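(* Let $\Theta=(R_i)_{i\in I}$ be a sequence of finitary relational symbols and $<$ a binary relational symbol not in $\Theta$. Let $\mathbf{F}$ be a set of irreducible finite linearly ordered $\Theta$-structures. If at least one of the sets $I$, $\mathbf{F}$ is finite, then $\mathrm{Forb}_{\mathbf{Rel}(\Theta,<)}(\mathbf{F})$ has the canonical Ramsey property.
   Context: A linearly ordered $\Theta$-structure is $\mathcal{A}=(A,(R_i^{\mathcal{A}})_{i\in I},<^{\mathcal{A}})$ with $R_i^{\mathcal{A}}\subseteq A^{r_i}$ ($r_i$ the arity of $R_i$) and $<^{\mathcal{A}}$ a linear order on $A$. $\mathbf{Rel}(\Theta,<)$ is the category of finite linearly ordered $\Theta$-structures (including the empty one) with embeddings as morphisms (injective maps preserving and reflecting every $R_i$ and the order). A finite such structure is irreducible if for all distinct $a,b\in A$ there are $i\in I$ and $(x_1,\dots,x_{r_i})\in R_i^{\mathcal{A}}$ with $x_p=a$, $x_q=b$ for some $p,q$. $\mathrm{Forb}_{\mathbf{C}}(\mathbf{F})$ is the full subcategory of $\mathbf{C}$ on the objects $A$ with $\hom_{\mathbf{C}}(F,A)=\varnothing$ for all $F\in\mathbf{F}$. For objects $A,B,C$ of a category, $C\xrightarrow{can}(B)^A$ means: for every $\chi:\hom(A,C)\to\omega$ there exist $w\in\hom(B,C)$, an object $Q$ and $q\in\hom(Q,A)$ such that for all $f,g\in\hom(A,B)$, $\chi(w\cdot f)=\chi(w\cdot g)$ iff $f\cdot q=g\cdot q$. A category has the canonical Ramsey property if for all objects $A,B$ with $\hom(A,B)\neq\varnothing$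 there is an object $C$ with $C\xrightarrow{can}(B)^A$. *)

theory Defs
  imports Main "HOL-Library.FuncSet" "HOL-Library.Infinite_Typeclass"
begin

text \<open>Morphisms carry no domain or codomain of their own, so
  \<open>Comp K A B C g f\<close>, the composite of \<open>f \<in> Hom K A B\<close> and \<open>g \<in> Hom K B C\<close>,
  takes the three objects as arguments.\<close>

record ('o, 'm) category =
  Obj :: "'o set"
  Hom :: "'o \<Rightarrow> 'o \<Rightarrow> 'm set"
  Ident :: "'o \<Rightarrow> 'm"
  Comp :: "'o \<Rightarrow> 'o \<Rightarrow> 'o \<Rightarrow> 'm \<Rightarrow> 'm \<Rightarrow> 'm"

definition is_category :: "('o, 'm) category \<Rightarrow> bool" where
  "is_category K \<longleftrightarrow>
     (\<forall>A\<in>Obj K. Ident K A \<in> Hom K A A) \<and>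
     (\<forall>A\<in>Obj K. \<forall>B\<in>Obj K. \<forall>C\<in>Obj K. \<forall>f\<in>Hom K A B. \<forall>g\<in>Hom K B C.
        Comp K A B C g f \<in> Hom K A C) \<and>
     (\<forall>A\<in>Obj K. \<forall>B\<in>Obj K. \<forall>f\<in>Hom K A B.
        Comp K A A B f (Ident K A) = f \<and> Comp K A B B (Ident K B) f = f) \<and>
     (\<forall>A\<in>Obj K. \<forall>B\<in>Obj K. \<forall>C\<in>Obj K. \<forall>D\<in>Obj K.
        \<forall>f\<in>Hom K A B. \<forall>g\<in>Hom K B C. \<forall>h\<in>Hom K C D.
        Comp K A C D h (Comp K A B C g f) = Comp K A B D (Comp K B C D h g) f)"

definition full_subcategory :: "('o, 'm) category \<Rightarrow> 'o set \<Rightarrow> ('o, 'm) category" where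
  "full_subcategory K S = K\<lparr>Obj := Obj K \<inter> S\<rparr>"

definition Forb :: "('o, 'm) category \<Rightarrow> 'o set \<Rightarrow> ('o, 'm) category" where
  "Forb K \<F> = full_subcategory K {A. \<forall>F\<in>\<F>. Hom K F A = {}}"

text \<open>\<open>can_arrow K C B A\<close> is \<open>C \<longrightarrow> (B)\<^sup>A\<close> in the canonical sense. The colouring is a
  total function on the type of morphisms; only its values on \<open>Hom K A C\<close> are used.\<close>

definition can_arrow :: "('o, 'm) category \<Rightarrow> 'o \<Rightarrow> 'o \<Rightarrow> 'o \<Rightarrow> bool" where
  "can_arrow K C B A \<longleftrightarrow>
     (\<forall>\<chi> :: 'm \<Rightarrow> nat. \<exists>w\<in>Hom K B C. \<exists>Q\<in>Obj K. \<exists>q\<in>Hom K Q A.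
        \<forall>f\<in>Hom K A B. \<forall>g\<in>Hom K A B.
          \<chi> (Comp K A B C w f) = \<chi> (Comp K A B C w g) \<longleftrightarrow>
          Comp K Q A B f q = Comp K Q A B g q)"

definition canonical_Ramsey_property :: "('o, 'm) category \<Rightarrow> bool" where
  "canonical_Ramsey_property K \<longleftrightarrow>
     (\<forall>A\<in>Obj K. \<forall>B\<in>Obj K. Hom K A B \<noteq> {} \<longrightarrow> (\<exists>C\<in>Obj K. can_arrow K C B A))"

text \<open>The signature is given by an index set \<open>I\<close> and an arity function \<open>r\<close>; tuples are lists.\<close>

record ('a, 'i) ord_struct =
  univ :: "'a set"
  rel :: "'i \<Rightarrow> 'a list set"
  less_rel :: "('a \<times> 'a) set"

definition tuples :: "'a set \<Rightarrow> nat \<Rightarrow> 'a list set" where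
  "tuples A n = {xs. set xs \<subseteq> A \<and> length xs = n}"

text \<open>Relations at indices outside \<open>I\<close> are required to be empty, so that equality (and hence
  finiteness of a set of structures) is not affected by values that carry no meaning.\<close>

definition finite_ord_struct :: "'i set \<Rightarrow> ('i \<Rightarrow> nat) \<Rightarrow> ('a, 'i) ord_struct \<Rightarrow> bool" where
  "finite_ord_struct I r A \<longleftrightarrow>
     finite (univ A) \<and>
     (\<forall>i\<in>I. rel A i \<subseteq> tuples (univ A) (r i)) \<and>
     (\<forall>i. i \<notin> I \<longrightarrow> rel A i = {}) \<and>
     less_rel A \<subseteq> univ A \<times> univ A \<and>
     strict_linear_order_on (univ A) (less_rel A)"

text \<open>Embeddings are extensional functions, so that equality of morphisms is equality of maps
  on the universe of the domain.\<close>

definition embeddings ::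
  "'i set \<Rightarrow> ('i \<Rightarrow> nat) \<Rightarrow> ('a, 'i) ord_struct \<Rightarrow> ('a, 'i) ord_struct \<Rightarrow> ('a \<Rightarrow> 'a) set" where
  "embeddings I r A B =
     {f \<in> univ A \<rightarrow>\<^sub>E univ B. inj_on f (univ A) \<and>
        (\<forall>i\<in>I. \<forall>xs\<in>tuples (univ A) (r i). xs \<in> rel A i \<longleftrightarrow> map f xs \<in> rel B i) \<and>
        (\<forall>x\<in>univ A. \<forall>y\<in>univ A. (x, y) \<in> less_rel A \<longleftrightarrow> (f x, f y) \<in> less_rel B)}"

text \<open>The universes are the finite subsets of \<open>'a\<close>. For infinite \<open>'a\<close> every finite structure
  has an isomorphic copy among them.\<close>

definition Rel_cat ::
  "'i set \<Rightarrow> ('i \<Rightarrow> nat) \<Rightarrow> (('a::infinite, 'i) ord_struct, 'a \<Rightarrow> 'a) category" where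
  "Rel_cat I r =
     \<lparr>Obj = {A. finite_ord_struct I r A},
      Hom = embeddings I r,
      Ident = (\<lambda>A. restrict id (univ A)),
      Comp = (\<lambda>A B C g f. compose (univ A) g f)\<rparr>"

definition irreducible_struct :: "'i set \<Rightarrow> ('a, 'i) ord_struct \<Rightarrow> bool" where
  "irreducible_struct I A \<longleftrightarrow>
     (\<forall>a\<in>univ A. \<forall>b\<in>univ A. a \<noteq> b \<longrightarrow>
        (\<exists>i\<in>I. \<exists>xs\<in>rel A i. \<exists>p<length xs. \<exists>q<length xs. xs ! p = a \<and> xs ! q = b))"

lemma embeddings_compose:
  assumes f: "f \<in> embeddings I r A B" and g: "g \<in> embeddings I r B C"
  shows "compose (univ A) g f \<in> embeddings I r A C"
proof -
  have fm: "f x \<in> univ B" if "x \<in> univ A" for x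
    using f that by (auto simp: embeddings_def)
  have inj: "inj_on (compose (univ A) g f) (univ A)"
    using f g fm by (auto simp: embeddings_def inj_on_def compose_def)
  have "xs \<in> rel A i \<longleftrightarrow> map (compose (univ A) g f) xs \<in> rel C i"
    if i: "i \<in> I" and xs: "xs \<in> tuples (univ A) (r i)" for i xs
  proof -
    have eq: "map (compose (univ A) g f) xs = map g (map f xs)"
      using xs by (auto simp: tuples_def compose_def)
    have "map f xs \<in> tuples (univ B) (r i)"
      using xs fm by (auto simp: tuples_def)
    then have "map f xs \<in> rel B i \<longleftrightarrow> map g (map f xs) \<in> rel C i"
      using g i unfolding embeddings_def by blast
    moreover have "xs \<in> rel A i \<longleftrightarrow> map f xs \<in> rel B i"
      using f i xs unfolding embeddings_def by blast
    ultimately show ?thesis by (simp only: eq)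
  qed
  moreover have "compose (univ A) g f \<in> univ A \<rightarrow>\<^sub>E univ C"
    using g fm by (auto simp: embeddings_def compose_def)
  moreover have "(x, y) \<in> less_rel A \<longleftrightarrow>
      (compose (univ A) g f x, compose (univ A) g f y) \<in> less_rel C"
    if "x \<in> univ A" "y \<in> univ A" for x y
    using f g fm that by (auto simp: embeddings_def compose_def)
  ultimately show ?thesis
    using inj unfolding embeddings_def by blast
qed

lemma embeddings_ident: "restrict id (univ A) \<in> embeddings I r A A"
proof -
  have "map (restrict id (univ A)) xs = xs" if "xs \<in> tuples (univ A) n" for xs n
    using that by (auto simp: tuples_def intro!: map_idI)
  then show ?thesis
    by (auto simp: embeddings_def inj_on_def)
qed

lemma is_category_Rel_cat: "is_category (Rel_cat I r)"
proof -
  have fm: "f x \<in> univ B" if "f \<in> embeddings I r A B" "x \<in> univ A"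
    for f x and A B :: "('a, 'b) ord_struct"
    using that by (auto simp: embeddings_def)
  have ext: "f x = undefined" if "f \<in> embeddings I r A B" "x \<notin> univ A"
    for f x and A B :: "('a, 'b) ord_struct"
    using that by (auto simp: embeddings_def)
  show ?thesis
    unfolding is_category_def Rel_cat_def
    by (auto simp: embeddings_compose embeddings_ident)
       (auto simp: compose_def fun_eq_iff fm ext)
qed

lemma is_category_full_subcategory:
  "is_category K \<Longrightarrow> is_category (full_subcategory K S)"
  unfolding is_category_def full_subcategory_def by simp

lemma is_category_Forb: "is_category K \<Longrightarrow> is_category (Forb K \<F>)"
  unfolding Forb_def by (rule is_category_full_subcategory)

end

theory Submission
  imports Defs "HOL-Library.Ramsey"
begin

text \<open>The classical Ramsey property (Nesetril--Rodl) comes from the partite construction, with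
  Hales--Jewett as the partite lemma. It is run twice: first over a long linear order, which gives
  a Ramsey structure \<open>Y\<close> that may contain forbidden structures, then over \<open>Y\<close>, where every
  irreducible substructure of the result already embeds into \<open>A\<close> or \<open>B\<close>.

  For canonical colourings, \<open>B\<close> is first enlarged by finitely many levels of twins of its elements
  to a structure \<open>M\<close>. Applying the Ramsey property to all \<open>f(A) \<union> g(A)\<close> with \<open>f, g : A \<rightarrow> M\<close> one may
  assume that whether \<open>f\<close> and \<open>g\<close> get the same colour depends only on the isomorphism type of the
  pair. Call \<open>a \<in> A\<close> irrelevant if moving \<open>f(a)\<close> to a free twin does not change the colour.
  Twins show that \<open>f\<close> and \<open>g\<close> of equal colour agree on the relevant elements. Conversely, moving
  all irrelevant elements twice brings \<open>f\<close> into general position over its relevant part without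
  changing its colour, so the colour depends on the relevant part only.\<close>

section \<open>The Hales--Jewett theorem\<close>

text \<open>A colouring may use infinitely many colours, so no Ramsey statement applies to it
  directly. What gets coloured is the truth value of "the images of f and g have the same colour",
  and therefore two colours suffice in the classical part. Forbidden structures are kept out through
  irreducibility. In the partite power a tuple with a vertex off the base lies in one copy, and a
  twin shares no tuple with the element that it doubles, so irreducible substructures can be pulled
  back to structures that are already allowed. The place of a twin in the order is delicate. Put
  next to f(a), it would betray f(a) through the old vertices nearby. Put just below the next
  element of f(A), it compares with the old vertices in a way that depends only on elements above a.
  If the largest irrelevant elements are moved first, only relevant ones remain in this description.
  This is what makes the moved copies of two embeddings with equal relevant part indistinguishable
  over the old vertices.\<close>

lemma finite_tuples: "finite A \<Longrightarrow> finite (tuples A n)"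
  unfolding tuples_def by (rule finite_lists_length_eq)

text \<open>A list over the option type is a variable word: \<open>None\<close> is the variable,
  \<open>Some b\<close> a fixed letter. Its instances at all letters form a combinatorial
  line.\<close>

definition inst :: "'b option list \<Rightarrow> 'b \<Rightarrow> 'b list" where
  "inst L a = map (case_option a id) L"

definition vwords :: "'b set \<Rightarrow> nat \<Rightarrow> 'b option list set" where
  "vwords S N = {L \<in> tuples (insert None (Some ` S)) N. None \<in> set L}"

lemma finite_vwords: "finite S \<Longrightarrow> finite (vwords S N)"
  unfolding vwords_def by (simp add: finite_tuples)

lemma set_inst: "set L \<subseteq> insert None (Some ` S) \<Longrightarrow> a \<in> S \<Longrightarrow> set (inst L a) \<subseteq> S"
  by (auto simp: inst_def split: option.splits)

lemma inst_in_tuples: "L \<in> vwords S N \<Longrightarrow> a \<in> S \<Longrightarrow> inst L a \<in> tuples S N"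
  using set_inst[of L S a] by (auto simp: vwords_def tuples_def) (simp add: inst_def)

text \<open>One variable word per block parametrises a combinatorial subspace; its points are the
  words with one letter per block.\<close>

fun inst_blocks :: "'b option list list \<Rightarrow> 'b list \<Rightarrow> 'b list" where
  "inst_blocks (L # Ls) (a # w) = inst L a @ inst_blocks Ls w"
| "inst_blocks _ _ = []"

text \<open>A line of the subspace, seen as a line of the surrounding cube: blocks at the variable
  keep their own variable, the others are filled in.\<close>

fun subst_blocks :: "'b option list list \<Rightarrow> 'b option list \<Rightarrow> 'b option list" where
  "subst_blocks (L # Ls) (t # T) =
     (case t of None \<Rightarrow> L | Some b \<Rightarrow> map Some (inst L b)) @ subst_blocks Ls T"
| "subst_blocks _ _ = []"

lemma inst_subst_blocks: "inst (subst_blocks Ls T) a = inst_blocks Ls (inst T a)"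
  by (induction Ls T rule: subst_blocks.induct) (auto simp: inst_def split: option.splits)

lemma length_subst_blocks:
  "length T = length Ls \<Longrightarrow> length (subst_blocks Ls T) = sum_list (map length Ls)"
  by (induction Ls T rule: list_induct2')
     (auto simp: inst_def split: option.splits)

lemma length_inst_blocks:
  "length w = length Ls \<Longrightarrow> length (inst_blocks Ls w) = sum_list (map length Ls)"
  by (induction Ls w rule: list_induct2') (auto simp: inst_def)

lemma set_inst_blocks:
  "length w = length Ls \<Longrightarrow> set w \<subseteq> S \<Longrightarrow> \<forall>L\<in>set Ls. set L \<subseteq> insert None (Some ` S) \<Longrightarrow>
   set (inst_blocks Ls w) \<subseteq> S"
proof (induction Ls w rule: list_induct2')
  case (4 L Ls a w)
  then show ?case using set_inst[of L S a] by simp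
qed auto

lemma set_subst_blocks:
  "length T = length Ls \<Longrightarrow> set T \<subseteq> insert None (Some ` S) \<Longrightarrow>
   \<forall>L\<in>set Ls. set L \<subseteq> insert None (Some ` S) \<Longrightarrow>
   set (subst_blocks Ls T) \<subseteq> insert None (Some ` S)"
proof (induction Ls T rule: list_induct2')
  case (4 L Ls t T)
  then have "set (subst_blocks Ls T) \<subseteq> insert None (Some ` S)"
    by simp
  moreover have "set (inst L b) \<subseteq> S" if "t = Some b" for b
    using set_inst[of L S b] that 4(3,4) by auto
  ultimately show ?case
    using 4(4) by (cases t) auto
qed auto

lemma None_in_subst_blocks:
  "length T = length Ls \<Longrightarrow> None \<in> set T \<Longrightarrow> \<forall>L\<in>set Ls. None \<in> set L \<Longrightarrow>
   None \<in> set (subst_blocks Ls T)"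
  by (induction Ls T rule: list_induct2') auto

text \<open>Makes colourings whose colours are functions available to statements about bounded
  natural numbers; only the colour classes matter.\<close>

lemma nat_colouring:
  assumes "finite Y" "F ` X \<subseteq> Y"
  obtains \<chi> :: "'x \<Rightarrow> nat" where "\<And>x. x \<in> X \<Longrightarrow> \<chi> x < card Y"
    "\<And>x y. x \<in> X \<Longrightarrow> y \<in> X \<Longrightarrow> \<chi> x = \<chi> y \<longleftrightarrow> F x = F y"
proof -
  obtain h where h: "bij_betw h Y {0..<card Y}"
    using ex_bij_betw_finite_nat[OF assms(1)] by blast
  show thesis
  proof (rule that[of "h \<circ> F"])
    show "(h \<circ> F) x < card Y" if "x \<in> X" for x
      using bij_betwE[OF h] assms(2) that by auto
    show "((h \<circ> F) x = (h \<circ> F) y) = (F x = F y)" if "x \<in> X" "y \<in> X" for x y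
      using inj_on_eq_iff[OF bij_betw_imp_inj_on[OF h]] assms(2) that by auto
  qed
qed

text \<open>Shelah's cube lemma: each block is a line joining two of the words
  \<open>t \<dots> t s \<dots> s\<close>, found by the pigeonhole principle.\<close>

lemma insensitive_blocks:
  assumes S: "finite S" "s \<in> S" "t \<in> S"
  shows "\<exists>N. \<forall>\<chi> :: 'b list \<Rightarrow> nat. (\<forall>w\<in>tuples S N. \<chi> w < q) \<longrightarrow>
    (\<exists>Ls. length Ls = n \<and> sum_list (map length Ls) = N \<and>
       (\<forall>L\<in>set Ls. set L \<subseteq> insert None (Some ` S) \<and> None \<in> set L) \<and>
       (\<forall>u v. set u \<subseteq> S \<longrightarrow> set v \<subseteq> S \<longrightarrow> length u + Suc (length v) = n \<longrightarrow>
          \<chi> (inst_blocks Ls (u @ s # v)) = \<chi> (inst_blocks Ls (u @ t # v))))"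
proof (induction n arbitrary: q)
  case 0
  show ?case by (rule exI[of _ 0]) auto
next
  case (Suc n)
  \<comment> \<open>\<open>M\<close> counts the colourings of words of length \<open>n\<close>, so
    the \<open>M + 1\<close> words \<open>v 0\<close>, ..., \<open>v M\<close> cannot all induce
    different ones. The remaining blocks are found for \<open>card Y\<close> colours, because such a
    colour records the effect of every first block at once.\<close>
  define M where "M = card (tuples S n \<rightarrow>\<^sub>E {..<q})"
  define Y where "Y = (tuples S M \<rightarrow>\<^sub>E {..<q})"
  have finY: "finite Y" unfolding Y_def using S by (intro finite_PiE finite_tuples) auto
  obtain N where N: "\<And>\<chi> :: 'b list \<Rightarrow> nat. (\<forall>w\<in>tuples S N. \<chi> w < card Y) \<Longrightarrow>
    (\<exists>Ls. length Ls = n \<and> sum_list (map length Ls) = N \<and>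
       (\<forall>L\<in>set Ls. set L \<subseteq> insert None (Some ` S) \<and> None \<in> set L) \<and>
       (\<forall>u v. set u \<subseteq> S \<longrightarrow> set v \<subseteq> S \<longrightarrow> length u + Suc (length v) = n \<longrightarrow>
          \<chi> (inst_blocks Ls (u @ s # v)) = \<chi> (inst_blocks Ls (u @ t # v))))"
    using Suc.IH[of "card Y"] by blast
  show ?case
  proof (intro exI[of _ "M + N"] allI impI)
    fix \<chi> :: "'b list \<Rightarrow> nat"
    assume \<chi>: "\<forall>w\<in>tuples S (M + N). \<chi> w < q"
    define F where "F = (\<lambda>u. \<lambda>v\<in>tuples S M. \<chi> (v @ u))"
    have FY: "F ` tuples S N \<subseteq> Y"
    proof -
      have "v @ u \<in> tuples S (M + N)" if "u \<in> tuples S N" "v \<in> tuples S M" for u v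
        using that by (auto simp: tuples_def)
      then show ?thesis unfolding F_def Y_def using \<chi> by auto
    qed
    obtain \<chi>1 where \<chi>1: "\<And>x. x \<in> tuples S N \<Longrightarrow> \<chi>1 x < card Y"
      "\<And>x y. x \<in> tuples S N \<Longrightarrow> y \<in> tuples S N \<Longrightarrow> \<chi>1 x = \<chi>1 y \<longleftrightarrow> F x = F y"
      using nat_colouring[OF finY FY] by blast
    obtain Ls where Ls: "length Ls = n" "sum_list (map length Ls) = N"
       "\<forall>L\<in>set Ls. set L \<subseteq> insert None (Some ` S) \<and> None \<in> set L"
      and ins: "\<And>u v. set u \<subseteq> S \<Longrightarrow> set v \<subseteq> S \<Longrightarrow> length u + Suc (length v) = n \<Longrightarrow>
          \<chi>1 (inst_blocks Ls (u @ s # v)) = \<chi>1 (inst_blocks Ls (u @ t # v))"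
      using N[of \<chi>1] \<chi>1(1) by blast
    have blocks: "inst_blocks Ls w \<in> tuples S N" if "w \<in> tuples S n" for w
      using that Ls set_inst_blocks[of w Ls S] length_inst_blocks[of w Ls]
      by (auto simp: tuples_def)
    define v where "v = (\<lambda>i. replicate i t @ replicate (M - i) s)"
    have v: "v i \<in> tuples S M" if "i \<le> M" for i
      using that S by (auto simp: v_def tuples_def)
    define G where "G = (\<lambda>i. \<lambda>u\<in>tuples S n. \<chi> (v i @ inst_blocks Ls u))"
    have "v i @ inst_blocks Ls u \<in> tuples S (M + N)" if "i \<le> M" "u \<in> tuples S n" for i u
      using v[OF that(1)] blocks[OF that(2)] by (auto simp: tuples_def)
    then have "G ` {..M} \<subseteq> (tuples S n \<rightarrow>\<^sub>E {..<q})"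
      using \<chi> by (auto simp: G_def)
    then have "card (G ` {..M}) \<le> M"
      unfolding M_def using S by (intro card_mono finite_PiE finite_tuples) auto
    then have "\<not> inj_on G {..M}"
      using pigeonhole[of G "{..M}"] by simp
    then obtain i j where ij: "i < j" "j \<le> M" "G i = G j"
      unfolding inj_on_def by (metis atMost_iff linorder_neqE_nat)
    \<comment> \<open>The variable occupies exactly the positions where \<open>v i\<close> has
      \<open>s\<close> and \<open>v j\<close> has \<open>t\<close>.\<close>
    define L where "L = replicate i (Some t) @ replicate (j - i) None @ replicate (M - j) (Some s)"
    have inst_s: "inst L s = v i"
    proof -
      have "M - i = (j - i) + (M - j)" using ij by simp
      then show ?thesis by (simp add: L_def v_def inst_def replicate_add)
    qed
    have inst_t: "inst L t = v j"
    proof -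
      have "replicate j t = replicate (i + (j - i)) t" using ij by simp
      then show ?thesis by (simp add: L_def v_def inst_def replicate_add)
    qed
    have len: "length L = M" using ij by (simp add: L_def)
    have setL: "set L \<subseteq> insert None (Some ` S)" "None \<in> set L"
      using ij S by (auto simp: L_def)
    have L_vw: "L \<in> vwords S M"
      using len setL by (simp add: vwords_def tuples_def)
    show "\<exists>Ls. length Ls = Suc n \<and> sum_list (map length Ls) = M + N \<and>
       (\<forall>L\<in>set Ls. set L \<subseteq> insert None (Some ` S) \<and> None \<in> set L) \<and>
       (\<forall>u v. set u \<subseteq> S \<longrightarrow> set v \<subseteq> S \<longrightarrow> length u + Suc (length v) = Suc n \<longrightarrow>
          \<chi> (inst_blocks Ls (u @ s # v)) = \<chi> (inst_blocks Ls (u @ t # v)))"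
    proof (intro exI[of _ "L # Ls"] conjI allI impI)
      fix u w assume uw: "set u \<subseteq> S" "set w \<subseteq> S" "length u + Suc (length w) = Suc n"
      show "\<chi> (inst_blocks (L # Ls) (u @ s # w)) = \<chi> (inst_blocks (L # Ls) (u @ t # w))"
      proof (cases u)
        case Nil
        then have w: "w \<in> tuples S n" using uw by (auto simp: tuples_def)
        have "G i w = G j w" using ij by simp
        then show ?thesis using w Nil by (simp add: G_def inst_s inst_t)
      next
        case (Cons b u')
        have 1: "u' @ s # w \<in> tuples S n" "u' @ t # w \<in> tuples S n"
          using uw Cons S by (auto simp: tuples_def)
        have "\<chi>1 (inst_blocks Ls (u' @ s # w)) = \<chi>1 (inst_blocks Ls (u' @ t # w))"
          using uw Cons by (intro ins) auto
        then have "F (inst_blocks Ls (u' @ s # w)) = F (inst_blocks Ls (u' @ t # w))"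
          using \<chi>1(2) blocks 1 by blast
        from fun_cong[OF this, of "inst L b"] show ?thesis
          using inst_in_tuples[OF L_vw, of b] uw Cons by (simp add: F_def)
      qed
    qed (use Ls len setL in auto)
  qed
qed

text \<open>Induction on the alphabet. In a subspace that does not distinguish \<open>s\<close> from
  \<open>t\<close>, a line that is monochromatic over the smaller alphabet has the same colour at
  \<open>s\<close>, as \<open>s\<close> may be replaced by \<open>t\<close>. If the smaller alphabet
  is empty, there is no such \<open>t\<close>, hence the separate case.\<close>

theorem Hales_Jewett:
  assumes "finite S"
  shows "\<exists>N. \<forall>\<chi> :: 'b list \<Rightarrow> nat. (\<forall>w\<in>tuples S N. \<chi> w < q) \<longrightarrow>
    (\<exists>L\<in>vwords S N. \<forall>a\<in>S. \<forall>b\<in>S. \<chi> (inst L a) = \<chi> (inst L b))"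
  using assms
proof (induction S rule: finite_induct)
  case empty
  show ?case
    by (rule exI[of _ 1]) (auto simp: vwords_def tuples_def intro!: exI[of _ "[None]"])
next
  case (insert s S)
  show ?case
  proof (cases "S = {}")
    case True
    then show ?thesis
      by (intro exI[of _ 1]) (auto simp: vwords_def tuples_def intro!: exI[of _ "[None]"])
  next
    case False
    then obtain t where t: "t \<in> S" by blast
    obtain n where n: "\<And>\<chi> :: 'b list \<Rightarrow> nat. (\<forall>w\<in>tuples S n. \<chi> w < q) \<Longrightarrow>
        (\<exists>L\<in>vwords S n. \<forall>a\<in>S. \<forall>b\<in>S. \<chi> (inst L a) = \<chi> (inst L b))"
      using insert.IH by blast
    obtain N where N: "\<And>\<chi> :: 'b list \<Rightarrow> nat. (\<forall>w\<in>tuples (insert s S) N. \<chi> w < q) \<Longrightarrow>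
      (\<exists>Ls. length Ls = n \<and> sum_list (map length Ls) = N \<and>
       (\<forall>L\<in>set Ls. set L \<subseteq> insert None (Some ` insert s S) \<and> None \<in> set L) \<and>
       (\<forall>u v. set u \<subseteq> insert s S \<longrightarrow> set v \<subseteq> insert s S \<longrightarrow> length u + Suc (length v) = n \<longrightarrow>
          \<chi> (inst_blocks Ls (u @ s # v)) = \<chi> (inst_blocks Ls (u @ t # v))))"
      using insensitive_blocks[of "insert s S" s t q n] insert.hyps t by blast
    show ?thesis
    proof (intro exI[of _ N] allI impI)
      fix \<chi> :: "'b list \<Rightarrow> nat"
      assume \<chi>: "\<forall>w\<in>tuples (insert s S) N. \<chi> w < q"
      obtain Ls where Ls: "length Ls = n" "sum_list (map length Ls) = N"
        "\<forall>L\<in>set Ls. set L \<subseteq> insert None (Some ` insert s S) \<and> None \<in> set L"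
        and ins: "\<And>u v. set u \<subseteq> insert s S \<Longrightarrow> set v \<subseteq> insert s S \<Longrightarrow>
          length u + Suc (length v) = n \<Longrightarrow>
          \<chi> (inst_blocks Ls (u @ s # v)) = \<chi> (inst_blocks Ls (u @ t # v))"
        using N[OF \<chi>] by blast
      have "inst_blocks Ls w \<in> tuples (insert s S) N" if "w \<in> tuples S n" for w
        using that Ls set_inst_blocks[of w Ls "insert s S"] length_inst_blocks[of w Ls]
        by (auto simp: tuples_def)
      then obtain T where T: "T \<in> vwords S n"
        and mono: "\<And>a b. a \<in> S \<Longrightarrow> b \<in> S \<Longrightarrow>
          \<chi> (inst_blocks Ls (inst T a)) = \<chi> (inst_blocks Ls (inst T b))"
        using n[of "\<lambda>w. \<chi> (inst_blocks Ls w)"] \<chi> by blast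
      \<comment> \<open>The letters at the variable positions are changed one at a time from the
        left; \<open>u\<close> is the part already treated.\<close>
      have swap: "\<chi> (inst_blocks Ls (u @ inst V s)) = \<chi> (inst_blocks Ls (u @ inst V t))"
        if "set u \<subseteq> insert s S" "set V \<subseteq> insert None (Some ` S)" "length u + length V = n" for u V
        using that
      proof (induction V arbitrary: u)
        case Nil
        then show ?case by (simp add: inst_def)
      next
        case (Cons x V)
        show ?case
        proof (cases x)
          case (Some b)
          then show ?thesis
            using Cons.IH[of "u @ [b]"] Cons.prems by (auto simp: inst_def)
        next
          case None
          have V: "set (inst V s) \<subseteq> insert s S"
            using Cons.prems by (auto simp: inst_def split: option.splits)
          have "\<chi> (inst_blocks Ls (u @ s # inst V s)) = \<chi> (inst_blocks Ls (u @ t # inst V s))"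
            using Cons.prems V by (intro ins) (auto simp: inst_def)
          also have "\<dots> = \<chi> (inst_blocks Ls ((u @ [t]) @ inst V t))"
            using Cons.IH[of "u @ [t]"] Cons.prems t by auto
          finally show ?thesis using None by (simp add: inst_def)
        qed
      qed
      have sT: "\<chi> (inst_blocks Ls (inst T s)) = \<chi> (inst_blocks Ls (inst T t))"
        using swap[of "[]" T] T by (simp add: vwords_def tuples_def)
      have "length T = length Ls" "set T \<subseteq> insert None (Some ` insert s S)" "None \<in> set T"
        using T Ls(1) by (auto simp: vwords_def tuples_def)
      then have "subst_blocks Ls T \<in> vwords (insert s S) N"
        using Ls(2,3) length_subst_blocks[of T Ls] set_subst_blocks[of T Ls "insert s S"]
          None_in_subst_blocks[of T Ls]
        by (simp add: vwords_def tuples_def)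
      moreover have "\<chi> (inst (subst_blocks Ls T) a) = \<chi> (inst (subst_blocks Ls T) t)"
        if "a \<in> insert s S" for a
        using that mono[OF _ t, of a] sT unfolding inst_subst_blocks by blast
      ultimately show "\<exists>L\<in>vwords (insert s S) N.
          \<forall>a\<in>insert s S. \<forall>b\<in>insert s S. \<chi> (inst L a) = \<chi> (inst L b)"
        by (intro bexI[of _ "subst_blocks Ls T"] ballI) auto
    qed
  qed
qed

section \<open>Ordered structures and embeddings\<close>

definition emb :: "'i set \<Rightarrow> ('a, 'i) ord_struct \<Rightarrow> ('b, 'i) ord_struct \<Rightarrow> ('a \<Rightarrow> 'b) \<Rightarrow> bool" where
  "emb J A B f \<longleftrightarrow> f \<in> univ A \<rightarrow> univ B \<and>
     (\<forall>i\<in>J. \<forall>xs. set xs \<subseteq> univ A \<longrightarrow> (map f xs \<in> rel B i \<longleftrightarrow> xs \<in> rel A i)) \<and>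
     (\<forall>x\<in>univ A. \<forall>y\<in>univ A. (f x, f y) \<in> less_rel B \<longleftrightarrow> (x, y) \<in> less_rel A)"

definition Emb :: "'i set \<Rightarrow> ('a, 'i) ord_struct \<Rightarrow> ('b, 'i) ord_struct \<Rightarrow> ('a \<Rightarrow> 'b) set" where
  "Emb J A B = {f \<in> extensional (univ A). emb J A B f}"

definition induced :: "('a, 'i) ord_struct \<Rightarrow> 'a set \<Rightarrow> ('a, 'i) ord_struct" where
  "induced M S = \<lparr>univ = S, rel = (\<lambda>i. {xs \<in> rel M i. set xs \<subseteq> S}), less_rel = less_rel M \<inter> S \<times> S\<rparr>"

lemma induced_simps [simp]:
  "univ (induced M S) = S"
  "xs \<in> rel (induced M S) i \<longleftrightarrow> xs \<in> rel M i \<and> set xs \<subseteq> S"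
  "(x, y) \<in> less_rel (induced M S) \<longleftrightarrow> (x, y) \<in> less_rel M \<and> x \<in> S \<and> y \<in> S"
  by (auto simp: induced_def)

lemma induced_induced: "T \<subseteq> S \<Longrightarrow> induced (induced M S) T = induced M T"
  by (auto simp: induced_def)

lemma finite_ord_structD:
  assumes "finite_ord_struct I r A"
  shows "finite (univ A)"
    and "xs \<in> rel A i \<Longrightarrow> set xs \<subseteq> univ A"
    and "xs \<in> rel A i \<Longrightarrow> length xs = r i"
    and "xs \<in> rel A i \<Longrightarrow> i \<in> I"
    and "(x, y) \<in> less_rel A \<Longrightarrow> x \<in> univ A"
    and "(x, y) \<in> less_rel A \<Longrightarrow> y \<in> univ A"
    and "(x, x) \<notin> less_rel A"
    and "(x, y) \<in> less_rel A \<Longrightarrow> (y, z) \<in> less_rel A \<Longrightarrow> (x, z) \<in> less_rel A"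
    and "(x, y) \<in> less_rel A \<Longrightarrow> (y, x) \<notin> less_rel A"
    and "x \<in> univ A \<Longrightarrow> y \<in> univ A \<Longrightarrow> x \<noteq> y \<Longrightarrow> (x, y) \<notin> less_rel A \<Longrightarrow> (y, x) \<in> less_rel A"
proof -
  note A = assms[unfolded finite_ord_struct_def]
  show "finite (univ A)" using A by blast
  have ri: "i \<in> I" "xs \<in> tuples (univ A) (r i)" if "xs \<in> rel A i" for xs i
    using A that by blast+
  then show "xs \<in> rel A i \<Longrightarrow> set xs \<subseteq> univ A" "xs \<in> rel A i \<Longrightarrow> length xs = r i"
    "xs \<in> rel A i \<Longrightarrow> i \<in> I"
    by (auto simp: tuples_def)
  show "(x, y) \<in> less_rel A \<Longrightarrow> x \<in> univ A" "(x, y) \<in> less_rel A \<Longrightarrow> y \<in> univ A"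
    using A by blast+
  have lin: "trans (less_rel A)" "irrefl (less_rel A)" "total_on (univ A) (less_rel A)"
    using A by (auto simp: strict_linear_order_on_def)
  show irr: "(x, x) \<notin> less_rel A" for x
    using lin(2) by (auto simp: irrefl_def)
  show tr: "(x, y) \<in> less_rel A \<Longrightarrow> (y, z) \<in> less_rel A \<Longrightarrow> (x, z) \<in> less_rel A" for x y z
    using lin(1) by (auto dest: transD)
  show "(x, y) \<in> less_rel A \<Longrightarrow> (y, x) \<notin> less_rel A"
    using irr tr by blast
  show "x \<in> univ A \<Longrightarrow> y \<in> univ A \<Longrightarrow> x \<noteq> y \<Longrightarrow> (x, y) \<notin> less_rel A \<Longrightarrow> (y, x) \<in> less_rel A"
    using lin(3) by (auto simp: total_on_def)
qed

lemma finite_ord_structI: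
  assumes "finite (univ A)"
    and "\<And>i xs. xs \<in> rel A i \<Longrightarrow> i \<in> I \<and> set xs \<subseteq> univ A \<and> length xs = r i"
    and "\<And>x y. (x, y) \<in> less_rel A \<Longrightarrow> x \<in> univ A \<and> y \<in> univ A"
    and "\<And>x. (x, x) \<notin> less_rel A"
    and "\<And>x y z. (x, y) \<in> less_rel A \<Longrightarrow> (y, z) \<in> less_rel A \<Longrightarrow> (x, z) \<in> less_rel A"
    and "\<And>x y. x \<in> univ A \<Longrightarrow> y \<in> univ A \<Longrightarrow> x \<noteq> y \<Longrightarrow> (x, y) \<in> less_rel A \<or> (y, x) \<in> less_rel A"
  shows "finite_ord_struct I r A"
proof -
  have "trans (less_rel A)" using assms(5) by (rule transI)
  moreover have "irrefl (less_rel A)" using assms(4) by (auto simp: irrefl_def)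
  moreover have "total_on (univ A) (less_rel A)" using assms(6) by (auto simp: total_on_def)
  ultimately show ?thesis
    using assms(1-3) unfolding finite_ord_struct_def strict_linear_order_on_def
    by (auto simp: tuples_def)
qed

lemma finite_ord_struct_induced:
  assumes "finite_ord_struct I r M" "S \<subseteq> univ M"
  shows "finite_ord_struct I r (induced M S)"
proof (rule finite_ord_structI)
  note D = finite_ord_structD[OF assms(1)]
  show "finite (univ (induced M S))"
    using D(1) assms(2) by (simp add: finite_subset)
  show "i \<in> I \<and> set xs \<subseteq> univ (induced M S) \<and> length xs = r i"
    if "xs \<in> rel (induced M S) i" for i xs
    using D(3,4)[of xs i] that by simp
  show "(x, z) \<in> less_rel (induced M S)"
    if "(x, y) \<in> less_rel (induced M S)" "(y, z) \<in> less_rel (induced M S)" for x y z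
    using D(8) that unfolding induced_simps by blast
  show "(x, y) \<in> less_rel (induced M S) \<or> (y, x) \<in> less_rel (induced M S)"
    if "x \<in> univ (induced M S)" "y \<in> univ (induced M S)" "x \<noteq> y" for x y
    using D(10) assms(2) that unfolding induced_simps by blast
qed (use finite_ord_structD(7)[OF assms(1)] in auto)

lemma embD:
  assumes "emb J A B f"
  shows "x \<in> univ A \<Longrightarrow> f x \<in> univ B"
    and "i \<in> J \<Longrightarrow> set xs \<subseteq> univ A \<Longrightarrow> map f xs \<in> rel B i \<longleftrightarrow> xs \<in> rel A i"
    and "x \<in> univ A \<Longrightarrow> y \<in> univ A \<Longrightarrow> (f x, f y) \<in> less_rel B \<longleftrightarrow> (x, y) \<in> less_rel A"
  using assms by (auto simp: emb_def)

lemma embI: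
  assumes "\<And>x. x \<in> univ A \<Longrightarrow> f x \<in> univ B"
    and "\<And>i xs. i \<in> J \<Longrightarrow> set xs \<subseteq> univ A \<Longrightarrow> map f xs \<in> rel B i \<longleftrightarrow> xs \<in> rel A i"
    and "\<And>x y. x \<in> univ A \<Longrightarrow> y \<in> univ A \<Longrightarrow> (f x, f y) \<in> less_rel B \<longleftrightarrow> (x, y) \<in> less_rel A"
  shows "emb J A B f"
  using assms by (auto simp: emb_def)

text \<open>Between strict linear orders, preserving the order already implies reflecting
  it.\<close>

lemma emb_monoI:
  assumes A: "finite_ord_struct I r A" and B: "finite_ord_struct I r B"
    and "\<And>x. x \<in> univ A \<Longrightarrow> f x \<in> univ B"
    and "\<And>i xs. i \<in> J \<Longrightarrow> set xs \<subseteq> univ A \<Longrightarrow> map f xs \<in> rel B i \<longleftrightarrow> xs \<in> rel A i"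
    and mono: "\<And>x y. (x, y) \<in> less_rel A \<Longrightarrow> (f x, f y) \<in> less_rel B"
  shows "emb J A B f"
proof (rule embI)
  fix x y assume "x \<in> univ A" "y \<in> univ A"
  then show "(f x, f y) \<in> less_rel B \<longleftrightarrow> (x, y) \<in> less_rel A"
    using mono finite_ord_structD(7,9,10)[OF A] finite_ord_structD(7,9,10)[OF B] by metis
qed (use assms in auto)

lemma emb_eq_iff:
  assumes A: "finite_ord_struct I r A" and B: "finite_ord_struct I r B" and f: "emb J A B f"
    and "x \<in> univ A" "y \<in> univ A"
  shows "f x = f y \<longleftrightarrow> x = y"
  using finite_ord_structD(7,10)[OF A] finite_ord_structD(7,10)[OF B] embD(3)[OF f] assms(4,5) by metis

lemma emb_inj_on:
  assumes "finite_ord_struct I r A" "finite_ord_struct I r B" "emb J A B f"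
  shows "inj_on f (univ A)"
  using emb_eq_iff[OF assms] by (auto simp: inj_on_def)

lemma emb_mono: "emb J A B f \<Longrightarrow> J' \<subseteq> J \<Longrightarrow> emb J' A B f"
  by (auto simp: emb_def)

lemma emb_comp:
  assumes f: "emb J A B f" and g: "emb J B C g"
  shows "emb J A C (g \<circ> f)"
proof (rule embI)
  fix i xs assume i: "i \<in> J" "set xs \<subseteq> univ A"
  then have "set (map f xs) \<subseteq> univ B" using embD(1)[OF f] by auto
  from embD(2)[OF g i(1) this] embD(2)[OF f i]
  show "map (g \<circ> f) xs \<in> rel C i \<longleftrightarrow> xs \<in> rel A i" by simp
qed (use embD(1,3)[OF f] embD(1,3)[OF g] in auto)

lemma emb_cancel:
  assumes gf: "emb J A C (g \<circ> f)" and g: "emb J B C g" and f: "\<And>x. x \<in> univ A \<Longrightarrow> f x \<in> univ B"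
  shows "emb J A B f"
proof (rule embI)
  fix i xs assume i: "i \<in> J" "set xs \<subseteq> univ A"
  then have "set (map f xs) \<subseteq> univ B" using f by auto
  from embD(2)[OF g i(1) this] embD(2)[OF gf i]
  show "map f xs \<in> rel B i \<longleftrightarrow> xs \<in> rel A i" by simp
qed (use f embD(3)[OF gf] embD(3)[OF g] in auto)

lemma emb_cong:
  assumes "\<And>x. x \<in> univ A \<Longrightarrow> f x = g x"
  shows "emb J A B f \<longleftrightarrow> emb J A B g"
proof -
  have imp: "emb J A B g" if "\<And>x. x \<in> univ A \<Longrightarrow> f x = g x" "emb J A B f" for f g
  proof (rule embI)
    fix i xs assume i: "i \<in> J" "set xs \<subseteq> univ A"
    then have "map g xs = map f xs" using that(1) by auto
    then show "map g xs \<in> rel B i \<longleftrightarrow> xs \<in> rel A i"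
      using embD(2)[OF that(2) i] by (simp only:)
  next
    show "g x \<in> univ B" if "x \<in> univ A" for x
      using embD(1)[OF \<open>emb J A B f\<close>] \<open>\<And>x. x \<in> univ A \<Longrightarrow> f x = g x\<close> that by metis
    show "(g x, g y) \<in> less_rel B \<longleftrightarrow> (x, y) \<in> less_rel A" if "x \<in> univ A" "y \<in> univ A" for x y
      using embD(3)[OF \<open>emb J A B f\<close>] \<open>\<And>x. x \<in> univ A \<Longrightarrow> f x = g x\<close> that by metis
  qed
  show ?thesis using imp[of f g] imp[of g f] assms by auto
qed

lemma emb_id: "emb J A A id"
  by (auto simp: emb_def)

lemma emb_induced: "S \<subseteq> univ M \<Longrightarrow> emb J (induced M S) M id"
  by (auto simp: emb_def)

lemma emb_into_induced:
  assumes f: "emb J A M f" and "f ` univ A \<subseteq> S" "S \<subseteq> univ M"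
  shows "emb J A (induced M S) f"
  using f assms(2,3) by (intro emb_cancel[of J A M id f, OF _ emb_induced]) auto

lemma Emb_iff: "f \<in> Emb J A B \<longleftrightarrow> f \<in> extensional (univ A) \<and> emb J A B f"
  by (simp add: Emb_def)

lemma Emb_emb: "f \<in> Emb J A B \<Longrightarrow> emb J A B f"
  by (simp add: Emb_def)

lemma compose_in_Emb: "emb J A B f \<Longrightarrow> emb J B C g \<Longrightarrow> compose (univ A) g f \<in> Emb J A C"
  using emb_comp[of J A B f C g] emb_cong[of A "compose (univ A) g f" "g \<circ> f" J C]
  by (auto simp: Emb_def compose_def)

lemma restrict_in_Emb: "emb J A B f \<Longrightarrow> restrict f (univ A) \<in> Emb J A B"
  using emb_cong[of A "restrict f (univ A)" f J B] by (auto simp: Emb_def)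

lemma compose_assoc':
  assumes "\<And>x. x \<in> A \<Longrightarrow> f x \<in> B"
  shows "compose A h (compose A g f) = compose A (compose B h g) f"
  using assms by (auto simp: compose_def restrict_def fun_eq_iff)

lemma finite_Emb:
  assumes "finite_ord_struct I r A" "finite_ord_struct I r B"
  shows "finite (Emb J A B)"
proof (rule finite_subset)
  show "Emb J A B \<subseteq> univ A \<rightarrow>\<^sub>E univ B"
    by (auto simp: Emb_def PiE_def dest: embD(1))
  show "finite (univ A \<rightarrow>\<^sub>E univ B)"
    using assms by (intro finite_PiE) (auto dest: finite_ord_structD(1))
qed

text \<open>The definitions differ in injectivity, which the order provides, and in lists of the
  wrong length, which no relation of either structure contains.\<close>

lemma embeddings_eq_Emb:
  assumes A: "finite_ord_struct I r A" and B: "finite_ord_struct I r B"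
  shows "embeddings I r A B = Emb I A B"
proof (intro set_eqI iffI)
  fix f assume f: "f \<in> embeddings I r A B"
  show "f \<in> Emb I A B"
    unfolding Emb_iff
  proof (intro conjI embI)
    fix i xs assume i: "i \<in> I" "set xs \<subseteq> univ A"
    show "map f xs \<in> rel B i \<longleftrightarrow> xs \<in> rel A i"
    proof (cases "length xs = r i")
      case True
      then show ?thesis using f i by (auto simp: embeddings_def tuples_def)
    next
      case False
      then show ?thesis using finite_ord_structD(3)[OF A] finite_ord_structD(3)[OF B] by fastforce
    qed
  qed (use f in \<open>auto simp: embeddings_def PiE_def\<close>)
next
  fix f assume f: "f \<in> Emb I A B"
  note e = Emb_emb[OF f]
  show "f \<in> embeddings I r A B"
    unfolding embeddings_def
    using emb_inj_on[OF A B e] embD[OF e] f by (auto simp: Emb_def tuples_def PiE_def)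
qed

text \<open>The constructions produce structures on lists and pairs, while the objects of the
  category live on one fixed infinite type. Results are carried back there along a bijection with a
  finite subset.\<close>

lemma transfer_ord_struct:
  fixes A :: "('b, 'i) ord_struct"
  assumes A: "finite_ord_struct I r A"
  obtains A' :: "('a::infinite, 'i) ord_struct" and \<phi> \<psi> where
    "finite_ord_struct I r A'" "\<And>J. emb J A A' \<phi>" "\<And>J. emb J A' A \<psi>"
    "\<And>x. x \<in> univ A \<Longrightarrow> \<psi> (\<phi> x) = x"
proof -
  note AD = finite_ord_structD[OF A]
  obtain T :: "'a set" where T: "finite T" "card T = card (univ A)"
    using infinite_arbitrarily_large[OF infinite_UNIV] by blast
  obtain \<phi> where \<phi>: "bij_betw \<phi> (univ A) T"
    using finite_same_card_bij[OF AD(1) T(1)] T(2) by auto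
  define \<psi> where "\<psi> = inv_into (univ A) \<phi>"
  have inv: "\<psi> (\<phi> x) = x" if "x \<in> univ A" for x
    using \<phi> that unfolding \<psi>_def by (simp add: bij_betw_inv_into_left)
  have inv': "\<phi> (\<psi> x) = x" "\<psi> x \<in> univ A" if "x \<in> T" for x
    using \<phi> that unfolding \<psi>_def
    by (auto simp: bij_betw_inv_into_right bij_betw_def inv_into_into)
  define A' where "A' = \<lparr>univ = T, rel = (\<lambda>i. {xs. set xs \<subseteq> T \<and> map \<psi> xs \<in> rel A i}),
     less_rel = {(x, y). x \<in> T \<and> y \<in> T \<and> (\<psi> x, \<psi> y) \<in> less_rel A}\<rparr>"
  have s: "univ A' = T" "xs \<in> rel A' i \<longleftrightarrow> set xs \<subseteq> T \<and> map \<psi> xs \<in> rel A i"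
    "(x, y) \<in> less_rel A' \<longleftrightarrow> x \<in> T \<and> y \<in> T \<and> (\<psi> x, \<psi> y) \<in> less_rel A" for xs i x y
    by (auto simp: A'_def)
  show thesis
  proof (rule that[of A' \<phi> \<psi>])
    show "finite_ord_struct I r A'"
    proof (rule finite_ord_structI)
      show "i \<in> I \<and> set xs \<subseteq> univ A' \<and> length xs = r i" if "xs \<in> rel A' i" for i xs
        using AD(3,4)[of "map \<psi> xs"] that by (auto simp: s)
      show "(x, y) \<in> less_rel A' \<or> (y, x) \<in> less_rel A'"
        if "x \<in> univ A'" "y \<in> univ A'" "x \<noteq> y" for x y
        using AD(10) inv' that unfolding s by metis
      show "(x, z) \<in> less_rel A'" if "(x, y) \<in> less_rel A'" "(y, z) \<in> less_rel A'" for x y z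
        using AD(8) that unfolding s by blast
      show "(x, x) \<notin> less_rel A'" for x
        using AD(7) by (simp add: s)
    qed (use T(1) in \<open>simp_all add: s\<close>)
    have mem: "\<phi> x \<in> T" if "x \<in> univ A" for x
      using \<phi> that by (auto simp: bij_betw_def)
    show "emb J A A' \<phi>" for J
    proof (rule embI)
      fix i xs assume "set xs \<subseteq> univ A"
      moreover from this have "map \<psi> (map \<phi> xs) = xs"
        using inv by (auto intro!: map_idI)
      ultimately show "map \<phi> xs \<in> rel A' i \<longleftrightarrow> xs \<in> rel A i"
        using mem unfolding s by auto
    qed (use inv mem in \<open>auto simp: s\<close>)
    show "emb J A' A \<psi>" for J
      by (rule embI) (use inv' in \<open>auto simp: s\<close>)
  qed (rule inv)
qed

text \<open>The two-colour Ramsey arrow for embeddings. It includes that \<open>B\<close> embeds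
  into \<open>C\<close>, even if \<open>A\<close> does not embed into \<open>B\<close>.\<close>

definition arrows ::
  "'i set \<Rightarrow> ('c, 'i) ord_struct \<Rightarrow> ('a, 'i) ord_struct \<Rightarrow> ('a, 'i) ord_struct \<Rightarrow> bool" where
  "arrows J C B A \<longleftrightarrow> (\<forall>\<chi> :: ('a \<Rightarrow> 'c) \<Rightarrow> bool. \<exists>w\<in>Emb J B C.
     \<forall>f\<in>Emb J A B. \<forall>g\<in>Emb J A B. \<chi> (compose (univ A) w f) = \<chi> (compose (univ A) w g))"

lemma irreducible_structD:
  assumes "irreducible_struct I F" "a \<in> univ F" "b \<in> univ F" "a \<noteq> b"
  obtains i xs where "i \<in> I" "xs \<in> rel F i" "a \<in> set xs" "b \<in> set xs"
proof -
  obtain i xs p q where "i \<in> I" "xs \<in> rel F i" "p < length xs" "q < length xs" "xs ! p = a" "xs ! q = b"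
    using assms unfolding irreducible_struct_def by metis
  then show thesis using that[of i xs] by (metis nth_mem)
qed

lemma irreducible_structI:
  assumes "\<And>a b. a \<in> univ F \<Longrightarrow> b \<in> univ F \<Longrightarrow> a \<noteq> b \<Longrightarrow>
    \<exists>i\<in>I. \<exists>xs\<in>rel F i. a \<in> set xs \<and> b \<in> set xs"
  shows "irreducible_struct I F"
  unfolding irreducible_struct_def using assms by (metis in_set_conv_nth)

text \<open>The invariant that keeps results inside \<open>Forb\<close>: a forbidden structure is
  irreducible, so if it embedded into \<open>C\<close>, it would embed into a member of
  \<open>\<D>\<close>.\<close>

definition irreducibles_within ::
  "'i set \<Rightarrow> ('i \<Rightarrow> nat) \<Rightarrow> ('a, 'i) ord_struct \<Rightarrow> ('a, 'i) ord_struct set \<Rightarrow> bool" where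
  "irreducibles_within I r C \<D> \<longleftrightarrow> (\<forall>(F :: ('a, 'i) ord_struct) \<phi>.
     finite_ord_struct I r F \<longrightarrow> irreducible_struct I F \<longrightarrow> emb I F C \<phi> \<longrightarrow> (\<exists>D\<in>\<D>. \<exists>\<phi>. emb I F D \<phi>))"

section \<open>The partite construction\<close>

text \<open>The fibres of \<open>\<pi>\<close> are the parts. Nothing is asked about relations,
  since in the first run \<open>Y\<close> is a bare linear order.\<close>

definition partite :: "('y, 'i) ord_struct \<Rightarrow> ('a, 'i) ord_struct \<Rightarrow> ('a \<Rightarrow> 'y) \<Rightarrow> bool" where
  "partite Y P \<pi> \<longleftrightarrow> \<pi> \<in> univ P \<rightarrow> univ Y \<and>
     (\<forall>x y. (x, y) \<in> less_rel P \<longrightarrow> (\<pi> x, \<pi> y) \<in> less_rel Y \<or> \<pi> x = \<pi> y)"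

text \<open>This condition survives the partite construction and keeps irreducible structures out.\<close>

definition hom_embedding :: "'f itself \<Rightarrow> 'i set \<Rightarrow> ('i \<Rightarrow> nat) \<Rightarrow> ('y, 'i) ord_struct \<Rightarrow>
    ('a, 'i) ord_struct \<Rightarrow> ('a \<Rightarrow> 'y) \<Rightarrow> bool" where
  "hom_embedding _ I r Y P \<pi> \<longleftrightarrow> (\<forall>(F :: ('f, 'i) ord_struct) \<phi>.
     finite_ord_struct I r F \<longrightarrow> irreducible_struct I F \<longrightarrow> emb I F P \<phi> \<longrightarrow> emb I F Y (\<pi> \<circ> \<phi>))"

lemma hom_embeddingD:
  fixes F :: "('f, 'i) ord_struct"
  assumes "hom_embedding TYPE('f) I r Y P \<pi>" "finite_ord_struct I r F" "irreducible_struct I F"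
    "emb I F P \<phi>"
  shows "emb I F Y (\<pi> \<circ> \<phi>)"
  using assms by (auto simp: hom_embedding_def)

lemma map_lexord:
  assumes "\<forall>t\<in>set L. f t = g t \<or> (f t, g t) \<in> R" "\<exists>t\<in>set L. f t \<noteq> g t"
  shows "(map f L, map g L) \<in> lexord R"
  using assms by (induction L) auto

lemma lexord_total:
  assumes "length xs = length ys" "set xs \<subseteq> X" "set ys \<subseteq> X" "xs \<noteq> ys"
    and "\<And>x y. x \<in> X \<Longrightarrow> y \<in> X \<Longrightarrow> x \<noteq> y \<Longrightarrow> (x, y) \<in> R \<or> (y, x) \<in> R"
  shows "(xs, ys) \<in> lexord R \<or> (ys, xs) \<in> lexord R"
  using assms(1-4)
proof (induction xs ys rule: list_induct2)
  case (Cons x xs y ys)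
  then show ?case using assms(5)[of x y] by (cases "x = y") auto
qed auto

text \<open>One step treats one position \<open>e\<close> of \<open>A\<close> in \<open>Y\<close>.
  The embeddings of \<open>A\<close> into \<open>P\<close> over \<open>e\<close> form the
  Hales--Jewett alphabet, and each line over it yields one copy of \<open>P\<close>.\<close>

locale partite_step =
  fixes I :: "'i set" and r :: "'i \<Rightarrow> nat"
    and A :: "('a, 'i) ord_struct" and P :: "('a, 'i) ord_struct"
    and Y :: "('y, 'i) ord_struct" and \<pi> :: "'a \<Rightarrow> 'y" and e :: "'a \<Rightarrow> 'y"
    and N :: nat and code :: "('a \<Rightarrow> 'a) option list \<Rightarrow> nat"
  assumes A: "finite_ord_struct I r A" and P: "finite_ord_struct I r P"
    and Y: "finite_ord_struct I r Y"
    and \<pi>: "partite Y P \<pi>" and e: "emb {} A Y e" and N: "0 < N"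
    and code: "inj_on code (vwords {\<alpha> \<in> Emb I A P. \<forall>a\<in>univ A. \<pi> (\<alpha> a) = e a} N)"
begin

definition letters :: "('a \<Rightarrow> 'a) set" where
  "letters = {\<alpha> \<in> Emb I A P. \<forall>a\<in>univ A. \<pi> (\<alpha> a) = e a}"

abbreviation lines :: "('a \<Rightarrow> 'a) option list set" where
  "lines \<equiv> vwords letters N"

definition base :: "'y set" where
  "base = e ` univ A"

text \<open>One coordinate of a line acts on a vertex: the variable keeps it, a letter \<alpha>
  replaces it by the vertex of \<alpha>(A) in the same part. Off the base that part has no vertex of
  \<alpha>(A), and the vertex is kept.\<close>

definition coord :: "('a \<Rightarrow> 'a) option \<Rightarrow> 'a \<Rightarrow> 'a" where
  "coord t x = (case t of None \<Rightarrow> x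
     | Some \<alpha> \<Rightarrow> if \<pi> x \<in> base then \<alpha> (inv_into (univ A) e (\<pi> x)) else x)"

text \<open>Copies of \<open>P\<close> share the vertices that lie over the base; the other vertices
  are kept apart by the code of the line.\<close>

definition copy :: "('a \<Rightarrow> 'a) option list \<Rightarrow> 'a \<Rightarrow> 'a list \<times> nat" where
  "copy L x = (map (\<lambda>t. coord t x) L, if \<pi> x \<in> base then 0 else code L)"

text \<open>All coordinates of a vertex lie in the same part, so the first one determines it;
  \<open>0 < N\<close> ensures that there is one.\<close>

definition proj :: "'a list \<times> nat \<Rightarrow> 'y" where
  "proj z = \<pi> (hd (fst z))"

text \<open>Over the base, tuples related at every coordinate are added, as in a power of
  \<open>P\<close>. Otherwise an irreducible structure over the base could lack relations that its
  projection has in \<open>Y\<close>, and \<open>proj\<close> would not embed it.\<close>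

definition power_rel :: "'i \<Rightarrow> ('a list \<times> nat) list set" where
  "power_rel i = {zs. (\<forall>z\<in>set zs. proj z \<in> base) \<and> set zs \<subseteq> (\<Union>L\<in>lines. copy L ` univ P) \<and>
     (\<forall>c<N. map (\<lambda>z. fst z ! c) zs \<in> rel P i)}"

definition power :: "('a list \<times> nat, 'i) ord_struct" where
  "power = \<lparr>univ = (\<Union>L\<in>lines. copy L ` univ P),
     rel = (\<lambda>i. (\<Union>L\<in>lines. map (copy L) ` rel P i) \<union> power_rel i),
     less_rel = {(z, z'). z \<in> (\<Union>L\<in>lines. copy L ` univ P) \<and> z' \<in> (\<Union>L\<in>lines. copy L ` univ P) \<and>
       ((fst z, fst z') \<in> lexord (less_rel P) \<or> fst z = fst z' \<and> snd z < snd z')}\<rparr>"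

lemma power_simps:
  "univ power = (\<Union>L\<in>lines. copy L ` univ P)"
  "rel power i = (\<Union>L\<in>lines. map (copy L) ` rel P i) \<union> power_rel i"
  "(z, z') \<in> less_rel power \<longleftrightarrow> z \<in> univ power \<and> z' \<in> univ power \<and>
     ((fst z, fst z') \<in> lexord (less_rel P) \<or> fst z = fst z' \<and> snd z < snd z')"
  by (auto simp: power_def)

lemma code_eqD: "code L = code L' \<Longrightarrow> L \<in> lines \<Longrightarrow> L' \<in> lines \<Longrightarrow> L = L'"
  using inj_onD[OF code] unfolding letters_def by blast

lemmas PD = finite_ord_structD[OF P]

lemma \<pi>_less: "(x, y) \<in> less_rel P \<Longrightarrow> (\<pi> x, \<pi> y) \<in> less_rel Y \<or> \<pi> x = \<pi> y"
  using \<pi> by (auto simp: partite_def)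

lemma less_if_\<pi>_less:
  assumes "x \<in> univ P" "y \<in> univ P" "(\<pi> x, \<pi> y) \<in> less_rel Y"
  shows "(x, y) \<in> less_rel P"
  using assms PD(10)[of x y] \<pi>_less[of y x] finite_ord_structD(7,9)[OF Y] by metis

lemma inv_e: "a \<in> univ A \<Longrightarrow> inv_into (univ A) e (e a) = a"
  using inv_into_f_f[OF emb_inj_on[OF A Y e]] .

lemma base_inv: "y \<in> base \<Longrightarrow> inv_into (univ A) e y \<in> univ A \<and> e (inv_into (univ A) e y) = y"
  unfolding base_def by (simp add: f_inv_into_f inv_into_into)

lemma letters_emb: "\<alpha> \<in> letters \<Longrightarrow> emb I A P \<alpha>"
  and letters_\<pi>: "\<alpha> \<in> letters \<Longrightarrow> a \<in> univ A \<Longrightarrow> \<pi> (\<alpha> a) = e a"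
  by (auto simp: letters_def Emb_def)

lemma finite_letters: "finite letters"
  unfolding letters_def using finite_Emb[OF A P] by simp

lemma line_set: "L \<in> lines \<Longrightarrow> t \<in> set L \<Longrightarrow> t = None \<or> (\<exists>\<alpha>\<in>letters. t = Some \<alpha>)"
  and line_length: "L \<in> lines \<Longrightarrow> length L = N"
  and line_None: "L \<in> lines \<Longrightarrow> None \<in> set L"
  by (auto simp: vwords_def tuples_def)

lemma line_nth_None:
  assumes "L \<in> lines"
  obtains c where "c < N" "L ! c = None"
  using line_None[OF assms] line_length[OF assms] by (metis in_set_conv_nth)

lemma line_nth:
  assumes "L \<in> lines" "c < N"
  shows "L ! c = None \<or> (\<exists>\<alpha>\<in>letters. L ! c = Some \<alpha>)"
  using line_set[OF assms(1)] line_length[OF assms(1)] assms(2) nth_mem by blast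

lemma coord:
  assumes "t = None \<or> (\<exists>\<alpha>\<in>letters. t = Some \<alpha>)" "x \<in> univ P"
  shows "coord t x \<in> univ P" "\<pi> (coord t x) = \<pi> x"
  using assms base_inv[of "\<pi> x"] letters_\<pi> embD(1)[OF letters_emb] by (auto simp: coord_def)

text \<open>Within one part, a coordinate either keeps both vertices or collapses them to one.
  Between different parts, the order is that of the parts, which \<open>coord\<close>
  preserves.\<close>

lemma coord_less:
  assumes t: "t = None \<or> (\<exists>\<alpha>\<in>letters. t = Some \<alpha>)" and xy: "(x, y) \<in> less_rel P"
  shows "coord t x = coord t y \<or> (coord t x, coord t y) \<in> less_rel P"
proof (cases "\<pi> x = \<pi> y")
  case True
  then show ?thesis using xy by (auto simp: coord_def split: option.splits)
next
  case False
  have x: "x \<in> univ P" "y \<in> univ P" using xy PD(5,6) by auto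
  have "(\<pi> x, \<pi> y) \<in> less_rel Y" using \<pi>_less[OF xy] False by simp
  then show ?thesis using coord[OF t] x less_if_\<pi>_less by auto
qed

lemma copy_nth: "L \<in> lines \<Longrightarrow> c < N \<Longrightarrow> fst (copy L x) ! c = coord (L ! c) x"
  by (simp add: copy_def line_length)

lemma power_vertex:
  assumes "z \<in> univ power"
  shows "length (fst z) = N" "set (fst z) \<subseteq> univ P" "c < N \<Longrightarrow> \<pi> (fst z ! c) = proj z"
    "proj z \<in> univ Y" "proj z \<in> base \<Longrightarrow> snd z = 0"
proof -
  obtain L x where L: "L \<in> lines" "x \<in> univ P" "z = copy L x"
    using assms by (auto simp: power_simps)
  show len: "length (fst z) = N" using L line_length by (simp add: copy_def)
  show "set (fst z) \<subseteq> univ P" using L coord(1)[OF line_set[OF L(1)]] by (auto simp: copy_def)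
  have p: "\<pi> (fst z ! c) = \<pi> x" if "c < N" for c
    using copy_nth[OF L(1) that] coord(2)[OF line_nth[OF L(1) that]] L by simp
  have "proj z = \<pi> (fst z ! 0)"
    using len N hd_conv_nth[of "fst z"] unfolding proj_def by fastforce
  then have proj: "proj z = \<pi> x" using p N by simp
  then show "c < N \<Longrightarrow> \<pi> (fst z ! c) = proj z" using p by simp
  show "proj z \<in> univ Y" using proj L \<pi> by (auto simp: partite_def)
  show "proj z \<in> base \<Longrightarrow> snd z = 0" using proj L by (simp add: copy_def)
qed

lemma copy_in: "L \<in> lines \<Longrightarrow> x \<in> univ P \<Longrightarrow> copy L x \<in> univ power"
  by (auto simp: power_simps)

lemma proj_copy: "L \<in> lines \<Longrightarrow> x \<in> univ P \<Longrightarrow> proj (copy L x) = \<pi> x"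
  using power_vertex(3)[OF copy_in N] copy_nth[OF _ N] coord(2)[OF line_nth[OF _ N]] by metis

text \<open>Every coordinate is weakly monotone, and a variable coordinate is the identity, so the
  comparison is strict somewhere.\<close>

lemma copy_less:
  assumes L: "L \<in> lines" and xy: "(x, y) \<in> less_rel P"
  shows "(copy L x, copy L y) \<in> less_rel power"
proof -
  have "x \<in> univ P" "y \<in> univ P" "x \<noteq> y" using xy PD(5,6,7) by auto
  moreover have "coord None x = x" "coord None y = y" by (auto simp: coord_def)
  ultimately have "(map (\<lambda>t. coord t x) L, map (\<lambda>t. coord t y) L) \<in> lexord (less_rel P)"
    using coord_less[OF line_set[OF L] xy] line_None[OF L]
    by (intro map_lexord ballI bexI[of _ None]) auto
  then show ?thesis using copy_in[OF L] \<open>x \<in> univ P\<close> \<open>y \<in> univ P\<close>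
    by (simp add: power_simps(3)) (simp add: copy_def)
qed

lemma power_relD:
  assumes "zs \<in> power_rel i"
  shows "set zs \<subseteq> univ power" "z \<in> set zs \<Longrightarrow> proj z \<in> base" "c < N \<Longrightarrow> map (\<lambda>z. fst z ! c) zs \<in> rel P i"
  using assms by (auto simp: power_rel_def power_simps)

lemma finite_ord_struct_power: "finite_ord_struct I r power"
proof (rule finite_ord_structI)
  show "finite (univ power)"
    using finite_vwords[OF finite_letters] PD(1) by (simp add: power_simps)
  show "i \<in> I \<and> set zs \<subseteq> univ power \<and> length zs = r i" if zs: "zs \<in> rel power i" for zs i
  proof (cases "zs \<in> power_rel i")
    case True
    from power_relD(1)[OF this] power_relD(3)[OF this N] PD(3,4)[of "map (\<lambda>z. fst z ! 0) zs" i]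
    show ?thesis by simp
  next
    case False
    then obtain L xs where L: "L \<in> lines" "xs \<in> rel P i" "zs = map (copy L) xs"
      using zs by (auto simp: power_simps)
    then show ?thesis using PD(2,3,4)[OF L(2)] copy_in[OF L(1)] by auto
  qed
  show "z \<in> univ power \<and> z' \<in> univ power" if "(z, z') \<in> less_rel power" for z z'
    using that by (simp add: power_simps(3))
  show "(z, z) \<notin> less_rel power" for z
    using lexord_irreflexive[of "less_rel P" "fst z"] PD(7) by (simp add: power_simps(3))
  have "trans (less_rel P)" using PD(8) by (rule transI)
  then show "(z, z'') \<in> less_rel power"
    if "(z, z') \<in> less_rel power" "(z', z'') \<in> less_rel power" for z z' z''
    using that lexord_trans[of "fst z" "fst z'" "less_rel P" "fst z''"]
    by (auto simp: power_simps(3))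
  show "(z, z') \<in> less_rel power \<or> (z', z) \<in> less_rel power"
    if "z \<in> univ power" "z' \<in> univ power" "z \<noteq> z'" for z z'
  proof (cases "fst z = fst z'")
    case True
    then have "snd z \<noteq> snd z'" using that(3) by (simp add: prod_eq_iff)
    then show ?thesis using True that by (auto simp: power_simps(3))
  next
    case False
    show ?thesis
    proof -
      have "(fst z, fst z') \<in> lexord (less_rel P) \<or> (fst z', fst z) \<in> lexord (less_rel P)"
        by (rule lexord_total[where X = "univ P"])
           (use False PD(10) power_vertex(1,2)[OF that(1)] power_vertex(1,2)[OF that(2)] in auto)
      then show ?thesis using that unfolding power_simps(3) by blast
    qed
  qed
qed

lemma partite_power: "partite Y power proj"
  unfolding partite_def
proof (intro conjI allI impI)
  show "proj \<in> univ power \<rightarrow> univ Y" using power_vertex(4) by auto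
  fix z z' assume z: "(z, z') \<in> less_rel power"
  then have zz: "z \<in> univ power" "z' \<in> univ power" by (auto simp: power_simps(3))
  obtain x xs where x: "fst z = x # xs" using power_vertex(1)[OF zz(1)] N by (cases "fst z") auto
  obtain y ys where y: "fst z' = y # ys" using power_vertex(1)[OF zz(2)] N by (cases "fst z'") auto
  have "x = y \<or> (x, y) \<in> less_rel P" using z x y by (auto simp: power_simps(3))
  then show "(proj z, proj z') \<in> less_rel Y \<or> proj z = proj z'"
    using \<pi>_less x y by (auto simp: proj_def)
qed

text \<open>The point is that neither \<open>power_rel\<close> nor another copy adds relations to
  this one. A variable coordinate of \<open>L\<close> shows the original tuple, which settles
  \<open>power_rel\<close>. If the tuple also comes from a line \<open>L'\<close>, a vertex off the
  base forces \<open>L = L'\<close> by its code; over the base, the two preimages are compared at a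
  variable coordinate of each line.\<close>

lemma copy_rel:
  assumes L: "L \<in> lines" and xs: "set xs \<subseteq> univ P"
  shows "map (copy L) xs \<in> rel power i \<longleftrightarrow> xs \<in> rel P i"
proof
  show "xs \<in> rel P i \<Longrightarrow> map (copy L) xs \<in> rel power i" using L by (auto simp: power_simps)
  assume R: "map (copy L) xs \<in> rel power i"
  obtain c where c: "c < N" "L ! c = None" using line_nth_None[OF L] by blast
  have at_c: "map (\<lambda>z. fst z ! c) (map (copy L) xs) = xs"
    using copy_nth[OF L c(1)] c(2) by (simp add: coord_def o_def)
  show "xs \<in> rel P i"
  proof (cases "map (copy L) xs \<in> power_rel i")
    case True
    from power_relD(3)[OF this c(1)] show ?thesis unfolding at_c .
  next
    case False
    then obtain L' ys where L': "L' \<in> lines" and ys: "ys \<in> rel P i"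
      and eq: "map (copy L) xs = map (copy L') ys"
      using R by (auto simp: power_simps)
    have ysP: "set ys \<subseteq> univ P" using PD(2)[OF ys] .
    have len: "length xs = length ys" using map_eq_imp_length_eq[OF eq] .
    have nth: "copy L (xs ! p) = copy L' (ys ! p)" if "p < length xs" for p
      using arg_cong[OF eq, of "\<lambda>zs. zs ! p"] that len by simp
    have pi: "\<pi> (xs ! p) = \<pi> (ys ! p)" if p: "p < length xs" for p
      using nth[OF p] proj_copy[OF L, of "xs ! p"] proj_copy[OF L', of "ys ! p"] xs ysP p len
      by (auto simp: subset_iff)
    obtain c' where c': "c' < N" "L' ! c' = None" using line_nth_None[OF L'] by blast
    have at_c: "xs ! p = coord (L' ! c) (ys ! p)" if p: "p < length xs" for p
      using nth[OF p] copy_nth[OF L c(1), of "xs ! p"] copy_nth[OF L' c(1), of "ys ! p"] c(2)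
      by (simp add: coord_def)
    have at_c': "ys ! p = coord (L ! c') (xs ! p)" if p: "p < length xs" for p
      using nth[OF p] copy_nth[OF L c'(1), of "xs ! p"] copy_nth[OF L' c'(1), of "ys ! p"] c'(2)
      by (simp add: coord_def)
    have same: "xs \<in> rel P i" if "L ! c' = None \<or> L' ! c = None"
    proof -
      have "xs ! p = ys ! p" if "p < length xs" for p
        using at_c[OF that] at_c'[OF that] \<open>L ! c' = None \<or> L' ! c = None\<close> by (auto simp: coord_def)
      then have "xs = ys" using len by (simp add: nth_equalityI)
      then show ?thesis using ys by simp
    qed
    show ?thesis
    proof (cases "\<exists>p<length xs. \<pi> (xs ! p) \<notin> base")
      case True
      then obtain p where p: "p < length xs" "\<pi> (xs ! p) \<notin> base" by blast
      then have "code L = code L'" using nth[OF p(1)] pi[OF p(1)] by (simp add: copy_def)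
      then have "L = L'" using code_eqD L L' by simp
      then show ?thesis using same c by simp
    next
      case False
      then have b: "\<pi> (xs ! p) \<in> base" if "p < length xs" for p using that by blast
      show ?thesis
      proof (cases "L ! c' = None \<or> L' ! c = None")
        case True
        then show ?thesis by (rule same)
      next
        case notNone: False
        obtain \<alpha> where \<alpha>: "\<alpha> \<in> letters" "L ! c' = Some \<alpha>"
          using line_nth[OF L c'(1)] notNone by auto
        obtain \<beta> where \<beta>: "\<beta> \<in> letters" "L' ! c = Some \<beta>"
          using line_nth[OF L' c(1)] notNone by auto
        \<comment> \<open>Each preimage is the image of the same tuple \<open>js\<close> of
          \<open>A\<close> under a letter, and letters preserve and reflect relations.\<close>
        define js where "js = map (\<lambda>x. inv_into (univ A) e (\<pi> x)) xs"
        have js: "set js \<subseteq> univ A" using b base_inv unfolding js_def by (auto simp: in_set_conv_nth)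
        have ys_eq: "ys = map \<alpha> js"
          using len at_c' b \<alpha> by (intro nth_equalityI) (auto simp: js_def coord_def)
        have xs_eq: "xs = map \<beta> js"
        proof (rule nth_equalityI)
          fix p assume p: "p < length xs"
          then have "xs ! p = \<beta> (inv_into (univ A) e (\<pi> (ys ! p)))"
            using at_c[OF p] b[OF p] pi[OF p] \<beta> by (simp add: coord_def)
          then show "xs ! p = map \<beta> js ! p" using p pi[OF p] by (simp add: js_def)
        qed (simp add: js_def)
        have iI: "i \<in> I" using PD(4)[OF ys] .
        have "js \<in> rel A i" using ys embD(2)[OF letters_emb[OF \<alpha>(1)] iI js] by (simp add: ys_eq)
        then show ?thesis using embD(2)[OF letters_emb[OF \<beta>(1)] iI js] xs_eq by simp
      qed
    qed
  qed
qed

lemma emb_copy: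
  assumes L: "L \<in> lines"
  shows "emb I P power (copy L)"
  using emb_monoI[OF P finite_ord_struct_power] copy_in[OF L] copy_rel[OF L] copy_less[OF L] by blast

text \<open>A letter lies over \<open>e\<close>, so a fixed letter \<beta> of \<open>L\<close> sends
  \<alpha>(a) to \<beta>(a). The image of \<alpha> in the copy thus depends only on the word
  \<open>inst L \<alpha>\<close>, which is how Hales--Jewett enters.\<close>

lemma copy_letter:
  assumes L: "L \<in> lines" and \<alpha>: "\<alpha> \<in> letters" and a: "a \<in> univ A"
  shows "copy L (\<alpha> a) = (map (\<lambda>\<beta>. \<beta> a) (inst L \<alpha>), 0)"
  using letters_\<pi>[OF \<alpha> a] a
  by (auto simp: copy_def inst_def coord_def base_def inv_e split: option.splits)

text \<open>An irreducible substructure with a vertex off the base lies in one copy; over the base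
  all its coordinate projections are irreducible, so it embeds into \<open>Y\<close>.\<close>

lemma irreducible_in_power:
  fixes F :: "('a, 'i) ord_struct"
  assumes eI: "emb I A Y e" and hom: "hom_embedding TYPE('a) I r Y P \<pi>"
    and F: "finite_ord_struct I r F" "irreducible_struct I F" and \<phi>: "emb I F power \<phi>"
  shows "(\<exists>L\<in>lines. \<phi> ` univ F \<subseteq> copy L ` univ P) \<or>
    emb I F Y (proj \<circ> \<phi>) \<and> proj ` \<phi> ` univ F \<subseteq> base"
proof (cases "\<exists>v\<in>univ F. proj (\<phi> v) \<notin> base")
  case True
  then obtain v where v: "v \<in> univ F" "proj (\<phi> v) \<notin> base" by blast
  obtain L x where L: "L \<in> lines" "x \<in> univ P" "\<phi> v = copy L x"
    using embD(1)[OF \<phi> v(1)] by (auto simp: power_simps)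
  have "\<phi> w \<in> copy L ` univ P" if w: "w \<in> univ F" for w
  proof (cases "w = v")
    case False
    then obtain i xs where xs: "i \<in> I" "xs \<in> rel F i" "v \<in> set xs" "w \<in> set xs"
      using irreducible_structD[OF F(2) v(1) w] by metis
    then have R: "map \<phi> xs \<in> rel power i"
      using embD(2)[OF \<phi>] finite_ord_structD(2)[OF F(1)] by blast
    \<comment> \<open>This tuple leaves the base, so it comes from a single copy, and the code
      stored in the vertex \<open>\<phi> v\<close> identifies its line as \<open>L\<close>.\<close>
    have "map \<phi> xs \<notin> power_rel i" using v(2) xs(3) power_relD(2)[of "map \<phi> xs" i "\<phi> v"] by auto
    then obtain L' ys where L': "L' \<in> lines" "ys \<in> rel P i" "map \<phi> xs = map (copy L') ys"
      using R by (auto simp: power_simps)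
    have im: "\<phi> ` set xs = copy L' ` set ys" using arg_cong[OF L'(3), of set] by simp
    then obtain y where y: "y \<in> set ys" "\<phi> v = copy L' y" using xs(3) by blast
    have yP: "y \<in> univ P" using PD(2)[OF L'(2)] y(1) by blast
    have "\<pi> x \<notin> base" "\<pi> y \<notin> base"
      using v(2) proj_copy[OF L(1,2)] L(3) proj_copy[OF L'(1) yP] y(2) by auto
    then have "L = L'" using L(1,3) L'(1) y(2) code_eqD by (simp add: copy_def)
    then show ?thesis using im xs(4) PD(2)[OF L'(2)] by blast
  qed (use L in auto)
  then show ?thesis using L(1) by blast
next
  case False
  then have b: "proj (\<phi> v) \<in> base" if "v \<in> univ F" for v using that by blast
  have FV: "\<phi> v \<in> univ power" if "v \<in> univ F" for v using embD(1)[OF \<phi> that] .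
  define \<phi>c where "\<phi>c = (\<lambda>c v. fst (\<phi> v) ! c)"
  have \<phi>cP: "\<phi>c c v \<in> univ P" "\<pi> (\<phi>c c v) = proj (\<phi> v)" if "c < N" "v \<in> univ F" for c v
    using power_vertex(1-3)[OF FV[OF that(2)]] that(1) nth_mem[of c "fst (\<phi> v)"]
    by (auto simp: \<phi>c_def)
  have P_if_power: "map (\<phi>c c) xs \<in> rel P i"
    if R: "map \<phi> xs \<in> rel power i" and c: "c < N" and xs: "set xs \<subseteq> univ F" for c xs i
  proof (cases "map \<phi> xs \<in> power_rel i")
    case True
    from power_relD(3)[OF this c] show ?thesis by (simp add: \<phi>c_def o_def)
  next
    case False
    then obtain L ys where L: "L \<in> lines" and ys: "ys \<in> rel P i" and eq: "map \<phi> xs = map (copy L) ys"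
      using R by (auto simp: power_simps)
    have iI: "i \<in> I" using PD(4)[OF ys] .
    have ysP: "set ys \<subseteq> univ P" using PD(2)[OF ys] .
    have len: "length xs = length ys" using map_eq_imp_length_eq[OF eq] .
    have nth: "\<phi> (xs ! p) = copy L (ys ! p)" if "p < length ys" for p
      using arg_cong[OF eq, of "\<lambda>zs. zs ! p"] that len by simp
    have bs: "\<pi> y \<in> base" if y: "y \<in> set ys" for y
    proof -
      obtain p where p: "p < length ys" "ys ! p = y" using y by (auto simp: in_set_conv_nth)
      then have "proj (\<phi> (xs ! p)) = \<pi> y"
        using nth[OF p(1)] proj_copy[OF L, of y] y ysP by auto
      moreover have "xs ! p \<in> univ F" using p(1) len xs nth_mem[of p xs] by auto
      ultimately show ?thesis using b by metis
    qed
    have mapeq: "map (\<phi>c c) xs = map (coord (L ! c)) ys"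
      using len nth copy_nth[OF L c] by (intro nth_equalityI) (auto simp: \<phi>c_def)
    show ?thesis
    proof (cases "L ! c")
      case None
      then have "map (coord (L ! c)) ys = ys" by (simp add: coord_def map_idI)
      then show ?thesis using ys mapeq by simp
    next
      case (Some \<alpha>)
      then have \<alpha>: "\<alpha> \<in> letters" using line_nth[OF L c] by auto
      \<comment> \<open>The entries of one related tuple form an irreducible structure. Hence
        \<open>\<pi>\<close> embeds it into \<open>Y\<close>, the tuple is pulled back along
        \<open>e\<close> to \<open>A\<close>, and the letter \<alpha> carries it into
        \<open>P\<close>.\<close>
      define G where "G = induced P (set ys)"
      have GP: "emb I G P id" unfolding G_def using ysP by (rule emb_induced)
      have G: "finite_ord_struct I r G"
        unfolding G_def using finite_ord_struct_induced[OF P ysP] .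
      have "irreducible_struct I G"
        using ys iI by (intro irreducible_structI bexI[of _ i] bexI[of _ ys]) (auto simp: G_def)
      from hom_embeddingD[OF hom G this GP] have Gpi: "emb I G Y \<pi>" by simp
      have "set ys \<subseteq> univ G" by (simp add: G_def)
      then have Yrel: "map \<pi> ys \<in> rel Y i"
        using embD(2)[OF Gpi iI] ys by (simp add: G_def)
      define js where "js = map (\<lambda>y. inv_into (univ A) e (\<pi> y)) ys"
      have js: "set js \<subseteq> univ A" using bs base_inv by (auto simp: js_def)
      have "map e js = map \<pi> ys" using bs base_inv by (auto simp: js_def)
      then have "js \<in> rel A i" using embD(2)[OF eI iI js] Yrel by simp
      then have "map \<alpha> js \<in> rel P i" using embD(2)[OF letters_emb[OF \<alpha>] iI js] by simp
      moreover have "map \<alpha> js = map (coord (L ! c)) ys"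
        using bs Some by (auto simp: js_def coord_def)
      ultimately show ?thesis using mapeq by simp
    qed
  qed
  \<comment> \<open>Related tuples stay related at coordinate \<open>c\<close>, so the projected
    structure is irreducible before its injectivity is known, and \<open>hom\<close> applies to
    it.\<close>
  have emb_c: "emb I (induced P (\<phi>c c ` univ F)) Y \<pi>" if c: "c < N" for c
  proof -
    let ?G = "induced P (\<phi>c c ` univ F)"
    have sub: "\<phi>c c ` univ F \<subseteq> univ P" using \<phi>cP(1)[OF c] by auto
    have "irreducible_struct I ?G"
    proof (rule irreducible_structI)
      fix x y assume "x \<in> univ ?G" "y \<in> univ ?G" "x \<noteq> y"
      then obtain v w where vw: "v \<in> univ F" "w \<in> univ F" "x = \<phi>c c v" "y = \<phi>c c w" "v \<noteq> w" by auto
      obtain i xs where xs: "i \<in> I" "xs \<in> rel F i" "v \<in> set xs" "w \<in> set xs"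
        using irreducible_structD[OF F(2) vw(1,2,5)] by metis
      have xsF: "set xs \<subseteq> univ F" using finite_ord_structD(2)[OF F(1) xs(2)] .
      then have "map \<phi> xs \<in> rel power i" using embD(2)[OF \<phi> xs(1)] xs(2) by blast
      from P_if_power[OF this c xsF] have "map (\<phi>c c) xs \<in> rel ?G i" using xsF by auto
      then show "\<exists>i\<in>I. \<exists>xs\<in>rel ?G i. x \<in> set xs \<and> y \<in> set xs"
        using xs vw by (intro bexI[of _ i] bexI[of _ "map (\<phi>c c) xs"]) auto
    qed
    from hom_embeddingD[OF hom finite_ord_struct_induced[OF P sub] this emb_induced[OF sub]]
    show ?thesis by simp
  qed
  \<comment> \<open>Over the base all codes are 0, so distinct vertices differ at some coordinate,
    and \<open>\<pi>\<close> is injective on the projection to that coordinate.\<close>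
  have inj: "proj (\<phi> v) \<noteq> proj (\<phi> w)" if vw: "v \<in> univ F" "w \<in> univ F" "v \<noteq> w" for v w
  proof -
    have "\<phi> v \<noteq> \<phi> w" using emb_eq_iff[OF F(1) finite_ord_struct_power \<phi>] vw by blast
    moreover have "snd (\<phi> v) = snd (\<phi> w)" using power_vertex(5)[OF FV] b vw by metis
    ultimately have "fst (\<phi> v) \<noteq> fst (\<phi> w)" by (simp add: prod_eq_iff)
    then obtain c where c: "c < N" "\<phi>c c v \<noteq> \<phi>c c w"
      unfolding \<phi>c_def using power_vertex(1)[OF FV] vw by (metis nth_equalityI)
    have sub: "\<phi>c c ` univ F \<subseteq> univ P" using \<phi>cP(1)[OF c(1)] by auto
    have "\<pi> (\<phi>c c v) \<noteq> \<pi> (\<phi>c c w)"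
      using emb_eq_iff[OF finite_ord_struct_induced[OF P sub] Y emb_c[OF c(1)]] vw c(2) by auto
    then show ?thesis using \<phi>cP(2)[OF c(1)] vw by simp
  qed
  have "emb I F Y (proj \<circ> \<phi>)"
  proof (rule emb_monoI[OF F(1) Y])
    show "(proj \<circ> \<phi>) x \<in> univ Y" if "x \<in> univ F" for x
      using power_vertex(4)[OF FV[OF that]] by simp
    show "((proj \<circ> \<phi>) x, (proj \<circ> \<phi>) y) \<in> less_rel Y" if xy: "(x, y) \<in> less_rel F" for x y
    proof -
      have xF: "x \<in> univ F" "y \<in> univ F" "x \<noteq> y"
        using finite_ord_structD(5,6,7)[OF F(1)] xy by blast+
      then have "(\<phi> x, \<phi> y) \<in> less_rel power" using embD(3)[OF \<phi>] xy by blast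
      then show ?thesis using partite_power inj[OF xF] unfolding partite_def o_def by blast
    qed
  next
    fix i xs assume i: "i \<in> I" and xs: "set xs \<subseteq> univ F"
    have pc: "map \<pi> (map (\<phi>c c) xs) = map (proj \<circ> \<phi>) xs" if "c < N" for c
      using \<phi>cP(2)[OF that] xs by auto
    \<comment> \<open>The left side does not mention \<open>c\<close>: the tuple is related in
      \<open>P\<close> at all coordinates or at none.\<close>
    have Yc: "map (proj \<circ> \<phi>) xs \<in> rel Y i \<longleftrightarrow> map (\<phi>c c) xs \<in> rel P i" if c: "c < N" for c
    proof -
      have "set (map (\<phi>c c) xs) \<subseteq> univ (induced P (\<phi>c c ` univ F))" using xs by auto
      from embD(2)[OF emb_c[OF c] i this]
      have "map (proj \<circ> \<phi>) xs \<in> rel Y i \<longleftrightarrow> map (\<phi>c c) xs \<in> rel (induced P (\<phi>c c ` univ F)) i"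
        unfolding pc[OF c] .
      then show ?thesis using xs by auto
    qed
    have "map \<phi> xs \<in> rel power i \<longleftrightarrow> (\<forall>c<N. map (\<phi>c c) xs \<in> rel P i)"
    proof
      assume "\<forall>c<N. map (\<phi>c c) xs \<in> rel P i"
      then have "map \<phi> xs \<in> power_rel i"
        using b FV xs unfolding power_rel_def power_simps(1)[symmetric] by (auto simp: \<phi>c_def o_def)
      then show "map \<phi> xs \<in> rel power i" by (simp add: power_simps(2))
    qed (use P_if_power xs in blast)
    then show "map (proj \<circ> \<phi>) xs \<in> rel Y i \<longleftrightarrow> xs \<in> rel F i"
      using Yc N embD(2)[OF \<phi> i xs] by blast
  qed
  then show ?thesis using b by auto
qed

lemma factor_through_copy:
  assumes L: "L \<in> lines" and \<phi>: "emb I F power \<phi>" "\<phi> ` univ F \<subseteq> copy L ` univ P"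
  obtains \<psi> where "emb I F P \<psi>" "\<And>v. v \<in> univ F \<Longrightarrow> \<psi> v \<in> univ P \<and> \<phi> v = copy L (\<psi> v)"
proof -
  define \<psi> where "\<psi> = (\<lambda>v. inv_into (univ P) (copy L) (\<phi> v))"
  have \<psi>: "\<psi> v \<in> univ P \<and> \<phi> v = copy L (\<psi> v)" if "v \<in> univ F" for v
    using \<phi>(2) that unfolding \<psi>_def by (auto simp: f_inv_into_f inv_into_into image_subset_iff)
  have "emb I F power (copy L \<circ> \<psi>)" using \<phi>(1) \<psi> emb_cong[of F \<phi> "copy L \<circ> \<psi>"] by auto
  then have "emb I F P \<psi>" using emb_cancel[OF _ emb_copy[OF L]] \<psi> by blast
  then show thesis using \<psi> that by blast
qed

lemma hom_embedding_power:
  assumes "emb I A Y e" "hom_embedding TYPE('a) I r Y P \<pi>"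
  shows "hom_embedding TYPE('a) I r Y power proj"
  unfolding hom_embedding_def
proof (intro allI impI)
  fix F :: "('a, 'i) ord_struct" and \<phi>
  assume F: "finite_ord_struct I r F" "irreducible_struct I F" "emb I F power \<phi>"
  show "emb I F Y (proj \<circ> \<phi>)"
    using irreducible_in_power[OF assms F]
  proof (elim disjE conjE bexE)
    fix L assume L: "L \<in> lines" "\<phi> ` univ F \<subseteq> copy L ` univ P"
    then obtain \<psi> where \<psi>: "emb I F P \<psi>" "\<And>v. v \<in> univ F \<Longrightarrow> \<psi> v \<in> univ P \<and> \<phi> v = copy L (\<psi> v)"
      using factor_through_copy[OF L(1) F(3)] by blast
    show ?thesis
      using hom_embeddingD[OF assms(2) F(1,2) \<psi>(1)] \<psi>(2) proj_copy[OF L(1)]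
        emb_cong[of F "proj \<circ> \<phi>" "\<pi> \<circ> \<psi>"] by auto
  qed
qed

text \<open>An irreducible structure inside one copy pulls back to \<open>P\<close>. One over the
  base projects into the image of \<open>e\<close> and pulls back along \<open>e\<close> to
  \<open>A\<close>.\<close>

lemma forbidden_power:
  fixes F :: "('a, 'i) ord_struct"
  assumes "emb I A Y e" "hom_embedding TYPE('a) I r Y P \<pi>"
    and F: "finite_ord_struct I r F" "irreducible_struct I F" "emb I F power \<phi>"
  shows "(\<exists>\<phi>. emb I F P \<phi>) \<or> (\<exists>\<phi>. emb I F A \<phi>)"
  using irreducible_in_power[OF assms]
proof (elim disjE conjE bexE)
  assume \<phi>: "emb I F Y (proj \<circ> \<phi>)" "proj ` \<phi> ` univ F \<subseteq> base"
  define \<psi> where "\<psi> = (\<lambda>v. inv_into (univ A) e (proj (\<phi> v)))"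
  have \<psi>: "\<psi> v \<in> univ A \<and> e (\<psi> v) = proj (\<phi> v)" if "v \<in> univ F" for v
    using \<phi>(2) base_inv that unfolding \<psi>_def by blast
  then have "emb I F Y (e \<circ> \<psi>)" using \<phi>(1) emb_cong[of F "proj \<circ> \<phi>" "e \<circ> \<psi>"] by auto
  then show ?thesis using emb_cancel[OF _ assms(1)] \<psi> by blast
qed (use factor_through_copy[OF _ F(3)] in metis)

end

text \<open>The joint effect of the steps for all \<open>e\<close> in \<open>E\<close>: on a
  suitable copy of \<open>P\<close>, the colour of an embedding of \<open>A\<close> over some
  \<open>e\<close> depends on \<open>e\<close> alone. The clause on irreducible structures is
  conditional because in the first run the maps in \<open>E\<close> respect only the order.\<close>

definition partite_lift :: "'i set \<Rightarrow> ('i \<Rightarrow> nat) \<Rightarrow> ('a, 'i) ord_struct \<Rightarrow> ('y, 'i) ord_struct \<Rightarrow>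
    ('a \<Rightarrow> 'y) set \<Rightarrow> ('a, 'i) ord_struct \<Rightarrow> ('a \<Rightarrow> 'y) \<Rightarrow> ('a, 'i) ord_struct \<Rightarrow> ('a \<Rightarrow> 'y) \<Rightarrow> bool" where
  "partite_lift I r A Y E P \<pi> P' \<pi>' \<longleftrightarrow> finite_ord_struct I r P' \<and> partite Y P' \<pi>' \<and>
    (\<forall>\<chi> :: ('a \<Rightarrow> 'a) \<Rightarrow> bool. \<exists>w. emb I P P' w \<and> (\<forall>x\<in>univ P. \<pi>' (w x) = \<pi> x) \<and>
       (\<forall>e\<in>E. \<exists>b. \<forall>\<alpha>\<in>Emb I A P. (\<forall>a\<in>univ A. \<pi> (\<alpha> a) = e a) \<longrightarrow>
          \<chi> (compose (univ A) w \<alpha>) = b)) \<and>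
    ((\<forall>e\<in>E. emb I A Y e) \<and> hom_embedding TYPE('a) I r Y P \<pi> \<longrightarrow>
       hom_embedding TYPE('a) I r Y P' \<pi>' \<and>
       (\<forall>F :: ('a, 'i) ord_struct. finite_ord_struct I r F \<longrightarrow> irreducible_struct I F \<longrightarrow>
          (\<exists>\<phi>. emb I F P' \<phi>) \<longrightarrow> (\<exists>\<phi>. emb I F P \<phi>) \<or> (\<exists>\<phi>. emb I F A \<phi>)))"

lemma partite_liftD:
  fixes A P P' F :: "('a, 'i) ord_struct" and \<chi> :: "('a \<Rightarrow> 'a) \<Rightarrow> bool"
  assumes "partite_lift I r A Y E P \<pi> P' \<pi>'"
  shows "finite_ord_struct I r P'" "partite Y P' \<pi>'"
    and "\<exists>w. emb I P P' w \<and> (\<forall>x\<in>univ P. \<pi>' (w x) = \<pi> x) \<and>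
       (\<forall>e\<in>E. \<exists>b. \<forall>\<alpha>\<in>Emb I A P. (\<forall>a\<in>univ A. \<pi> (\<alpha> a) = e a) \<longrightarrow> \<chi> (compose (univ A) w \<alpha>) = b)"
    and "\<forall>e\<in>E. emb I A Y e \<Longrightarrow> hom_embedding TYPE('a) I r Y P \<pi> \<Longrightarrow> hom_embedding TYPE('a) I r Y P' \<pi>'"
    and "\<forall>e\<in>E. emb I A Y e \<Longrightarrow> hom_embedding TYPE('a) I r Y P \<pi> \<Longrightarrow>
       finite_ord_struct I r F \<Longrightarrow> irreducible_struct I F \<Longrightarrow> emb I F P' \<phi> \<Longrightarrow>
       (\<exists>\<phi>. emb I F P \<phi>) \<or> (\<exists>\<phi>. emb I F A \<phi>)"
  using assms unfolding partite_lift_def by auto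

lemma partite_liftI:
  fixes A P P' :: "('a, 'i) ord_struct"
  assumes "finite_ord_struct I r P'" "partite Y P' \<pi>'"
    and "\<And>\<chi> :: ('a \<Rightarrow> 'a) \<Rightarrow> bool. \<exists>w. emb I P P' w \<and> (\<forall>x\<in>univ P. \<pi>' (w x) = \<pi> x) \<and>
       (\<forall>e\<in>E. \<exists>b. \<forall>\<alpha>\<in>Emb I A P. (\<forall>a\<in>univ A. \<pi> (\<alpha> a) = e a) \<longrightarrow> \<chi> (compose (univ A) w \<alpha>) = b)"
    and "\<forall>e\<in>E. emb I A Y e \<Longrightarrow> hom_embedding TYPE('a) I r Y P \<pi> \<Longrightarrow> hom_embedding TYPE('a) I r Y P' \<pi>'"
    and "\<And>(F :: ('a, 'i) ord_struct) \<phi>. \<forall>e\<in>E. emb I A Y e \<Longrightarrow> hom_embedding TYPE('a) I r Y P \<pi> \<Longrightarrow>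
       finite_ord_struct I r F \<Longrightarrow> irreducible_struct I F \<Longrightarrow> emb I F P' \<phi> \<Longrightarrow>
       (\<exists>\<phi>. emb I F P \<phi>) \<or> (\<exists>\<phi>. emb I F A \<phi>)"
  shows "partite_lift I r A Y E P \<pi> P' \<pi>'"
  unfolding partite_lift_def
proof (intro conjI allI impI)
  fix F :: "('a, 'i) ord_struct"
  assume "(\<forall>e\<in>E. emb I A Y e) \<and> hom_embedding TYPE('a) I r Y P \<pi>" "finite_ord_struct I r F"
    "irreducible_struct I F" "\<exists>\<phi>. emb I F P' \<phi>"
  then show "(\<exists>\<phi>. emb I F P \<phi>) \<or> (\<exists>\<phi>. emb I F A \<phi>)"
    using assms(5) by metis
qed (use assms(1-4) in auto)

lemma partite_step_exists:
  fixes A P :: "('a::infinite, 'i) ord_struct" and Y :: "('y, 'i) ord_struct"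
  assumes A: "finite_ord_struct I r A" and P: "finite_ord_struct I r P"
    and Y: "finite_ord_struct I r Y" and \<pi>: "partite Y P \<pi>" and e: "emb {} A Y e"
  shows "\<exists>(P' :: ('a, 'i) ord_struct) \<pi>'. partite_lift I r A Y {e} P \<pi> P' \<pi>'"
proof -
  define S where "S = {\<alpha> \<in> Emb I A P. \<forall>a\<in>univ A. \<pi> (\<alpha> a) = e a}"
  have finS: "finite S" unfolding S_def using finite_Emb[OF A P] by simp
  obtain N where HJ: "\<And>\<chi> :: ('a \<Rightarrow> 'a) list \<Rightarrow> nat. (\<forall>w\<in>tuples S N. \<chi> w < 2) \<Longrightarrow>
      \<exists>L\<in>vwords S N. \<forall>a\<in>S. \<forall>b\<in>S. \<chi> (inst L a) = \<chi> (inst L b)"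
    using Hales_Jewett[OF finS, of 2] by blast
  \<comment> \<open>A constant colouring already yields a line, and its variable needs a
    position.\<close>
  have "vwords S N \<noteq> {}" using HJ[of "\<lambda>_. 0"] by auto
  then have N: "0 < N" by (auto simp: vwords_def tuples_def intro!: gr0I)
  obtain code :: "('a \<Rightarrow> 'a) option list \<Rightarrow> nat" where code: "inj_on code (vwords S N)"
    using finite_imp_inj_to_nat_seg[OF finite_vwords[OF finS]] by blast
  interpret partite_step I r A P Y \<pi> e N code
    by unfold_locales (use A P Y \<pi> e N code in \<open>auto simp: S_def\<close>)
  have S: "S = letters" by (simp add: S_def letters_def)
  obtain P' :: "('a, 'i) ord_struct" and \<phi> \<psi> where P': "finite_ord_struct I r P'"
    and \<phi>: "\<And>J. emb J power P' \<phi>" and \<psi>: "\<And>J. emb J P' power \<psi>"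
    and inv: "\<And>z. z \<in> univ power \<Longrightarrow> \<psi> (\<phi> z) = z"
    using transfer_ord_struct[OF finite_ord_struct_power] by metis
  show ?thesis
  proof (intro exI, rule partite_liftI)
    show "finite_ord_struct I r P'" by (rule P')
    show "partite Y P' (proj \<circ> \<psi>)"
      unfolding partite_def
    proof (intro conjI allI impI)
      show "proj \<circ> \<psi> \<in> univ P' \<rightarrow> univ Y"
        using embD(1)[OF \<psi>] partite_power by (auto simp: partite_def)
      fix x y assume xy: "(x, y) \<in> less_rel P'"
      then have "(\<psi> x, \<psi> y) \<in> less_rel power"
        using embD(3)[OF \<psi>] finite_ord_structD(5,6)[OF P'] by metis
      then show "((proj \<circ> \<psi>) x, (proj \<circ> \<psi>) y) \<in> less_rel Y \<or> (proj \<circ> \<psi>) x = (proj \<circ> \<psi>) y"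
        using partite_power unfolding partite_def o_def by blast
    qed
    show "\<exists>w. emb I P P' w \<and> (\<forall>x\<in>univ P. (proj \<circ> \<psi>) (w x) = \<pi> x) \<and>
       (\<forall>e\<in>{e}. \<exists>b. \<forall>\<alpha>\<in>Emb I A P. (\<forall>a\<in>univ A. \<pi> (\<alpha> a) = e a) \<longrightarrow>
          \<chi> (compose (univ A) w \<alpha>) = b)"
      for \<chi> :: "('a \<Rightarrow> 'a) \<Rightarrow> bool"
    proof -
      \<comment> \<open>Reading a word of letters at each element of \<open>A\<close> gives a map
        into \<open>P'\<close>. On the instances of a line these maps are the images of the letters
        in one copy, so a colouring of maps becomes a colouring of words.\<close>
      define word where "word = (\<lambda>u. \<lambda>a\<in>univ A. \<phi> (map (\<lambda>\<beta>. \<beta> a) u, 0))"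
      define col :: "('a \<Rightarrow> 'a) list \<Rightarrow> nat" where "col = (\<lambda>u. if \<chi> (word u) then 1 else 0)"
      have "\<forall>w\<in>tuples S N. col w < 2" by (simp add: col_def)
      then obtain L where L: "L \<in> lines"
        and mono': "\<forall>\<alpha>\<in>letters. \<forall>\<beta>\<in>letters. col (inst L \<alpha>) = col (inst L \<beta>)"
        using HJ[of col] unfolding S by blast
      have mono: "\<chi> (word (inst L \<alpha>)) = \<chi> (word (inst L \<beta>))" if "\<alpha> \<in> letters" "\<beta> \<in> letters" for \<alpha> \<beta>
        using mono' that unfolding col_def by (metis zero_neq_one)
      have "compose (univ A) (\<phi> \<circ> copy L) \<alpha> = word (inst L \<alpha>)" if "\<alpha> \<in> letters" for \<alpha>
        using copy_letter[OF L that] by (auto simp: compose_def word_def)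
      then have "\<exists>b. \<forall>\<alpha>\<in>letters. \<chi> (compose (univ A) (\<phi> \<circ> copy L) \<alpha>) = b"
        using mono by metis
      then show ?thesis
        using emb_comp[OF emb_copy[OF L] \<phi>] inv[OF copy_in[OF L]] proj_copy[OF L]
        by (intro exI[of _ "\<phi> \<circ> copy L"]) (auto simp: letters_def)
    qed
    show "hom_embedding TYPE('a) I r Y P' (proj \<circ> \<psi>)"
      if eI: "\<forall>e\<in>{e}. emb I A Y e" and "hom_embedding TYPE('a) I r Y P \<pi>"
      unfolding hom_embedding_def
    proof (intro allI impI)
      fix F :: "('a, 'i) ord_struct" and f
      assume F: "finite_ord_struct I r F" "irreducible_struct I F" "emb I F P' f"
      from hom_embeddingD[OF hom_embedding_power[OF bspec[OF eI insertI1] that(2)] F(1,2) emb_comp[OF F(3) \<psi>]]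
      show "emb I F Y (proj \<circ> \<psi> \<circ> f)" by (simp add: o_assoc)
    qed
    show "(\<exists>\<phi>. emb I F P \<phi>) \<or> (\<exists>\<phi>. emb I F A \<phi>)"
      if "\<forall>e\<in>{e}. emb I A Y e" "hom_embedding TYPE('a) I r Y P \<pi>"
         "finite_ord_struct I r F" "irreducible_struct I F" "emb I F P' f"
       for F :: "('a, 'i) ord_struct" and f
      using forbidden_power[OF bspec[OF that(1) insertI1] that(2-4) emb_comp[OF that(5) \<psi>]] .
  qed
qed

lemma partite_construction:
  fixes A P :: "('a::infinite, 'i) ord_struct" and Y :: "('y, 'i) ord_struct"
  assumes A: "finite_ord_struct I r A" and P: "finite_ord_struct I r P"
    and Y: "finite_ord_struct I r Y" and \<pi>: "partite Y P \<pi>"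
    and E: "finite E" "\<forall>e\<in>E. emb {} A Y e"
  shows "\<exists>(P' :: ('a, 'i) ord_struct) \<pi>'. partite_lift I r A Y E P \<pi> P' \<pi>'"
  using E
proof (induction E rule: finite_induct)
  case empty
  have "partite_lift I r A Y {} P \<pi> P \<pi>"
  proof (rule partite_liftI[OF P \<pi>])
    show "\<exists>w. emb I P P w \<and> (\<forall>x\<in>univ P. \<pi> (w x) = \<pi> x) \<and>
       (\<forall>e\<in>{}. \<exists>b. \<forall>\<alpha>\<in>Emb I A P. (\<forall>a\<in>univ A. \<pi> (\<alpha> a) = e a) \<longrightarrow>
          \<chi> (compose (univ A) w \<alpha>) = b)" for \<chi> :: "('a \<Rightarrow> 'a) \<Rightarrow> bool"
      using emb_id[of I P] by (intro exI[of _ id]) auto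
  qed auto
  then show ?case by blast
next
  case (insert e E)
  obtain P1 :: "('a, 'i) ord_struct" and \<pi>1 where "partite_lift I r A Y E P \<pi> P1 \<pi>1"
    using insert by auto
  note L1 = partite_liftD[OF this]
  obtain P2 :: "('a, 'i) ord_struct" and \<pi>2 where "partite_lift I r A Y {e} P1 \<pi>1 P2 \<pi>2"
    using partite_step_exists[OF A L1(1) Y L1(2), of e] insert.prems by auto
  note L2 = partite_liftD[OF this]
  have "partite_lift I r A Y (insert e E) P \<pi> P2 \<pi>2"
  proof (rule partite_liftI[OF L2(1,2)])
    \<comment> \<open>The embeddings are chosen against the order of construction: first
      \<open>w2\<close> into the last structure, then \<open>w1\<close> for the colouring pulled
      back along \<open>w2\<close>.\<close>
    fix \<chi> :: "('a \<Rightarrow> 'a) \<Rightarrow> bool"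
    obtain w2 b where w2: "emb I P1 P2 w2" "\<forall>x\<in>univ P1. \<pi>2 (w2 x) = \<pi>1 x"
      and b: "\<And>\<alpha>. \<alpha> \<in> Emb I A P1 \<Longrightarrow> (\<forall>a\<in>univ A. \<pi>1 (\<alpha> a) = e a) \<Longrightarrow> \<chi> (compose (univ A) w2 \<alpha>) = b"
      using L2(3)[of \<chi>] by auto
    obtain w1 where w1: "emb I P P1 w1" "\<forall>x\<in>univ P. \<pi>1 (w1 x) = \<pi> x"
      and c: "\<forall>e\<in>E. \<exists>b. \<forall>\<alpha>\<in>Emb I A P. (\<forall>a\<in>univ A. \<pi> (\<alpha> a) = e a) \<longrightarrow>
          \<chi> (compose (univ A) w2 (compose (univ A) w1 \<alpha>)) = b"
      using L1(3)[of "\<lambda>f. \<chi> (compose (univ A) w2 f)"] by blast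
    have comp: "compose (univ A) w2 (compose (univ A) w1 \<alpha>) = compose (univ A) (w2 \<circ> w1) \<alpha>" for \<alpha>
      by (auto simp: compose_def)
    have "\<chi> (compose (univ A) (w2 \<circ> w1) \<alpha>) = b"
      if \<alpha>: "\<alpha> \<in> Emb I A P" "\<forall>a\<in>univ A. \<pi> (\<alpha> a) = e a" for \<alpha>
    proof -
      have "\<forall>a\<in>univ A. \<pi>1 (compose (univ A) w1 \<alpha> a) = e a"
        using \<alpha> w1(2) embD(1)[OF Emb_emb[OF \<alpha>(1)]] by (auto simp: compose_def)
      from b[OF compose_in_Emb[OF Emb_emb[OF \<alpha>(1)] w1(1)] this] show ?thesis by (simp add: comp)
    qed
    then show "\<exists>w. emb I P P2 w \<and> (\<forall>x\<in>univ P. \<pi>2 (w x) = \<pi> x) \<and>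
       (\<forall>e\<in>insert e E. \<exists>b. \<forall>\<alpha>\<in>Emb I A P. (\<forall>a\<in>univ A. \<pi> (\<alpha> a) = e a) \<longrightarrow>
          \<chi> (compose (univ A) w \<alpha>) = b)"
      using emb_comp[OF w1(1) w2(1)] w1 w2(2) embD(1)[OF w1(1)] c unfolding comp
      by (intro exI[of _ "w2 \<circ> w1"]) auto
  next
    assume e: "\<forall>e\<in>insert e E. emb I A Y e" and hom: "hom_embedding TYPE('a) I r Y P \<pi>"
    then have hom1: "hom_embedding TYPE('a) I r Y P1 \<pi>1" using L1(4) by simp
    then show "hom_embedding TYPE('a) I r Y P2 \<pi>2" using L2(4) e by simp
    show "(\<exists>\<phi>. emb I F P \<phi>) \<or> (\<exists>\<phi>. emb I F A \<phi>)"
      if F: "finite_ord_struct I r F" "irreducible_struct I F" "emb I F P2 \<phi>"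
      for F :: "('a, 'i) ord_struct" and \<phi>
      using L2(5)[OF _ hom1 F] L1(5)[OF _ hom F(1,2)] e by auto
  qed
  then show ?case by blast
qed

text \<open>The partite construction starts from one copy of \<open>B\<close> over each of its embeddings into \<open>Y\<close>.
  With \<open>J = {}\<close> a linear order \<open>Y\<close> is enough; \<open>J = I\<close> is needed to control irreducible structures.\<close>

lemma arrows_lift:
  fixes A B :: "('a::infinite, 'i) ord_struct" and Y :: "('y, 'i) ord_struct"
  assumes A: "finite_ord_struct I r A" and B: "finite_ord_struct I r B"
    and Y: "finite_ord_struct I r Y" and JI: "J \<subseteq> I" and ar: "arrows J Y B A"
  obtains C :: "('a, 'i) ord_struct" where "finite_ord_struct I r C" "arrows I C B A"
    "J = I \<longrightarrow> irreducibles_within I r C {A, B}"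
proof -
  note BD = finite_ord_structD[OF B] and YD = finite_ord_structD[OF Y]
  define H where "H = Emb J B Y"
  have finH: "finite H" unfolding H_def by (rule finite_Emb[OF B Y])
  have H: "emb J B Y h" if "h \<in> H" for h using that by (simp add: H_def Emb_def)
  obtain code :: "('a \<Rightarrow> 'y) \<Rightarrow> nat" where code: "inj_on code H"
    using finite_imp_inj_to_nat_seg[OF finH] by blast
  \<comment> \<open>Disjoint copies of \<open>B\<close>, the copy indexed by \<open>h\<close> lying
    over \<open>Y\<close> by means of \<open>h\<close>. Each copy meets a fibre at most once, so
    within a fibre \<open>code\<close> orders the copies.\<close>
  define U where "U = H \<times> univ B"
  define pr where "pr = (\<lambda>(h :: 'a \<Rightarrow> 'y, b). h b)"
  define D where "D = \<lparr>univ = U, rel = (\<lambda>i. \<Union>h\<in>H. map (Pair h) ` rel B i),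
    less_rel = {(x, y). x \<in> U \<and> y \<in> U \<and>
      ((pr x, pr y) \<in> less_rel Y \<or> pr x = pr y \<and> code (fst x) < code (fst y))}\<rparr>"
  have D_simps: "univ D = U" "rel D i = (\<Union>h\<in>H. map (Pair h) ` rel B i)"
    "(x, y) \<in> less_rel D \<longleftrightarrow> x \<in> U \<and> y \<in> U \<and>
      ((pr x, pr y) \<in> less_rel Y \<or> pr x = pr y \<and> code (fst x) < code (fst y))" for i x y
    by (simp_all add: D_def)
  have prY: "pr x \<in> univ Y" if "x \<in> U" for x
    using that embD(1)[OF H] by (auto simp: U_def pr_def)
  have pr_eqD: "x = y" if "x \<in> U" "y \<in> U" "pr x = pr y" "code (fst x) = code (fst y)" for x y
  proof -
    have "fst x = fst y" using inj_onD[OF code] that by (auto simp: U_def)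
    moreover have "snd x = snd y"
      using emb_eq_iff[OF B Y H] that calculation by (auto simp: U_def pr_def)
    ultimately show ?thesis by (simp add: prod_eq_iff)
  qed
  have D: "finite_ord_struct I r D"
  proof (rule finite_ord_structI)
    show "finite (univ D)" using finH BD(1) by (simp add: D_simps U_def)
    show "i \<in> I \<and> set xs \<subseteq> univ D \<and> length xs = r i" if xs: "xs \<in> rel D i" for i xs
    proof -
      obtain h ys where h: "h \<in> H" "ys \<in> rel B i" "xs = map (Pair h) ys"
        using xs by (auto simp: D_simps)
      then show ?thesis using BD(2,3,4)[OF h(2)] by (auto simp: D_simps U_def)
    qed
    show "x \<in> univ D \<and> y \<in> univ D" if "(x, y) \<in> less_rel D" for x y using that by (simp add: D_simps)
    show "(x, x) \<notin> less_rel D" for x using YD(7) by (simp add: D_simps)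
    show "(x, z) \<in> less_rel D" if "(x, y) \<in> less_rel D" "(y, z) \<in> less_rel D" for x y z
      using that YD(8)[of "pr x" "pr y" "pr z"] by (auto simp: D_simps)
    show "(x, y) \<in> less_rel D \<or> (y, x) \<in> less_rel D" if "x \<in> univ D" "y \<in> univ D" "x \<noteq> y" for x y
      using that YD(10)[OF prY prY, of x y] pr_eqD[of x y] unfolding D_simps
      by (metis linorder_neqE_nat)
  qed
  have incl: "emb I B D (Pair h)" if h: "h \<in> H" for h
  proof (rule emb_monoI[OF B D])
    show "(h, x) \<in> univ D" if "x \<in> univ B" for x using that h by (simp add: D_simps U_def)
    show "map (Pair h) xs \<in> rel D i \<longleftrightarrow> xs \<in> rel B i" for i xs
    proof
      assume "map (Pair h) xs \<in> rel D i"
      then obtain h' ys where "ys \<in> rel B i" "map (Pair h) xs = map (Pair h') ys"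
        by (auto simp: D_simps)
      moreover have "map snd (map (Pair k) zs) = zs" for k :: "'a \<Rightarrow> 'y" and zs :: "'a list"
        by (simp add: o_def)
      ultimately show "xs \<in> rel B i" by metis
    qed (use h in \<open>auto simp: D_simps\<close>)
    show "((h, x), (h, y)) \<in> less_rel D" if "(x, y) \<in> less_rel B" for x y
      using that BD(5,6)[OF that] h embD(3)[OF H[OF h]] by (auto simp: D_simps U_def pr_def)
  qed
  obtain P :: "('a, 'i) ord_struct" and \<phi> \<psi> where P: "finite_ord_struct I r P"
    and \<phi>: "\<And>J. emb J D P \<phi>" and \<psi>: "\<And>J. emb J P D \<psi>"
    and inv: "\<And>z. z \<in> univ D \<Longrightarrow> \<psi> (\<phi> z) = z"
    using transfer_ord_struct[OF D] by metis
  define \<pi> where "\<pi> = pr \<circ> \<psi>"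
  have \<pi>: "partite Y P \<pi>"
    unfolding partite_def
  proof (intro conjI allI impI)
    show "\<pi> \<in> univ P \<rightarrow> univ Y" using embD(1)[OF \<psi>] prY by (auto simp: \<pi>_def D_simps)
    fix x y assume xy: "(x, y) \<in> less_rel P"
    then have "(\<psi> x, \<psi> y) \<in> less_rel D"
      using embD(3)[OF \<psi>] finite_ord_structD(5,6)[OF P] by metis
    then show "(\<pi> x, \<pi> y) \<in> less_rel Y \<or> \<pi> x = \<pi> y" by (auto simp: \<pi>_def D_simps)
  qed
  \<comment> \<open>No relation joins two copies of \<open>B\<close>, so an irreducible structure
    stays in one of them.\<close>
  have irr: "\<exists>h\<in>H. \<exists>g. emb I F B g \<and> (\<forall>v\<in>univ F. f v = (h, g v))"
    if F: "finite_ord_struct I r F" "irreducible_struct I F" "emb I F D f"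
    for F :: "('a, 'i) ord_struct" and f
  proof -
    obtain h where h: "h \<in> H" "\<forall>v\<in>univ F. fst (f v) = h"
    proof (cases "univ F = {}")
      case True
      \<comment> \<open>An empty \<open>F\<close> selects no copy; the arrow supplies some
        index.\<close>
      have "H \<noteq> {}" using ar unfolding arrows_def H_def by blast
      then show ?thesis using True that by blast
    next
      case False
      then obtain v where v: "v \<in> univ F" by blast
      have "fst (f w) = fst (f v)" if w: "w \<in> univ F" for w
      proof (cases "w = v")
        case False
        then obtain i xs where xs: "i \<in> I" "xs \<in> rel F i" "v \<in> set xs" "w \<in> set xs"
          using irreducible_structD[OF F(2) v w] by metis
        then have "map f xs \<in> rel D i" using embD(2)[OF F(3)] finite_ord_structD(2)[OF F(1)] by blast
        then obtain h' ys where "map f xs = map (Pair h') ys" by (auto simp: D_simps)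
        from arg_cong[OF this, of set] have "f ` set xs = Pair h' ` set ys" by simp
        then have "f v \<in> Pair h' ` set ys" "f w \<in> Pair h' ` set ys" using xs(3,4) by blast+
        then show ?thesis by auto
      qed simp
      moreover have "fst (f v) \<in> H" using embD(1)[OF F(3) v] by (auto simp: D_simps U_def)
      ultimately show ?thesis using that by blast
    qed
    define g where "g = snd \<circ> f"
    have g: "f v = (h, g v)" if "v \<in> univ F" for v using h(2) that by (auto simp: g_def prod_eq_iff)
    have "emb I F D (Pair h \<circ> g)" using F(3) g emb_cong[of F f "Pair h \<circ> g"] by auto
    moreover have "g v \<in> univ B" if "v \<in> univ F" for v
      using embD(1)[OF F(3) that] by (auto simp: D_simps U_def g_def)
    ultimately have "emb I F B g" using emb_cancel[OF _ incl[OF h(1)]] by blast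
    then show ?thesis using h g by blast
  qed
  have hom: "hom_embedding TYPE('a) I r Y P \<pi>" if J: "J = I"
    unfolding hom_embedding_def
  proof (intro allI impI)
    fix F :: "('a, 'i) ord_struct" and f
    assume F: "finite_ord_struct I r F" "irreducible_struct I F" "emb I F P f"
    from irr[OF F(1,2) emb_comp[OF F(3) \<psi>]]
    obtain h g where h: "h \<in> H" "emb I F B g" "\<And>v. v \<in> univ F \<Longrightarrow> \<psi> (f v) = (h, g v)" by auto
    have "emb I F Y (h \<circ> g)" using emb_comp[OF h(2)] H[OF h(1)] J by blast
    then show "emb I F Y (\<pi> \<circ> f)"
      using h(3) emb_cong[of F "\<pi> \<circ> f" "h \<circ> g"] by (auto simp: \<pi>_def pr_def)
  qed
  define E where "E = Emb J A Y"
  have E: "finite E" "\<forall>e\<in>E. emb {} A Y e" "\<And>e. e \<in> E \<Longrightarrow> emb J A Y e"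
    unfolding E_def using finite_Emb[OF A Y] by (auto dest: Emb_emb emb_mono[of J A Y _ "{}"])
  obtain C :: "('a, 'i) ord_struct" and \<pi>' where "partite_lift I r A Y E P \<pi> C \<pi>'"
    using partite_construction[OF A P Y \<pi> E(1,2)] by blast
  note C = partite_liftD[OF this]
  show thesis
  proof (rule that[OF C(1)])
    show "arrows I C B A"
      unfolding arrows_def
    proof
      fix \<chi> :: "('a \<Rightarrow> 'a) \<Rightarrow> bool"
      obtain w where w: "emb I P C w"
        and c: "\<And>e. e \<in> E \<Longrightarrow> \<exists>b. \<forall>\<alpha>\<in>Emb I A P. (\<forall>a\<in>univ A. \<pi> (\<alpha> a) = e a) \<longrightarrow>
          \<chi> (compose (univ A) w \<alpha>) = b"
        using C(3)[of \<chi>] by blast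
      \<comment> \<open>As the colour depends only on the position \<open>e\<close>, it becomes a
        colouring \<gamma> of the embeddings of \<open>A\<close> into \<open>Y\<close>, to which the
        arrow of \<open>Y\<close> applies. The copy of \<open>B\<close> indexed by the resulting
        \<open>h\<close> is the one sought.\<close>
      obtain \<gamma> where \<gamma>: "\<And>e \<alpha>. e \<in> E \<Longrightarrow> \<alpha> \<in> Emb I A P \<Longrightarrow> (\<forall>a\<in>univ A. \<pi> (\<alpha> a) = e a) \<Longrightarrow>
          \<chi> (compose (univ A) w \<alpha>) = \<gamma> e"
        using c by metis
      obtain h where h: "h \<in> H"
        and mono: "\<forall>f\<in>Emb J A B. \<forall>g\<in>Emb J A B.
          \<gamma> (compose (univ A) h f) = \<gamma> (compose (univ A) h g)"
        using ar[unfolded arrows_def, THEN spec, of \<gamma>] unfolding H_def by (elim bexE)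
      let ?k = "\<phi> \<circ> Pair h"
      have k: "emb I B P ?k" using emb_comp[OF incl[OF h] \<phi>] .
      have col: "\<chi> (compose (univ A) (compose (univ B) w ?k) f) = \<gamma> (compose (univ A) h f)"
        and fJ: "f \<in> Emb J A B" if f: "f \<in> Emb I A B" for f
      proof -
        show fJ: "f \<in> Emb J A B" using f JI emb_mono unfolding Emb_def by blast
        have fB: "f a \<in> univ B" if "a \<in> univ A" for a using embD(1)[OF Emb_emb[OF f] that] .
        have e: "compose (univ A) h f \<in> E"
          unfolding E_def using compose_in_Emb[OF Emb_emb[OF fJ] H[OF h]] .
        have "\<forall>a\<in>univ A. \<pi> (compose (univ A) ?k f a) = compose (univ A) h f a"
          using inv fB h by (auto simp: compose_def \<pi>_def pr_def D_simps U_def)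
        from \<gamma>[OF e compose_in_Emb[OF Emb_emb[OF f] k] this]
        have "\<chi> (compose (univ A) w (compose (univ A) ?k f)) = \<gamma> (compose (univ A) h f)" .
        then show "\<chi> (compose (univ A) (compose (univ B) w ?k) f) = \<gamma> (compose (univ A) h f)"
          using compose_assoc'[of "univ A" f "univ B" w ?k] fB by simp
      qed
      show "\<exists>w\<in>Emb I B C. \<forall>f\<in>Emb I A B. \<forall>g\<in>Emb I A B.
          \<chi> (compose (univ A) w f) = \<chi> (compose (univ A) w g)"
        using compose_in_Emb[OF k w] col mono fJ
        by (intro bexI[of _ "compose (univ B) w ?k"]) auto
    qed
  next
    show "J = I \<longrightarrow> irreducibles_within I r C {A, B}"
      unfolding irreducibles_within_def
    proof (intro impI allI)
      fix F' :: "('a, 'i) ord_struct" and f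
      assume J: "J = I" and F': "finite_ord_struct I r F'" "irreducible_struct I F'" "emb I F' C f"
      then have "(\<exists>\<phi>. emb I F' P \<phi>) \<or> (\<exists>\<phi>. emb I F' A \<phi>)" using C(5)[OF _ hom[OF J]] E(3) by blast
      then show "\<exists>D\<in>{A, B}. \<exists>\<phi>. emb I F' D \<phi>"
        using irr[OF F'(1,2) emb_comp[OF _ \<psi>]] by blast
    qed
  qed
qed

section \<open>The Ramsey property of finite linear orders\<close>

lemma order_embedding_unique:
  assumes A: "finite_ord_struct I r A"
    and f: "\<And>x y. (x, y) \<in> less_rel A \<Longrightarrow> f x < (f y :: nat)"
    and g: "\<And>x y. (x, y) \<in> less_rel A \<Longrightarrow> g x < (g y :: nat)"
    and eq: "f ` univ A = g ` univ A" and x: "x \<in> univ A"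
  shows "f x = g x"
proof -
  note AD = finite_ord_structD[OF A]
  have less: "(y, z) \<in> less_rel A" if "h y < h z" "y \<in> univ A" "z \<in> univ A"
    "\<And>x y. (x, y) \<in> less_rel A \<Longrightarrow> h x < (h y :: nat)" for h y z
    using that AD(10)[of y z] by fastforce
  \<comment> \<open>A strictly increasing map sends \<open>x\<close> to the member of the image with
    as many members below it as \<open>x\<close> has predecessors. So the image determines the
    map.\<close>
  have rank: "card {t \<in> h ` univ A. t < h x} = card {y. (y, x) \<in> less_rel A}"
    if h: "\<And>x y. (x, y) \<in> less_rel A \<Longrightarrow> h x < (h y :: nat)" for h
  proof -
    have "{t \<in> h ` univ A. t < h x} = h ` {y. (y, x) \<in> less_rel A}"
      using less[OF _ _ x h] h AD(5) by auto
    moreover have "inj_on h (univ A)"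
      unfolding inj_on_def using h AD(10) by (metis less_irrefl)
    then have "inj_on h {y. (y, x) \<in> less_rel A}"
      using AD(5) by (auto intro: inj_on_subset)
    ultimately show ?thesis by (simp add: card_image)
  qed
  have mono: "card {t \<in> T. t < s} < card {t \<in> T. t < s'}"
    if "s \<in> T" "s < s'" "finite T" for T and s s' :: nat
    using that by (intro psubset_card_mono) auto
  show ?thesis
  proof (rule ccontr)
    assume "f x \<noteq> g x"
    moreover have "card {t \<in> f ` univ A. t < f x} = card {t \<in> f ` univ A. t < g x}"
      using rank[of f, OF f] rank[of g, OF g] by (simp add: eq)
    moreover have "f x \<in> f ` univ A" "g x \<in> f ` univ A" "finite (f ` univ A)"
      using x AD(1) eq by auto
    ultimately show False
      using mono[of "f x" "f ` univ A" "g x"] mono[of "g x" "f ` univ A" "f x"]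
      by (metis less_irrefl nat_neq_iff)
  qed
qed

lemma order_embedding_exists:
  assumes B: "finite_ord_struct I r B" and H: "finite H" "card H = card (univ B)"
  obtains h :: "'a \<Rightarrow> nat" where "h ` univ B \<subseteq> H" "\<And>x y. (x, y) \<in> less_rel B \<Longrightarrow> h x < h y"
proof -
  note BD = finite_ord_structD[OF B]
  obtain k where k: "bij_betw k {..<card H} H" "strict_mono_on {..<card H} k"
    using ex_bij_betw_strict_mono_card[OF H(1)] by blast
  define rk where "rk = (\<lambda>x. card {y. (y, x) \<in> less_rel B})"
  have fin: "finite {y. (y, x) \<in> less_rel B}" for x
    using BD(1,5) by (auto intro: finite_subset)
  have rk: "rk x < card H" if "x \<in> univ B" for x
    unfolding rk_def H(2) using that BD(1,5,7) by (intro psubset_card_mono) auto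
  have mono: "rk x < rk y" if "(x, y) \<in> less_rel B" for x y
  proof -
    have "x \<in> {z. (z, y) \<in> less_rel B}" "x \<notin> {z. (z, x) \<in> less_rel B}"
      using that BD(7) by auto
    moreover have "{z. (z, x) \<in> less_rel B} \<subseteq> {z. (z, y) \<in> less_rel B}"
      using that BD(8) by blast
    ultimately show ?thesis unfolding rk_def by (intro psubset_card_mono[OF fin]) blast
  qed
  show thesis
  proof (rule that[of "k \<circ> rk"])
    show "(k \<circ> rk) ` univ B \<subseteq> H" using k(1) rk by (auto simp: bij_betw_def)
    show "(k \<circ> rk) x < (k \<circ> rk) y" if "(x, y) \<in> less_rel B" for x y
      using strict_mono_onD[OF k(2)] rk mono[OF that] BD(5,6)[OF that] by auto
  qed
qed

text \<open>A finite chain has at most one order embedding with a given image. Colouring embeddings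
  of \<open>A\<close> thus amounts to colouring subsets of size \<open>card (univ A)\<close>, and
  Ramsey's theorem for two colours applies.\<close>

lemma arrows_linear_orders:
  fixes A B :: "('a, 'i) ord_struct"
  assumes A: "finite_ord_struct I r A" and B: "finite_ord_struct I r B"
  obtains Y :: "(nat, 'i) ord_struct" where "finite_ord_struct I r Y" "arrows {} Y B A"
proof -
  note AD = finite_ord_structD[OF A] and BD = finite_ord_structD[OF B]
  obtain p :: nat where p: "partn_lst {..<p} [card (univ B), card (univ B)] (card (univ A))"
    using ramsey_full by blast
  define Y :: "(nat, 'i) ord_struct" where
    "Y = \<lparr>univ = {..<p}, rel = (\<lambda>_. {}), less_rel = {(x, y). x < y \<and> y < p}\<rparr>"
  have Y: "finite_ord_struct I r Y"
    by (rule finite_ord_structI) (auto simp: Y_def)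
  have emb_Y: "emb {} D Y f" if D: "finite_ord_struct I r D" and f: "f ` univ D \<subseteq> {..<p}"
    "\<And>x y. (x, y) \<in> less_rel D \<Longrightarrow> f x < f y" for D :: "('a, 'i) ord_struct" and f
  proof (rule emb_monoI[OF D Y])
    show "(f x, f y) \<in> less_rel Y" if "(x, y) \<in> less_rel D" for x y
      using f that finite_ord_structD(6)[OF D that] by (auto simp: Y_def)
  qed (use f in \<open>auto simp: Y_def\<close>)
  have mono: "f x < f y" if "emb {} D Y f" "finite_ord_struct I r D" "(x, y) \<in> less_rel D"
    for D :: "('a, 'i) ord_struct" and f x y
    using embD(3)[OF that(1)] finite_ord_structD(5,6)[OF that(2,3)] that(3) by (auto simp: Y_def)
  have "arrows {} Y B A"
    unfolding arrows_def
  proof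
    fix \<chi> :: "('a \<Rightarrow> nat) \<Rightarrow> bool"
    define F where "F = (\<lambda>T. if \<exists>e\<in>Emb {} A Y. e ` univ A = T \<and> \<chi> e then 1 else 0 :: nat)"
    have FE: "F (e ` univ A) = (if \<chi> e then 1 else 0)" if e: "e \<in> Emb {} A Y" for e
    proof -
      have "e' = e" if e': "e' \<in> Emb {} A Y" "e' ` univ A = e ` univ A" for e'
      proof (rule extensionalityI[of _ "univ A"])
        show "e' x = e x" if "x \<in> univ A" for x
          using order_embedding_unique[OF A mono[OF _ A] mono[OF _ A] e'(2) that] e e'
          by (simp add: Emb_def)
      qed (use e e' in \<open>auto simp: Emb_def\<close>)
      then show ?thesis using e unfolding F_def by metis
    qed
    have "F \<in> nsets {..<p} (card (univ A)) \<rightarrow> {..<2}" by (auto simp: F_def)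
    then obtain i H where H: "H \<in> nsets {..<p} (card (univ B))"
      and Hi: "F ` nsets H (card (univ A)) \<subseteq> {i}"
      using p unfolding partn_lst_def monochromatic_def
      by (fastforce simp: less_Suc_eq numeral_2_eq_2)
    have Hp: "H \<subseteq> {..<p}" "finite H" "card H = card (univ B)" using H by (auto simp: nsets_def)
    obtain h where h: "h ` univ B \<subseteq> H" "\<And>x y. (x, y) \<in> less_rel B \<Longrightarrow> h x < h y"
      using order_embedding_exists[OF B Hp(2,3)] by blast
    have hY: "emb {} B Y h" using emb_Y[OF B] h Hp(1) by blast
    define w where "w = restrict h (univ B)"
    have wE: "w \<in> Emb {} B Y" unfolding w_def by (rule restrict_in_Emb[OF hY])
    have "F (compose (univ A) w f ` univ A) = i" if f: "f \<in> Emb {} A B" for f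
    proof -
      have e: "compose (univ A) w f \<in> Emb {} A Y"
        using compose_in_Emb[OF Emb_emb[OF f] Emb_emb[OF wE]] .
      have "card (compose (univ A) w f ` univ A) = card (univ A)"
        using emb_inj_on[OF A Y Emb_emb[OF e]] by (rule card_image)
      moreover have "compose (univ A) w f ` univ A \<subseteq> H"
        using h(1) embD(1)[OF Emb_emb[OF f]] by (auto simp: compose_def w_def)
      ultimately have "compose (univ A) w f ` univ A \<in> nsets H (card (univ A))"
        using AD(1) by (simp add: nsets_def)
      then show ?thesis using Hi by blast
    qed
    then have "(if \<chi> (compose (univ A) w f) then 1 else 0) = i" if "f \<in> Emb {} A B" for f
      using FE[OF compose_in_Emb[OF Emb_emb[OF that] Emb_emb[OF wE]]] that by simp
    then have "\<chi> (compose (univ A) w f) = \<chi> (compose (univ A) w g)"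
      if "f \<in> Emb {} A B" "g \<in> Emb {} A B" for f g
      using that by (metis zero_neq_one)
    then show "\<exists>w\<in>Emb {} B Y. \<forall>f\<in>Emb {} A B. \<forall>g\<in>Emb {} A B.
        \<chi> (compose (univ A) w f) = \<chi> (compose (univ A) w g)"
      using wE by blast
  qed
  then show thesis using Y that by blast
qed

theorem Nesetril_Rodl:
  fixes A B :: "('a::infinite, 'i) ord_struct"
  assumes A: "finite_ord_struct I r A" and B: "finite_ord_struct I r B"
  obtains C :: "('a, 'i) ord_struct" where "finite_ord_struct I r C" "arrows I C B A"
    "irreducibles_within I r C {A, B}"
proof -
  obtain Y :: "(nat, 'i) ord_struct" where Y: "finite_ord_struct I r Y" "arrows {} Y B A"
    using arrows_linear_orders[OF A B] .
  obtain C0 :: "('a, 'i) ord_struct" where C0: "finite_ord_struct I r C0" "arrows I C0 B A"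
    using arrows_lift[OF A B Y(1) empty_subsetI Y(2)] by metis
  show thesis
    using arrows_lift[OF A B C0(1) subset_refl C0(2)] that by metis
qed

section \<open>Twins\<close>

text \<open>\<open>x\<close> is a twin of \<open>d\<close> over \<open>S\<close>, free from the rest of \<open>L\<close>, and placed in the order just below
  the next element of \<open>S\<close> after \<open>d\<close>.\<close>

definition twin :: "'i set \<Rightarrow> ('a, 'i) ord_struct \<Rightarrow> 'a set \<Rightarrow> 'a set \<Rightarrow> 'a \<Rightarrow> 'a \<Rightarrow> bool" where
  "twin I M L S d x \<longleftrightarrow> x \<in> univ M \<and> x \<notin> L \<and>
     (\<forall>y\<in>L. (x, y) \<in> less_rel M \<longleftrightarrow>
        (\<exists>u\<in>S. (d, u) \<in> less_rel M \<and> (u = y \<or> (u, y) \<in> less_rel M))) \<and>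
     (\<forall>i\<in>I. \<forall>xs. set xs \<subseteq> insert x L \<longrightarrow> x \<in> set xs \<longrightarrow>
        (xs \<in> rel M i \<longleftrightarrow> set xs \<subseteq> insert x (S - {d}) \<and> map (id(x := d)) xs \<in> rel M i))"

lemma twinD:
  assumes "twin I M L S d x"
  shows "x \<in> univ M" "x \<notin> L"
    and "y \<in> L \<Longrightarrow> (x, y) \<in> less_rel M \<longleftrightarrow>
        (\<exists>u\<in>S. (d, u) \<in> less_rel M \<and> (u = y \<or> (u, y) \<in> less_rel M))"
    and "i \<in> I \<Longrightarrow> set xs \<subseteq> insert x L \<Longrightarrow> x \<in> set xs \<Longrightarrow>
        xs \<in> rel M i \<longleftrightarrow> set xs \<subseteq> insert x (S - {d}) \<and> map (id(x := d)) xs \<in> rel M i"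
  using assms unfolding twin_def by blast+

lemma twin_less:
  assumes M: "finite_ord_struct I r M" and tw: "twin I M L S d x" and "S \<subseteq> L" "y \<in> S"
  shows "(x, y) \<in> less_rel M \<longleftrightarrow> (d, y) \<in> less_rel M"
  using twinD(3)[OF tw, of y] finite_ord_structD(8)[OF M] assms(3,4) by blast

lemma twin_greater:
  assumes M: "finite_ord_struct I r M" and tw: "twin I M L S d x" and S: "S \<subseteq> L" "L \<subseteq> univ M" "y \<in> S"
  shows "(y, x) \<in> less_rel M \<longleftrightarrow> (d, y) \<notin> less_rel M"
proof -
  have "y \<noteq> x" "x \<in> univ M" "y \<in> univ M" using twinD(1,2)[OF tw] S by auto
  then show ?thesis
    using twin_less[OF M tw S(1,3)] finite_ord_structD(9,10)[OF M] by metis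
qed

text \<open>Lets a twin chosen over the union of two images serve as a twin over one of the images
  alone.\<close>

lemma twin_shrink:
  assumes M: "finite_ord_struct I r M" and tw: "twin I M L S d x" and T: "T \<subseteq> S" "S \<subseteq> L" "d \<in> T"
  shows "twin I M T T d x"
  unfolding twin_def
proof (intro conjI ballI allI impI)
  show "x \<in> univ M" using twinD(1)[OF tw] .
  show xT: "x \<notin> T" using twinD(2)[OF tw] T by blast
  show "(x, y) \<in> less_rel M \<longleftrightarrow> (\<exists>u\<in>T. (d, u) \<in> less_rel M \<and> (u = y \<or> (u, y) \<in> less_rel M))"
    if "y \<in> T" for y
    using twin_less[OF M tw T(2), of y] that T(1) finite_ord_structD(8)[OF M] by blast
  show "xs \<in> rel M i \<longleftrightarrow> set xs \<subseteq> insert x (T - {d}) \<and> map (id(x := d)) xs \<in> rel M i"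
    if "i \<in> I" "set xs \<subseteq> insert x T" "x \<in> set xs" for i xs
  proof -
    have "set xs \<subseteq> insert x L" using that T by blast
    moreover have "set xs \<subseteq> insert x (S - {d}) \<longleftrightarrow> set xs \<subseteq> insert x (T - {d})"
      using that T by blast
    ultimately show ?thesis using twinD(4)[OF tw that(1) _ that(3)] by blast
  qed
qed

lemma twin_subset:
  assumes "twin I M L' S d x" "L \<subseteq> L'"
  shows "twin I M L S d x"
proof -
  have "insert x L \<subseteq> insert x L'" using assms(2) by blast
  then show ?thesis using assms unfolding twin_def by (meson in_mono subset_trans)
qed

lemma twin_extend:
  assumes tw: "twin I M L S d x" and M: "induced M' (univ M) = M" and S: "S \<subseteq> L" "L \<subseteq> univ M" "d \<in> S"
    and MM: "univ M \<subseteq> univ M'"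
  shows "twin I M' L S d x"
proof -
  have r: "xs \<in> rel M i \<longleftrightarrow> xs \<in> rel M' i" if "set xs \<subseteq> univ M" for xs i
    using induced_simps(2)[of xs M' "univ M" i] M that by simp
  have l: "(y, z) \<in> less_rel M \<longleftrightarrow> (y, z) \<in> less_rel M'" if "y \<in> univ M" "z \<in> univ M" for y z
    using induced_simps(3)[of y z M' "univ M"] M that by simp
  have x: "x \<in> univ M" using twinD(1)[OF tw] .
  show ?thesis
    unfolding twin_def
  proof (intro conjI ballI allI impI)
    show "x \<in> univ M'" "x \<notin> L" using x MM twinD(2)[OF tw] by auto
    show "(x, y) \<in> less_rel M' \<longleftrightarrow> (\<exists>u\<in>S. (d, u) \<in> less_rel M' \<and> (u = y \<or> (u, y) \<in> less_rel M'))"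
      if y: "y \<in> L" for y
    proof -
      have "y \<in> univ M" "d \<in> univ M" "S \<subseteq> univ M" using y S by auto
      then have "(\<exists>u\<in>S. (d, u) \<in> less_rel M \<and> (u = y \<or> (u, y) \<in> less_rel M)) \<longleftrightarrow>
          (\<exists>u\<in>S. (d, u) \<in> less_rel M' \<and> (u = y \<or> (u, y) \<in> less_rel M'))"
        using l by (intro bex_cong) auto
      then show ?thesis using twinD(3)[OF tw y] l[OF x \<open>y \<in> univ M\<close>] by simp
    qed
    show "xs \<in> rel M' i \<longleftrightarrow> set xs \<subseteq> insert x (S - {d}) \<and> map (id(x := d)) xs \<in> rel M' i"
      if i: "i \<in> I" "set xs \<subseteq> insert x L" "x \<in> set xs" for i xs
    proof -
      have "set xs \<subseteq> univ M" "set (map (id(x := d)) xs) \<subseteq> univ M" using i S x by auto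
      then show ?thesis using twinD(4)[OF tw i] r by blast
    qed
  qed
qed

text \<open>Compared with \<open>S - {d}\<close>, the new vertex behaves exactly as \<open>d\<close>
  does. With \<open>d\<close> itself left out of the domain, sending the twin back to
  \<open>d\<close> is an embedding.\<close>

lemma twin_retract:
  assumes M: "finite_ord_struct I r M" and tw: "twin I M L S d x"
    and S: "S \<subseteq> L" "L \<subseteq> univ M" "d \<in> S"
  shows "emb I (induced M (insert x (S - {d}))) M (id(x := d))"
proof (rule emb_monoI[OF finite_ord_struct_induced[OF M] M])
  let ?D = "induced M (insert x (S - {d}))"
  have x: "x \<in> univ M" "x \<notin> L" using twinD(1,2)[OF tw] .
  show "insert x (S - {d}) \<subseteq> univ M" using x S by blast
  show "(id(x := d)) y \<in> univ M" if "y \<in> univ ?D" for y using that S by auto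
  show "map (id(x := d)) xs \<in> rel M i \<longleftrightarrow> xs \<in> rel ?D i"
    if i: "i \<in> I" and xs: "set xs \<subseteq> univ ?D" for i xs
  proof (cases "x \<in> set xs")
    case True
    have "set xs \<subseteq> insert x L" using xs S by auto
    from twinD(4)[OF tw i this True] show ?thesis using xs by auto
  next
    case False
    then have "map (id(x := d)) xs = xs" by (auto intro!: map_idI)
    then show ?thesis using xs by (metis induced_simps(1,2))
  qed
  show "((id(x := d)) y, (id(x := d)) z) \<in> less_rel M" if yz: "(y, z) \<in> less_rel ?D" for y z
  proof -
    have yz': "(y, z) \<in> less_rel M" "y \<in> insert x (S - {d})" "z \<in> insert x (S - {d})"
      using yz by auto
    consider "y = x" "z = x" | "y = x" "z \<in> S" "z \<noteq> x" | "z = x" "y \<in> S" "y \<noteq> x" "y \<noteq> d" | "y \<noteq> x" "z \<noteq> x"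
      using yz' by blast
    then show ?thesis
    proof cases
      case 1
      then show ?thesis using yz'(1) finite_ord_structD(7)[OF M] by blast
    next
      case 2
      then show ?thesis using twin_less[OF M tw S(1)] yz'(1) by simp
    next
      case 3
      then have "(d, y) \<notin> less_rel M" using twin_greater[OF M tw S(1,2)] yz'(1) by simp
      then show ?thesis using 3 finite_ord_structD(10)[OF M, of d y] S by auto
    next
      case 4
      then show ?thesis using yz'(1) by simp
    qed
  qed
qed

lemma irreducibles_within_trans:
  assumes "irreducibles_within I r M' {M}" "irreducibles_within I r M \<D>"
  shows "irreducibles_within I r M' \<D>"
  using assms unfolding irreducibles_within_def by blast

text \<open>No tuple contains the new vertex together with \<open>d\<close> or with an element
  outside \<open>S\<close>. An irreducible structure through the new vertex therefore lies in its
  union with \<open>S - {d}\<close> and retracts into \<open>D\<close>.\<close>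

lemma add_twin:
  fixes D :: "('a::infinite, 'i) ord_struct"
  assumes D: "finite_ord_struct I r D" and S: "S \<subseteq> univ D" "d \<in> S"
  obtains M x where "finite_ord_struct I r M" "univ D \<subseteq> univ M" "induced M (univ D) = D"
    "twin I M (univ D) S d x" "irreducibles_within I r M {D}"
proof -
  note DD = finite_ord_structD[OF D]
  obtain x where x: "x \<notin> univ D" using ex_new_if_finite[OF infinite_UNIV DD(1)] by blast
  have less_x: "(x, y) \<notin> less_rel D" "(y, x) \<notin> less_rel D" for y using DD(5,6) x by auto
  \<comment> \<open>The final segment of \<open>D\<close> generated by the elements of
    \<open>S\<close> above \<open>d\<close>; the new vertex is inserted directly below it.\<close>
  define up where "up = (\<lambda>y. \<exists>u\<in>S. (d, u) \<in> less_rel D \<and> (u = y \<or> (u, y) \<in> less_rel D))"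
  have up_mono: "up z" if "up y" "(y, z) \<in> less_rel D" for y z
    using that DD(8) unfolding up_def by blast
  have up_sep: "(y, z) \<in> less_rel D" if "\<not> up y" "up z" "y \<in> univ D" "z \<in> univ D" for y z
    using that up_mono DD(10) by metis
  define M where "M = \<lparr>univ = insert x (univ D),
    rel = (\<lambda>i. rel D i \<union> {xs. x \<in> set xs \<and> set xs \<subseteq> insert x (S - {d}) \<and> map (id(x := d)) xs \<in> rel D i}),
    less_rel = less_rel D \<union> {(x, y) | y. y \<in> univ D \<and> up y} \<union> {(y, x) | y. y \<in> univ D \<and> \<not> up y}\<rparr>"
  have M_simps: "univ M = insert x (univ D)"
    "xs \<in> rel M i \<longleftrightarrow> xs \<in> rel D i \<or>
       x \<in> set xs \<and> set xs \<subseteq> insert x (S - {d}) \<and> map (id(x := d)) xs \<in> rel D i"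
    "(y, z) \<in> less_rel M \<longleftrightarrow> (y, z) \<in> less_rel D \<or> y = x \<and> z \<in> univ D \<and> up z \<or>
       z = x \<and> y \<in> univ D \<and> \<not> up y" for xs i y z
    by (auto simp: M_def)
  have xs_D: "x \<notin> set xs" if "xs \<in> rel D i" for xs i using DD(2)[OF that] x by blast
  have M: "finite_ord_struct I r M"
  proof (rule finite_ord_structI)
    show "finite (univ M)" using DD(1) by (simp add: M_simps)
    show "i \<in> I \<and> set xs \<subseteq> univ M \<and> length xs = r i" if "xs \<in> rel M i" for i xs
      using that DD(2,3,4)[of xs i] DD(3,4)[of "map (id(x := d)) xs" i] S by (auto simp: M_simps)
    show "y \<in> univ M \<and> z \<in> univ M" if "(y, z) \<in> less_rel M" for y z
      using that DD(5,6)[of y z] by (auto simp: M_simps)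
    show "(y, y) \<notin> less_rel M" for y using DD(7) x by (auto simp: M_simps)
    show "(y, w) \<in> less_rel M" if "(y, z) \<in> less_rel M" "(z, w) \<in> less_rel M" for y z w
      using that x less_x DD(5,6,8) up_mono up_sep unfolding M_simps by metis
    show "(y, z) \<in> less_rel M \<or> (z, y) \<in> less_rel M" if "y \<in> univ M" "z \<in> univ M" "y \<noteq> z" for y z
      using that DD(10) unfolding M_simps by blast
  qed
  have ind: "induced M (univ D) = D"
  proof (rule ord_struct.equality)
    show "rel (induced M (univ D)) = rel D"
      using x DD(2) by (intro ext set_eqI) (auto simp: M_simps)
    show "less_rel (induced M (univ D)) = less_rel D"
      using x DD(5,6) by (auto simp: M_simps)
  qed simp_all
  have tw: "twin I M (univ D) S d x"
    unfolding twin_def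
  proof (intro conjI ballI allI impI)
    show "(x, y) \<in> less_rel M \<longleftrightarrow> (\<exists>u\<in>S. (d, u) \<in> less_rel M \<and> (u = y \<or> (u, y) \<in> less_rel M))"
      if y: "y \<in> univ D" for y
    proof -
      have "d \<noteq> x" "y \<noteq> x" "\<And>u. u \<in> S \<Longrightarrow> u \<noteq> x" using x S y by auto
      then show ?thesis using less_x y unfolding M_simps up_def by blast
    qed
    show "xs \<in> rel M i \<longleftrightarrow> set xs \<subseteq> insert x (S - {d}) \<and> map (id(x := d)) xs \<in> rel M i"
      if "x \<in> set xs" for i xs
    proof -
      have "x \<notin> set (map (id(x := d)) xs)" using x S by auto
      then show ?thesis using that xs_D unfolding M_simps by blast
    qed
  qed (use x in \<open>auto simp: M_simps\<close>)
  have "irreducibles_within I r M {D}"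
    unfolding irreducibles_within_def
  proof (intro allI impI)
    fix F :: "('a, 'i) ord_struct" and \<phi>
    assume F: "finite_ord_struct I r F" "irreducible_struct I F" and \<phi>: "emb I F M \<phi>"
    have into_D: "\<exists>D\<in>{D}. \<exists>\<phi>. emb I F D \<phi>" if "emb I F M \<psi>" "\<psi> ` univ F \<subseteq> univ D" for \<psi>
      using emb_into_induced[OF that] ind by (auto simp: M_simps)
    show "\<exists>D\<in>{D}. \<exists>\<phi>. emb I F D \<phi>"
    proof (cases "x \<in> \<phi> ` univ F")
      case False
      then show ?thesis using into_D[OF \<phi>] embD(1)[OF \<phi>] by (auto simp: M_simps)
    next
      case True
      then obtain v where v: "v \<in> univ F" "\<phi> v = x" by blast
      have "\<phi> w \<in> insert x (S - {d})" if w: "w \<in> univ F" for w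
      proof (cases "w = v")
        case False
        then obtain i xs where xs: "i \<in> I" "xs \<in> rel F i" "v \<in> set xs" "w \<in> set xs"
          using irreducible_structD[OF F(2) v(1) w] by metis
        then have "map \<phi> xs \<in> rel M i" using embD(2)[OF \<phi>] finite_ord_structD(2)[OF F(1)] by blast
        moreover have "x \<in> set (map \<phi> xs)" using xs(3) v(2) by auto
        ultimately have "set (map \<phi> xs) \<subseteq> insert x (S - {d})" using xs_D unfolding M_simps by blast
        then show ?thesis using xs(4) by auto
      qed (use v in simp)
      then have im: "\<phi> ` univ F \<subseteq> insert x (S - {d})" by blast
      have "insert x (S - {d}) \<subseteq> univ M" using S by (auto simp: M_simps)
      from emb_comp[OF emb_into_induced[OF \<phi> im this] twin_retract[OF M tw S(1) _ S(2)]]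
      have "emb I F M (id(x := d) \<circ> \<phi>)" by (auto simp: M_simps)
      moreover have "(id(x := d) \<circ> \<phi>) ` univ F \<subseteq> univ D" using im S by auto
      ultimately show ?thesis by (rule into_D)
    qed
  qed
  moreover have "univ D \<subseteq> univ M" by (auto simp: M_simps)
  ultimately show thesis using that M ind tw by blast
qed

text \<open>Twins added earlier stay twins, as an extension changes nothing among old vertices.
  Later ones are free even from the enlarged structure, hence from \<open>D\<close>.\<close>

lemma add_twins:
  fixes D :: "('a::infinite, 'i) ord_struct"
  assumes D: "finite_ord_struct I r D" and Z: "finite Z" "\<forall>(S, d)\<in>Z. S \<subseteq> univ D \<and> d \<in> S"
  shows "\<exists>M. finite_ord_struct I r M \<and> univ D \<subseteq> univ M \<and> induced M (univ D) = D \<and>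
    irreducibles_within I r M {D} \<and> (\<forall>(S, d)\<in>Z. \<exists>x. twin I M (univ D) S d x)"
  using Z
proof (induction Z rule: finite_induct)
  case empty
  have "induced D (univ D) = D"
    using finite_ord_structD(2,5,6)[OF D] by (intro ord_struct.equality) (auto simp: induced_def)
  then show ?case using D by (auto simp: irreducibles_within_def)
next
  case (insert z Z)
  obtain S d where z: "z = (S, d)" by (cases z)
  have S: "S \<subseteq> univ D" "d \<in> S" using insert.prems z by auto
  obtain M where M: "finite_ord_struct I r M" "univ D \<subseteq> univ M" "induced M (univ D) = D"
    "irreducibles_within I r M {D}" "\<forall>(S, d)\<in>Z. \<exists>x. twin I M (univ D) S d x"
    using insert by auto
  obtain M' x where M': "finite_ord_struct I r M'" "univ M \<subseteq> univ M'" "induced M' (univ M) = M"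
    "twin I M' (univ M) S d x" "irreducibles_within I r M' {M}"
    using add_twin[OF M(1) subset_trans[OF S(1) M(2)] S(2)] by metis
  have "induced M' (univ D) = D" using induced_induced[OF M(2), of M'] M(3) M'(3) by simp
  moreover have "\<exists>x. twin I M' (univ D) S d x" using twin_subset[OF M'(4) M(2)] by blast
  moreover have "\<exists>x. twin I M' (univ D) S' d' x" if Z: "(S', d') \<in> Z" for S' d'
  proof -
    have "S' \<subseteq> univ D" "d' \<in> S'" using insert.prems Z by auto
    moreover obtain y where "twin I M (univ D) S' d' y" using M(5) Z by blast
    ultimately show ?thesis using twin_extend[OF _ M'(3) _ M(2) _ M'(2)] by blast
  qed
  moreover have "univ D \<subseteq> univ M'" using M(2) M'(2) by blast
  ultimately show ?case
    using M'(1) irreducibles_within_trans[OF M'(5) M(4)] unfolding z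
    by (intro exI[of _ M'] conjI) blast+
qed

text \<open>A twin is known to be free only from the level below it, so in a sequence of moves each
  takes its new vertex from the next level. One extension serves all pairs \<open>S\<close>,
  \<open>d\<close> of a level, as these are finitely many.\<close>

lemma twin_tower:
  fixes D :: "('a::infinite, 'i) ord_struct"
  assumes D: "finite_ord_struct I r D"
  shows "\<exists>M Lv. finite_ord_struct I r M \<and> induced M (univ D) = D \<and> irreducibles_within I r M {D} \<and>
    Lv 0 = univ D \<and> Lv N = univ M \<and> (\<forall>k<N. Lv k \<subseteq> Lv (Suc k)) \<and> (\<forall>k\<le>N. Lv k \<subseteq> univ M) \<and>
    (\<forall>k<N. \<forall>S d. S \<subseteq> Lv k \<longrightarrow> d \<in> S \<longrightarrow> (\<exists>x\<in>Lv (Suc k). twin I M (Lv k) S d x))"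
proof (induction N)
  case 0
  have "induced D (univ D) = D"
    using finite_ord_structD(2,5,6)[OF D] by (intro ord_struct.equality) (auto simp: induced_def)
  then show ?case using D by (intro exI[of _ D] exI[of _ "\<lambda>_. univ D"]) (auto simp: irreducibles_within_def)
next
  case (Suc N)
  then obtain M Lv where M: "finite_ord_struct I r M" "induced M (univ D) = D"
    "irreducibles_within I r M {D}" and Lv: "Lv 0 = univ D" "Lv N = univ M"
    "\<forall>k<N. Lv k \<subseteq> Lv (Suc k)" "\<forall>k\<le>N. Lv k \<subseteq> univ M"
    and tw: "\<forall>k<N. \<forall>S d. S \<subseteq> Lv k \<longrightarrow> d \<in> S \<longrightarrow> (\<exists>x\<in>Lv (Suc k). twin I M (Lv k) S d x)"
    by (elim exE conjE) (rule that)
  define Z where "Z = {(S, d). S \<subseteq> univ M \<and> d \<in> S}"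
  have "Z \<subseteq> Pow (univ M) \<times> univ M" by (auto simp: Z_def)
  then have finZ: "finite Z" using finite_ord_structD(1)[OF M(1)] by (simp add: finite_subset)
  have ZM: "\<forall>(S, d)\<in>Z. S \<subseteq> univ M \<and> d \<in> S" by (auto simp: Z_def)
  obtain M' where M': "finite_ord_struct I r M'" "univ M \<subseteq> univ M'" "induced M' (univ M) = M"
    "irreducibles_within I r M' {M}" and twZ: "\<forall>(S, d)\<in>Z. \<exists>x. twin I M' (univ M) S d x"
    using add_twins[OF M(1) finZ ZM] by (elim exE conjE) (rule that)
  define Lv' where "Lv' = Lv(Suc N := univ M')"
  have "univ D \<subseteq> univ M" using Lv(1,4) by auto
  then have "induced M' (univ D) = D" using induced_induced[of "univ D" "univ M" M'] M(2) M'(3) by simp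
  moreover have "\<exists>x\<in>Lv' (Suc k). twin I M' (Lv' k) S d x" if k: "k < Suc N" and S: "S \<subseteq> Lv' k" "d \<in> S" for k S d
  proof (cases "k = N")
    case True
    then have "(S, d) \<in> Z" using S Lv(2) by (auto simp: Z_def Lv'_def)
    then obtain x where "twin I M' (univ M) S d x" using twZ by blast
    then show ?thesis using True Lv(2) twinD(1) by (fastforce simp: Lv'_def)
  next
    case False
    then have k: "k < N" using k by simp
    then have "S \<subseteq> Lv k" using S by (simp add: Lv'_def)
    then obtain x where x: "x \<in> Lv (Suc k)" "twin I M (Lv k) S d x" using tw k S(2) by blast
    have "Lv k \<subseteq> univ M" using Lv(4) k by simp
    from twin_extend[OF x(2) M'(3) \<open>S \<subseteq> Lv k\<close> this S(2) M'(2)] show ?thesis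
      using x(1) k by (auto simp: Lv'_def)
  qed
  moreover have "Lv' k \<subseteq> Lv' (Suc k)" if "k < Suc N" for k
    using that Lv(2,3) M'(2) by (cases "k = N") (auto simp: Lv'_def)
  moreover have "Lv' k \<subseteq> univ M'" if "k \<le> Suc N" for k
    using that Lv(4) M'(2) by (cases "k = Suc N") (auto simp: Lv'_def le_Suc_eq)
  ultimately show ?case
    using M'(1) irreducibles_within_trans[OF M'(4) M(3)] Lv(1)
    by (intro exI[of _ M'] exI[of _ Lv']) (auto simp: Lv'_def)
qed

section \<open>Canonical colourings\<close>

text \<open>Invariance concerns only whether two colours are equal, not the colours. In the bound on
  \<open>N\<close>, twice \<open>card (univ A)\<close> pays for two rounds with one level per moved
  element; the summand 2 guarantees twins over the levels 0 and 1.\<close>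

locale invariant_colouring =
  fixes I :: "'i set" and r :: "'i \<Rightarrow> nat" and A M :: "('a, 'i) ord_struct"
    and Lv :: "nat \<Rightarrow> 'a set" and N :: nat and c :: "('a \<Rightarrow> 'a) \<Rightarrow> nat"
  assumes A: "finite_ord_struct I r A" and M: "finite_ord_struct I r M"
    and Lv_Suc: "\<And>k. k < N \<Longrightarrow> Lv k \<subseteq> Lv (Suc k)" and Lv_M: "\<And>k. k \<le> N \<Longrightarrow> Lv k \<subseteq> univ M"
    and twins: "\<And>k S d. k < N \<Longrightarrow> S \<subseteq> Lv k \<Longrightarrow> d \<in> S \<Longrightarrow> \<exists>x\<in>Lv (Suc k). twin I M (Lv k) S d x"
    and N: "2 * card (univ A) + 2 \<le> N"
    and invariant: "\<And>f g f' g' h. f \<in> Emb I A M \<Longrightarrow> g \<in> Emb I A M \<Longrightarrow>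
      emb I (induced M (f ` univ A \<union> g ` univ A)) M h \<Longrightarrow>
      f' = compose (univ A) h f \<Longrightarrow> g' = compose (univ A) h g \<Longrightarrow> c f = c g \<longleftrightarrow> c f' = c g'"
begin

lemmas AD = finite_ord_structD[OF A]
lemmas MD = finite_ord_structD[OF M]

lemma Lv_mono: "j \<le> k \<Longrightarrow> k \<le> N \<Longrightarrow> Lv j \<subseteq> Lv k"
proof (induction k rule: dec_induct)
  case (step k)
  then show ?case using Lv_Suc[of k] by auto
qed simp

lemma EmbD:
  assumes "f \<in> Emb I A M"
  shows "a \<in> univ A \<Longrightarrow> f a \<in> univ M" "f ` univ A \<subseteq> univ M"
    and "a \<in> univ A \<Longrightarrow> b \<in> univ A \<Longrightarrow> (f a, f b) \<in> less_rel M \<longleftrightarrow> (a, b) \<in> less_rel A"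
    and "a \<in> univ A \<Longrightarrow> b \<in> univ A \<Longrightarrow> f a = f b \<longleftrightarrow> a = b"
    and "i \<in> I \<Longrightarrow> set xs \<subseteq> univ A \<Longrightarrow> map f xs \<in> rel M i \<longleftrightarrow> xs \<in> rel A i"
  using embD[OF Emb_emb[OF assms]] emb_eq_iff[OF A M Emb_emb[OF assms]] by auto

lemma EmbI: "f \<in> extensional (univ A) \<Longrightarrow> emb I A M f \<Longrightarrow> f \<in> Emb I A M"
  by (simp add: Emb_def)

lemma Emb_ext: "f \<in> Emb I A M \<Longrightarrow> f \<in> extensional (univ A)"
  by (simp add: Emb_def)

lemma invariantI:
  assumes "f \<in> Emb I A M" "g \<in> Emb I A M" "f' \<in> Emb I A M" "g' \<in> Emb I A M"
    and "emb I (induced M (f ` univ A \<union> g ` univ A)) M h"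
    and "\<And>a. a \<in> univ A \<Longrightarrow> h (f a) = f' a" "\<And>a. a \<in> univ A \<Longrightarrow> h (g a) = g' a"
  shows "c f = c g \<longleftrightarrow> c f' = c g'"
proof (rule invariant[OF assms(1,2,5)])
  show "f' = compose (univ A) h f"
    by (rule extensionalityI[OF Emb_ext[OF assms(3)] compose_extensional]) (simp add: assms(6) compose_eq)
  show "g' = compose (univ A) h g"
    by (rule extensionalityI[OF Emb_ext[OF assms(4)] compose_extensional]) (simp add: assms(7) compose_eq)
qed

lemma emb_induced_subset:
  assumes "emb I (induced M T) M h" "S \<subseteq> T"
  shows "emb I (induced M S) M h"
proof (rule embI)
  show "map h xs \<in> rel M i \<longleftrightarrow> xs \<in> rel (induced M S) i"
    if "i \<in> I" "set xs \<subseteq> univ (induced M S)" for i xs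
    using embD(2)[OF assms(1) that(1), of xs] that(2) assms(2) by auto
  show "(h x, h y) \<in> less_rel M \<longleftrightarrow> (x, y) \<in> less_rel (induced M S)"
    if "x \<in> univ (induced M S)" "y \<in> univ (induced M S)" for x y
    using embD(3)[OF assms(1), of x y] that assms(2) by auto
qed (use embD(1)[OF assms(1)] assms(2) in auto)

lemma list_in_image:
  assumes "set xs \<subseteq> f ` X"
  obtains bs where "xs = map f bs" "set bs \<subseteq> X"
proof (rule that[of "map (inv_into X f) xs"])
  show "xs = map f (map (inv_into X f) xs)"
    using assms by (auto simp: f_inv_into_f subset_iff intro!: map_idI[symmetric])
  show "set (map (inv_into X f) xs) \<subseteq> X"
    using assms by (auto simp: inv_into_into subset_iff)
qed

section \<open>Free moves and irrelevant elements\<close>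

definition free_move :: "'a \<Rightarrow> ('a \<Rightarrow> 'a) \<Rightarrow> 'a \<Rightarrow> bool" where
  "free_move a f x \<longleftrightarrow> f \<in> Emb I A M \<and> a \<in> univ A \<and> twin I M (f ` univ A) (f ` univ A) (f a) x"

lemma free_moveD:
  assumes "free_move a f x"
  shows "f \<in> Emb I A M" "a \<in> univ A" "twin I M (f ` univ A) (f ` univ A) (f a) x"
    "x \<in> univ M" "x \<notin> f ` univ A"
    and "b \<in> univ A \<Longrightarrow> (x, f b) \<in> less_rel M \<longleftrightarrow> (a, b) \<in> less_rel A"
    and "b \<in> univ A \<Longrightarrow> (f b, x) \<in> less_rel M \<longleftrightarrow> (a, b) \<notin> less_rel A"
proof -
  show f: "f \<in> Emb I A M" and a: "a \<in> univ A" and tw: "twin I M (f ` univ A) (f ` univ A) (f a) x"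
    using assms by (auto simp: free_move_def)
  show "x \<in> univ M" "x \<notin> f ` univ A" using twinD(1,2)[OF tw] by auto
  show "b \<in> univ A \<Longrightarrow> (x, f b) \<in> less_rel M \<longleftrightarrow> (a, b) \<in> less_rel A"
    using twin_less[OF M tw subset_refl, of "f b"] EmbD(3)[OF f a] by auto
  show "b \<in> univ A \<Longrightarrow> (f b, x) \<in> less_rel M \<longleftrightarrow> (a, b) \<notin> less_rel A"
    using twin_greater[OF M tw subset_refl EmbD(2)[OF f], of "f b"] EmbD(3)[OF f a] by auto
qed

text \<open>Followed by the retraction that sends the twin back, the moved map is \<open>f\<close>;
  the retraction is an embedding and cancels.\<close>

lemma moved_in_Emb:
  assumes mv: "free_move a f x"
  shows "f(a := x) \<in> Emb I A M"
proof (rule EmbI)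
  note D = free_moveD[OF mv]
  let ?S = "insert x (f ` univ A - {f a})"
  show "f(a := x) \<in> extensional (univ A)" using Emb_ext[OF D(1)] D(2) by (auto simp: extensional_def)
  have im: "(f(a := x)) b \<in> ?S" if "b \<in> univ A" for b
    using that D(2) by (auto simp: EmbD(4)[OF D(1)])
  have ret: "emb I (induced M ?S) M (id(x := f a))"
    using twin_retract[OF M D(3) subset_refl EmbD(2)[OF D(1)]] D(2) by blast
  have "f b = (id(x := f a) \<circ> f(a := x)) b" if "b \<in> univ A" for b
    using that D(5) by auto
  then have comp: "emb I A M (id(x := f a) \<circ> f(a := x))"
    using Emb_emb[OF D(1)] emb_cong[of A f "id(x := f a) \<circ> f(a := x)"] by blast
  have "emb I A (induced M ?S) (f(a := x))"
    using emb_cancel[OF comp ret] im by simp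
  moreover have "?S \<subseteq> univ M" using EmbD(2)[OF D(1)] D(4) by blast
  ultimately have "emb I A M (id \<circ> f(a := x))" by (intro emb_comp[OF _ emb_induced])
  then show "emb I A M (f(a := x))" by simp
qed

text \<open>The twin conditions fix all relations and comparisons of \<open>x\<close> with f(A).
  Hence sending f(b) to g(b) and \<open>x\<close> to \<open>y\<close> is an embedding, and it
  carries \<open>f\<close> and its moved version to \<open>g\<close> and its moved version.\<close>

lemma free_move_same_type:
  assumes f: "free_move a f x" and g: "free_move a g y"
  shows "c f = c (f(a := x)) \<longleftrightarrow> c g = c (g(a := y))"
proof -
  note F = free_moveD[OF f] and G = free_moveD[OF g]
  let ?T = "insert x (f ` univ A)"
  define h where "h = (\<lambda>z. if z = x then y else g (inv_into (univ A) f z))"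
  have hx: "h x = y" by (simp add: h_def)
  have hf: "h (f b) = g b" if "b \<in> univ A" for b
    using that F(5) inv_into_f_f[OF emb_inj_on[OF A M Emb_emb[OF F(1)]] that] by (auto simp: h_def)
  have TM: "?T \<subseteq> univ M" using EmbD(2)[OF F(1)] F(4) by blast
  have "emb I (induced M ?T) M h"
  proof (rule emb_monoI[OF finite_ord_struct_induced[OF M TM] M])
    show "h z \<in> univ M" if "z \<in> univ (induced M ?T)" for z
      using that hx hf G(4) EmbD(1)[OF G(1)] by auto
    show "(h z, h w) \<in> less_rel M" if zw: "(z, w) \<in> less_rel (induced M ?T)" for z w
    proof -
      have zw': "(z, w) \<in> less_rel M" "z \<in> ?T" "w \<in> ?T" using zw by auto
      show ?thesis
      proof (cases "z = x")
        case True
        then obtain b where "b \<in> univ A" "w = f b" using zw' MD(7) by blast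
        then show ?thesis using True zw'(1) F(6) G(6) hx hf by simp
      next
        case False
        then obtain b where b: "b \<in> univ A" "z = f b" using zw' by blast
        show ?thesis
        proof (cases "w = x")
          case True
          then show ?thesis using b zw'(1) F(7) G(7) hx hf by simp
        next
          case False
          then obtain b' where "b' \<in> univ A" "w = f b'" using zw' by blast
          then show ?thesis using b zw'(1) EmbD(3)[OF F(1)] EmbD(3)[OF G(1)] hf by simp
        qed
      qed
    qed
    fix i xs assume i: "i \<in> I" and "set xs \<subseteq> univ (induced M ?T)"
    then have xs: "set xs \<subseteq> ?T" by simp
    have "map h xs \<in> rel M i \<longleftrightarrow> xs \<in> rel M i"
    proof (cases "x \<in> set xs")
      case False
      then have "set xs \<subseteq> f ` univ A" using xs by blast
      then obtain bs where bs: "xs = map f bs" "set bs \<subseteq> univ A" by (rule list_in_image)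
      have "map h xs = map g bs" using bs hf by auto
      then show ?thesis using EmbD(5)[OF F(1) i bs(2)] EmbD(5)[OF G(1) i bs(2)] bs(1) by metis
    next
      case True
      have "set (map (id(x := f a)) xs) \<subseteq> f ` univ A" using xs F(2) by auto
      then obtain bs where bs: "map (id(x := f a)) xs = map f bs" "set bs \<subseteq> univ A" by (rule list_in_image)
      have hz: "(id(y := g a)) (h z) = h ((id(x := f a)) z)" if "z \<in> set xs" for z
      proof (cases "z = x")
        case True
        then show ?thesis using hx hf[OF F(2)] by simp
      next
        case False
        then obtain b where b: "b \<in> univ A" "z = f b" using \<open>z \<in> set xs\<close> xs by blast
        then have "h z \<noteq> y" using hf G(5) by auto
        then show ?thesis using False by simp
      qed
      have "map (id(y := g a)) (map h xs) = map h (map (id(x := f a)) xs)" using hz by simp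
      also have "\<dots> = map g bs" unfolding bs(1) using bs(2) hf by auto
      finally have gb: "map (id(y := g a)) (map h xs) = map g bs" .
      have rels: "map (id(x := f a)) xs \<in> rel M i \<longleftrightarrow> map (id(y := g a)) (map h xs) \<in> rel M i"
        unfolding gb bs(1) using EmbD(5)[OF F(1) i bs(2)] EmbD(5)[OF G(1) i bs(2)] by simp
      have hin: "set (map h xs) \<subseteq> insert y (g ` univ A)" "y \<in> set (map h xs)"
        using xs True hx hf by auto
      \<comment> \<open>A tuple with both the twin and its original is unrelated, so the map must
        also match the occurrences of the originals.\<close>
      have "h z = g a \<longleftrightarrow> z = f a" if "z \<in> set xs" for z
        using subsetD[OF xs that] hx hf F(2,5) G(5) EmbD(4)[OF F(1)] EmbD(4)[OF G(1)] by auto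
      then have "g a \<in> set (map h xs) \<longleftrightarrow> f a \<in> set xs" by (metis (no_types) imageE imageI set_map)
      moreover have "g a \<noteq> y" "f a \<noteq> x" using F(2,5) G(5) by auto
      ultimately have "set xs \<subseteq> insert x (f ` univ A - {f a}) \<longleftrightarrow>
          set (map h xs) \<subseteq> insert y (g ` univ A - {g a})"
        using xs hin(1) by blast
      then show ?thesis
        using twinD(4)[OF F(3) i xs True] twinD(4)[OF G(3) i hin] rels by blast
    qed
    then show "map h xs \<in> rel M i \<longleftrightarrow> xs \<in> rel (induced M ?T) i" using xs by simp
  qed
  moreover have "f ` univ A \<union> (f(a := x)) ` univ A \<subseteq> ?T" by auto
  ultimately have "emb I (induced M (f ` univ A \<union> (f(a := x)) ` univ A)) M h"
    by (rule emb_induced_subset)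
  then show ?thesis
    by (rule invariantI[OF F(1) moved_in_Emb[OF f] G(1) moved_in_Emb[OF g]]) (use hf hx in auto)
qed

text \<open>One free move without change of colour is enough as definition: by
  \<open>free_move_same_type\<close> every other free move of the same element then keeps the colour
  as well.\<close>

definition irrelevant :: "'a \<Rightarrow> bool" where
  "irrelevant a \<longleftrightarrow> (\<exists>f x. free_move a f x \<and> c f = c (f(a := x)))"

lemma irrelevantD: "irrelevant a \<Longrightarrow> free_move a f x \<Longrightarrow> c (f(a := x)) = c f"
  using free_move_same_type unfolding irrelevant_def by metis

text \<open>Let \<open>x\<close> be a twin of g(a) over both images. As g(a) is not in f(A), sending
  \<open>x\<close> back fixes \<open>f\<close> and takes the moved \<open>g\<close> to
  \<open>g\<close>. So the moved \<open>g\<close> has the colour of \<open>f\<close>, which is that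
  of \<open>g\<close>.\<close>

lemma irrelevant_if_outside:
  assumes fg: "f \<in> Emb I A M" "g \<in> Emb I A M" "f ` univ A \<subseteq> Lv k" "g ` univ A \<subseteq> Lv k" "k < N"
    and eq: "c f = c g" and a: "a \<in> univ A" "g a \<notin> f ` univ A"
  shows "irrelevant a"
proof -
  let ?S = "f ` univ A \<union> g ` univ A"
  have S: "?S \<subseteq> Lv k" "g a \<in> ?S" using fg a by auto
  obtain x where tw: "twin I M (Lv k) ?S (g a) x" using twins[OF fg(5) S] by blast
  have "twin I M (g ` univ A) (g ` univ A) (g a) x" using twin_shrink[OF M tw] S a(1) by blast
  then have mv: "free_move a g x" using fg a by (simp add: free_move_def)
  have LM: "Lv k \<subseteq> univ M" using Lv_M fg(5) by simp
  have x: "x \<notin> ?S" using twinD(2)[OF tw] S by blast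
  have "emb I (induced M (insert x (?S - {g a}))) M (id(x := g a))"
    using twin_retract[OF M tw S(1) LM S(2)] .
  moreover have "f b \<noteq> g a" if "b \<in> univ A" for b
    using a(2) that by (metis imageI)
  then have "f ` univ A \<union> (g(a := x)) ` univ A \<subseteq> insert x (?S - {g a})"
    using a(1) EmbD(4)[OF fg(2)] by auto
  ultimately have "emb I (induced M (f ` univ A \<union> (g(a := x)) ` univ A)) M (id(x := g a))"
    by (rule emb_induced_subset)
  then have "c f = c (g(a := x)) \<longleftrightarrow> c f = c g"
    by (rule invariantI[OF fg(1) moved_in_Emb[OF mv] fg(1,2)]) (use x in auto)
  then show ?thesis using mv eq unfolding irrelevant_def by metis
qed

lemma rank_less:
  assumes "(a, b) \<in> less_rel A"
  shows "card {d. (b, d) \<in> less_rel A} < card {d. (a, d) \<in> less_rel A}"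
proof (rule psubset_card_mono)
  show "finite {d. (a, d) \<in> less_rel A}" using AD(1,6) by (auto intro: finite_subset)
  show "{d. (b, d) \<in> less_rel A} \<subset> {d. (a, d) \<in> less_rel A}"
    using assms AD(7,8) by blast
qed

text \<open>If \<open>g a\<close> is hit by \<open>f\<close>, it is hit at a larger argument, which is irrelevant by induction from
  the top and can be moved out of the way.\<close>

lemma irrelevant_if_less:
  assumes fg: "f \<in> Emb I A M" "g \<in> Emb I A M" "f ` univ A \<subseteq> Lv 0" "g ` univ A \<subseteq> Lv 0"
    and eq: "c f = c g"
  shows "a \<in> univ A \<Longrightarrow> (f a, g a) \<in> less_rel M \<Longrightarrow> irrelevant a"
proof (induction "card {d. (a, d) \<in> less_rel A}" arbitrary: a rule: less_induct)
  case less
  show ?case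
  proof (cases "g a \<in> f ` univ A")
    case False
    then show ?thesis using irrelevant_if_outside[OF fg _ eq less.prems(1)] N by auto
  next
    case True
    then obtain b where b: "b \<in> univ A" "g a = f b" by blast
    then have ab: "(a, b) \<in> less_rel A" using less.prems EmbD(3)[OF fg(1)] by auto
    then have "(f b, g b) \<in> less_rel M" using b less.prems(1) EmbD(3)[OF fg(2)] by metis
    then have irr: "irrelevant b" using less.hyps[OF rank_less[OF ab] b(1)] by blast
    have N0: "0 < N" "1 < N" using N by auto
    have "f b \<in> f ` univ A" using b by blast
    then obtain x where x: "x \<in> Lv 1" "twin I M (Lv 0) (f ` univ A) (f b) x"
      using twins[OF N0(1) fg(3)] by auto
    have "twin I M (f ` univ A) (f ` univ A) (f b) x"
      using twin_shrink[OF M x(2) subset_refl fg(3)] b by blast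
    then have mv: "free_move b f x" using fg b by (simp add: free_move_def)
    have L01: "Lv 0 \<subseteq> Lv 1" using Lv_Suc[OF N0(1)] by simp
    \<comment> \<open>Being outside \<open>Lv 0\<close>, the twin cannot hit \<open>g a\<close>
      again. The moved \<open>f\<close> reaches into \<open>Lv 1\<close>, so a twin over that level
      is needed next.\<close>
    have x0: "x \<notin> Lv 0" using twinD(2)[OF x(2)] .
    show ?thesis
    proof (rule irrelevant_if_outside[OF moved_in_Emb[OF mv] fg(2) _ _ N0(2) _ less.prems(1)])
      show "(f(b := x)) ` univ A \<subseteq> Lv 1" using fg(3) L01 x(1) by auto
      show "g ` univ A \<subseteq> Lv 1" using fg(4) L01 by blast
      show "c (f(b := x)) = c g" using irrelevantD[OF irr mv] eq by simp
      show "g a \<notin> (f(b := x)) ` univ A"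
        using b EmbD(4)[OF fg(1)] x0 fg(4) less.prems(1) by auto
    qed
  qed
qed

definition relevant :: "'a set" where
  "relevant = {a \<in> univ A. \<not> irrelevant a}"

text \<open>Equality of colours is symmetric, so \<open>irrelevant_if_less\<close> covers either
  order of the two values.\<close>

lemma agree_on_relevant:
  assumes fg: "f \<in> Emb I A M" "g \<in> Emb I A M" "f ` univ A \<subseteq> Lv 0" "g ` univ A \<subseteq> Lv 0"
    and eq: "c f = c g" and a: "a \<in> relevant"
  shows "f a = g a"
proof (rule ccontr)
  have a': "a \<in> univ A" "\<not> irrelevant a" using a by (auto simp: relevant_def)
  assume "f a \<noteq> g a"
  then consider "(f a, g a) \<in> less_rel M" | "(g a, f a) \<in> less_rel M"
    using MD(10) EmbD(1)[OF fg(1)] EmbD(1)[OF fg(2)] a'(1) by blast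
  then show False
    using irrelevant_if_less[OF fg eq] irrelevant_if_less[OF fg(2,1,4,3)] eq a' by metis
qed

section \<open>Bringing an embedding into general position\<close>

lemma max_exists:
  assumes "S \<noteq> {}"
  obtains a where "a \<in> S" "\<And>b. b \<in> S \<Longrightarrow> (a, b) \<notin> less_rel A"
proof -
  obtain s where "s \<in> S" using assms by blast
  then obtain a where a: "a \<in> S"
    "\<forall>b. b \<in> S \<longrightarrow> card {d. (a, d) \<in> less_rel A} \<le> card {d. (b, d) \<in> less_rel A}"
    using ex_has_least_nat[of "\<lambda>x. x \<in> S" s "\<lambda>a. card {d. (a, d) \<in> less_rel A}"] by blast
  then show thesis using that rank_less by (metis not_le)
qed

text \<open>Over \<open>Lv k\<close>, the comparisons of a moved element are those of the final
  segment generated by the relevant elements above it. Its tuples may still involve f(A): at the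
  time of the move, elements not yet moved had their old positions, and relations to these
  remain.\<close>

definition moved_above :: "nat \<Rightarrow> ('a \<Rightarrow> 'a) \<Rightarrow> ('a \<Rightarrow> 'a) \<Rightarrow> 'a \<Rightarrow> bool" where
  "moved_above k f \<phi> a \<longleftrightarrow> \<phi> a \<notin> Lv k \<and>
     (\<forall>y\<in>Lv k. (\<phi> a, y) \<in> less_rel M \<longleftrightarrow>
        (\<exists>j\<in>relevant. (a, j) \<in> less_rel A \<and> (f j = y \<or> (f j, y) \<in> less_rel M))) \<and>
     (\<forall>i\<in>I. \<forall>xs\<in>rel M i. set xs \<subseteq> Lv k \<union> \<phi> ` univ A \<longrightarrow> \<phi> a \<in> set xs \<longrightarrow>
        set xs \<subseteq> f ` univ A \<union> \<phi> ` univ A)"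

lemma moved_aboveD:
  assumes "moved_above k f \<phi> a"
  shows "\<phi> a \<notin> Lv k"
    and "y \<in> Lv k \<Longrightarrow> (\<phi> a, y) \<in> less_rel M \<longleftrightarrow>
        (\<exists>j\<in>relevant. (a, j) \<in> less_rel A \<and> (f j = y \<or> (f j, y) \<in> less_rel M))"
    and "i \<in> I \<Longrightarrow> xs \<in> rel M i \<Longrightarrow> set xs \<subseteq> Lv k \<union> \<phi> ` univ A \<Longrightarrow> \<phi> a \<in> set xs \<Longrightarrow>
        set xs \<subseteq> f ` univ A \<union> \<phi> ` univ A"
  using assms unfolding moved_above_def by blast+

lemma relevant_subset: "relevant \<subseteq> univ A"
  by (auto simp: relevant_def)

text \<open>The irrelevant elements are moved one at a time, from the top down, so that each new position
  lies above everything of \<open>Lv k\<close> below the next relevant element.\<close>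

lemma move_some:
  assumes f: "f \<in> Emb I A M" "f ` univ A \<subseteq> Lv k"
    and kN: "k + card (univ A - relevant) \<le> N"
  shows "n \<le> card (univ A - relevant) \<Longrightarrow> \<exists>T \<phi>. T \<subseteq> univ A - relevant \<and> card T = n \<and>
    (\<forall>a\<in>T. \<forall>b\<in>univ A - relevant. (a, b) \<in> less_rel A \<longrightarrow> b \<in> T) \<and>
    \<phi> \<in> Emb I A M \<and> \<phi> ` univ A \<subseteq> Lv (k + n) \<and> c \<phi> = c f \<and>
    (\<forall>a\<in>univ A - T. \<phi> a = f a) \<and> (\<forall>a\<in>T. moved_above k f \<phi> a)"
proof (induction n)
  case 0
  show ?case by (rule exI[of _ "{}"], rule exI[of _ f]) (use f in auto)
next
  case (Suc n)
  let ?U = "univ A - relevant"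
  obtain T \<phi> where T: "T \<subseteq> ?U" "card T = n"
    and up: "\<forall>a\<in>T. \<forall>b\<in>?U. (a, b) \<in> less_rel A \<longrightarrow> b \<in> T"
    and \<phi>: "\<phi> \<in> Emb I A M" "\<phi> ` univ A \<subseteq> Lv (k + n)" "c \<phi> = c f"
    and fix_\<phi>: "\<forall>a\<in>univ A - T. \<phi> a = f a" and mv_T: "\<forall>a\<in>T. moved_above k f \<phi> a"
    using Suc.IH Suc.prems by (elim meta_impE exE conjE) (simp, rule that)
  have finU: "finite ?U" "finite T" using AD(1) T(1) by (auto intro: finite_subset)
  have "?U - T \<noteq> {}" using Suc.prems T finU by (metis Diff_eq_empty_iff card_mono not_less_eq_eq)
  \<comment> \<open>For the largest unmoved element, every irrelevant element above it has been
    moved already.\<close>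
  then obtain a where a: "a \<in> ?U - T" and max: "\<And>b. b \<in> ?U - T \<Longrightarrow> (a, b) \<notin> less_rel A"
    using max_exists by metis
  have aA: "a \<in> univ A" "a \<notin> T" "a \<notin> relevant" using a by auto
  have irr: "irrelevant a" using aA by (auto simp: relevant_def)
  have knN: "k + n < N" using Suc.prems kN by simp
  have "\<phi> a \<in> \<phi> ` univ A" using aA by blast
  then obtain x where x: "x \<in> Lv (Suc (k + n))" and tw: "twin I M (Lv (k + n)) (\<phi> ` univ A) (\<phi> a) x"
    using twins[OF knN \<phi>(2)] by blast
  have "twin I M (\<phi> ` univ A) (\<phi> ` univ A) (\<phi> a) x"
    using twin_shrink[OF M tw subset_refl \<phi>(2)] aA by blast
  then have mv: "free_move a \<phi> x" using \<phi> aA by (simp add: free_move_def)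
  let ?\<phi> = "\<phi>(a := x)"
  have Lk: "Lv k \<subseteq> Lv (k + n)" using Lv_mono[of k "k + n"] knN by simp
  have xk: "x \<notin> Lv (k + n)" "x \<notin> Lv k" using twinD(2)[OF tw] Lk by auto
  have im: "?\<phi> ` univ A \<subseteq> insert x (\<phi> ` univ A)" "\<phi> ` univ A \<subseteq> insert (f a) (?\<phi> ` univ A)"
    using fix_\<phi> aA by auto
  \<comment> \<open>A tuple through the new twin lies in the current image. Any other tuple was
    already present before this move and may contain the old position of \<open>a\<close>, which is
    \<open>f a\<close>.\<close>
  have rels: "set xs \<subseteq> f ` univ A \<union> ?\<phi> ` univ A"
    if b: "b \<in> insert a T" and xs: "i \<in> I" "xs \<in> rel M i" "set xs \<subseteq> Lv k \<union> ?\<phi> ` univ A" "?\<phi> b \<in> set xs"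
    for b i xs
  proof (cases "x \<in> set xs")
    case True
    have "set xs \<subseteq> insert x (Lv (k + n))" using xs(3) Lk im(1) \<phi>(2) by blast
    then have "set xs \<subseteq> insert x (\<phi> ` univ A - {\<phi> a})"
      using twinD(4)[OF tw xs(1) _ True] xs(2) by blast
    also have "\<dots> \<subseteq> ?\<phi> ` univ A" using aA by auto
    finally show ?thesis by blast
  next
    case False
    then have b: "b \<in> T" "b \<noteq> a" using b xs(4) aA by auto
    have "set xs \<subseteq> Lv k \<union> \<phi> ` univ A"
    proof
      fix z assume z: "z \<in> set xs"
      then have "z \<in> Lv k \<or> z \<in> insert x (\<phi> ` univ A)" using xs(3) im(1) by (meson UnE subsetD)
      moreover have "z \<noteq> x" using z False by metis
      ultimately show "z \<in> Lv k \<union> \<phi> ` univ A" by simp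
    qed
    then have "set xs \<subseteq> f ` univ A \<union> \<phi> ` univ A"
      using moved_aboveD(3)[OF bspec[OF mv_T b(1)] xs(1,2)] xs(4) b(2) by simp
    then show ?thesis using im(2) aA by blast
  qed
  have ord: "(x, y) \<in> less_rel M \<longleftrightarrow>
        (\<exists>j\<in>relevant. (a, j) \<in> less_rel A \<and> (f j = y \<or> (f j, y) \<in> less_rel M))" if y: "y \<in> Lv k" for y
  proof
    assume "(x, y) \<in> less_rel M"
    then obtain b where b: "b \<in> univ A" "(\<phi> a, \<phi> b) \<in> less_rel M" "\<phi> b = y \<or> (\<phi> b, y) \<in> less_rel M"
      using twinD(3)[OF tw] y Lk by blast
    then have ab: "(a, b) \<in> less_rel A" using EmbD(3)[OF \<phi>(1) aA(1)] by blast
    show "\<exists>j\<in>relevant. (a, j) \<in> less_rel A \<and> (f j = y \<or> (f j, y) \<in> less_rel M)"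
    proof (cases "b \<in> relevant")
      case True
      then have "\<phi> b = f b" using fix_\<phi> T(1) b(1) by blast
      then show ?thesis using True ab b(3) by (intro bexI[of _ b]) auto
    next
      case False
      \<comment> \<open>A moved \<open>b\<close> has left \<open>Lv k\<close>, so
        \<open>\<phi> b\<close> is strictly below \<open>y\<close>, and the description of
        \<open>b\<close> provides a relevant element above \<open>b\<close> and hence above
        \<open>a\<close>.\<close>
      then have "b \<in> T" using max[of b] ab b(1) by blast
      note mvb = moved_aboveD[OF bspec[OF mv_T this]]
      then have "(\<phi> b, y) \<in> less_rel M" using b(3) y by blast
      then show ?thesis using mvb(2)[OF y] AD(8)[OF ab] by blast
    qed
  next
    assume "\<exists>j\<in>relevant. (a, j) \<in> less_rel A \<and> (f j = y \<or> (f j, y) \<in> less_rel M)"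
    then obtain j where j: "j \<in> relevant" "(a, j) \<in> less_rel A" "f j = y \<or> (f j, y) \<in> less_rel M" by blast
    then have "j \<in> univ A" "\<phi> j = f j" using fix_\<phi> T(1) relevant_subset by auto
    moreover from this have "(\<phi> a, \<phi> j) \<in> less_rel M" using EmbD(3)[OF \<phi>(1) aA(1)] j(2) by blast
    ultimately show "(x, y) \<in> less_rel M"
      using twinD(3)[OF tw subsetD[OF Lk y]] j(3) by (metis imageI)
  qed
  have mv_T': "moved_above k f ?\<phi> b" if b: "b \<in> insert a T" for b
  proof (cases "b = a")
    case True
    then show ?thesis using ord rels[OF b] xk(2) unfolding moved_above_def by (simp only: fun_upd_same) blast
  next
    case False
    then have "b \<in> T" using b by simp
    note mvb = moved_aboveD[OF bspec[OF mv_T this]]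
    show ?thesis using mvb(1,2) rels[OF b] False unfolding moved_above_def by simp
  qed
  show ?case
  proof (intro exI[of _ "insert a T"] exI[of _ ?\<phi>] conjI)
    show "insert a T \<subseteq> ?U" using a T(1) by blast
    show "card (insert a T) = Suc n" using T(2) aA finU by simp
    show "\<forall>b\<in>insert a T. \<forall>b'\<in>?U. (b, b') \<in> less_rel A \<longrightarrow> b' \<in> insert a T" using up max by blast
    show "?\<phi> \<in> Emb I A M" by (rule moved_in_Emb[OF mv])
    show "?\<phi> ` univ A \<subseteq> Lv (k + Suc n)" using im(1) \<phi>(2) x Lv_Suc[OF knN] by auto
    show "c ?\<phi> = c f" using irrelevantD[OF irr mv] \<phi>(3) by simp
    show "\<forall>b\<in>univ A - insert a T. ?\<phi> b = f b" using fix_\<phi> by simp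
    show "\<forall>b\<in>insert a T. moved_above k f ?\<phi> b" using mv_T' by blast
  qed
qed

lemma move_all:
  assumes f: "f \<in> Emb I A M" "f ` univ A \<subseteq> Lv k"
    and kN: "k + card (univ A - relevant) \<le> N"
  obtains \<phi> where "\<phi> \<in> Emb I A M" "\<phi> ` univ A \<subseteq> Lv (k + card (univ A - relevant))" "c \<phi> = c f"
    "\<forall>j\<in>relevant. \<phi> j = f j" "\<forall>a\<in>univ A - relevant. moved_above k f \<phi> a"
proof -
  let ?U = "univ A - relevant"
  obtain T \<phi> where T: "T \<subseteq> ?U" "card T = card ?U"
    and \<phi>: "\<phi> \<in> Emb I A M" "\<phi> ` univ A \<subseteq> Lv (k + card ?U)" "c \<phi> = c f"
     "\<forall>a\<in>univ A - T. \<phi> a = f a" "\<forall>a\<in>T. moved_above k f \<phi> a"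
    using move_some[OF f kN order_refl] by (elim exE conjE) (rule that)
  have "T = ?U" using T AD(1) by (intro card_subset_eq) auto
  then show thesis using that[OF \<phi>(1-3)] \<phi>(4,5) relevant_subset by blast
qed

text \<open>Apart from the relevant values, nothing of \<open>f\<close> occurs here. Embeddings with
  equal relevant part therefore have the same generic copies.\<close>

definition generic :: "('a \<Rightarrow> 'a) \<Rightarrow> ('a \<Rightarrow> 'a) \<Rightarrow> bool" where
  "generic f \<psi> \<longleftrightarrow> \<psi> \<in> Emb I A M \<and> (\<forall>j\<in>relevant. \<psi> j = f j) \<and>
     (\<forall>a\<in>univ A - relevant. \<psi> a \<notin> Lv 0 \<and>
       (\<forall>y\<in>Lv 0. (\<psi> a, y) \<in> less_rel M \<longleftrightarrow>
         (\<exists>j\<in>relevant. (a, j) \<in> less_rel A \<and> (f j = y \<or> (f j, y) \<in> less_rel M))) \<and>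
       (\<forall>i\<in>I. \<forall>xs\<in>rel M i. set xs \<subseteq> Lv 0 \<union> \<psi> ` univ A \<longrightarrow> \<psi> a \<in> set xs \<longrightarrow> set xs \<subseteq> \<psi> ` univ A))"

lemma genericD:
  assumes "generic f \<psi>"
  shows "\<psi> \<in> Emb I A M" "j \<in> relevant \<Longrightarrow> \<psi> j = f j"
    and "a \<in> univ A - relevant \<Longrightarrow> \<psi> a \<notin> Lv 0"
    and "a \<in> univ A - relevant \<Longrightarrow> y \<in> Lv 0 \<Longrightarrow> (\<psi> a, y) \<in> less_rel M \<longleftrightarrow>
         (\<exists>j\<in>relevant. (a, j) \<in> less_rel A \<and> (f j = y \<or> (f j, y) \<in> less_rel M))"
    and "a \<in> univ A - relevant \<Longrightarrow> i \<in> I \<Longrightarrow> xs \<in> rel M i \<Longrightarrow> set xs \<subseteq> Lv 0 \<union> \<psi> ` univ A \<Longrightarrow>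
       \<psi> a \<in> set xs \<Longrightarrow> set xs \<subseteq> \<psi> ` univ A"
  using assms unfolding generic_def by simp_all

text \<open>After one round the new elements are still related to the original copy of \<open>A\<close>;
  a second round makes them free from it.\<close>

lemma generic_exists:
  assumes f: "f \<in> Emb I A M" "f ` univ A \<subseteq> Lv 0"
  obtains \<psi> where "generic f \<psi>" "c \<psi> = c f"
proof -
  let ?U = "univ A - relevant" and ?m = "card (univ A - relevant)"
  have "?m \<le> card (univ A)" using AD(1) by (intro card_mono) auto
  then have m: "0 + ?m \<le> N" "?m + ?m \<le> N" using N by auto
  obtain \<phi> where \<phi>: "\<phi> \<in> Emb I A M" "\<phi> ` univ A \<subseteq> Lv (0 + ?m)" "c \<phi> = c f"
    and \<phi>_rel: "\<forall>j\<in>relevant. \<phi> j = f j" and \<phi>_mv: "\<forall>a\<in>?U. moved_above 0 f \<phi> a"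
    by (rule move_all[OF f m(1)], rule that)
  have \<phi>m: "\<phi> ` univ A \<subseteq> Lv ?m" using \<phi>(2) by simp
  obtain \<psi> where \<psi>: "\<psi> \<in> Emb I A M" "\<psi> ` univ A \<subseteq> Lv (?m + ?m)" "c \<psi> = c \<phi>"
    and \<psi>_rel: "\<forall>j\<in>relevant. \<psi> j = \<phi> j" and \<psi>_mv: "\<forall>a\<in>?U. moved_above ?m \<phi> \<psi> a"
    by (rule move_all[OF \<phi>(1) \<phi>m m(2)], rule that)
  have L0: "Lv 0 \<subseteq> Lv ?m" using Lv_mono[of 0 ?m] m by simp
  have "generic f \<psi>"
    unfolding generic_def
  proof (intro conjI ballI impI)
    fix a assume a: "a \<in> ?U"
    note mv = moved_aboveD[OF bspec[OF \<psi>_mv a]]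
    show "\<psi> a \<notin> Lv 0" using mv(1) L0 by blast
    show "(\<psi> a, y) \<in> less_rel M \<longleftrightarrow>
         (\<exists>j\<in>relevant. (a, j) \<in> less_rel A \<and> (f j = y \<or> (f j, y) \<in> less_rel M))" if "y \<in> Lv 0" for y
      using mv(2)[of y] that L0 \<phi>_rel by auto
    fix i xs assume xs: "i \<in> I" "xs \<in> rel M i" "set xs \<subseteq> Lv 0 \<union> \<psi> ` univ A" "\<psi> a \<in> set xs"
    have "set xs \<subseteq> \<phi> ` univ A \<union> \<psi> ` univ A" using mv(3)[OF xs(1,2) _ xs(4)] xs(3) L0 by blast
    \<comment> \<open>The first round removed all irrelevant elements from \<open>Lv 0\<close>, so
      what the intermediate copy has there is a relevant value, and both copies share it.\<close>
    moreover have "\<phi> b \<in> \<psi> ` univ A" if "b \<in> univ A" "\<phi> b \<in> Lv 0" for b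
    proof -
      have "b \<in> relevant" using moved_aboveD(1) \<phi>_mv that by blast
      then show ?thesis using \<psi>_rel that(1) by (metis imageI)
    qed
    ultimately show "set xs \<subseteq> \<psi> ` univ A" using xs(3) by blast
  qed (use \<psi> \<psi>_rel \<phi>_rel in auto)
  then show thesis using that \<psi>(3) \<phi>(3) by simp
qed

definition swap_generic :: "('a \<Rightarrow> 'a) \<Rightarrow> ('a \<Rightarrow> 'a) \<Rightarrow> ('a \<Rightarrow> 'a) \<Rightarrow> 'a \<Rightarrow> 'a" where
  "swap_generic g \<phi> \<psi> z = (if z \<in> g ` univ A then z else \<psi> (inv_into (univ A) \<phi> z))"

text \<open>The image of \<open>\<phi>\<close> meets g(A) only in relevant values, where
  \<open>\<psi>\<close> agrees, so the swap is consistent. A related tuple not inside g(A) contains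
  an irrelevant element of the generic copy and hence lies entirely in that copy.\<close>

lemma swap_generic:
  assumes g: "g \<in> Emb I A M" "g ` univ A \<subseteq> Lv 0" and \<phi>: "generic g \<phi>" and \<psi>: "generic g \<psi>"
  shows "a \<in> univ A \<Longrightarrow> swap_generic g \<phi> \<psi> (g a) = g a"
    and "a \<in> univ A \<Longrightarrow> swap_generic g \<phi> \<psi> (\<phi> a) = \<psi> a"
    and "i \<in> I \<Longrightarrow> xs \<in> rel M i \<Longrightarrow> set xs \<subseteq> \<phi> ` univ A \<union> g ` univ A \<Longrightarrow>
      map (swap_generic g \<phi> \<psi>) xs \<in> rel M i"
proof -
  let ?h = "swap_generic g \<phi> \<psi>"
  have \<phi>E: "\<phi> \<in> Emb I A M" and \<psi>E: "\<psi> \<in> Emb I A M" using \<phi> \<psi> by (auto simp: generic_def)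
  show hg: "?h (g a) = g a" if "a \<in> univ A" for a using that by (simp add: swap_generic_def)
  show h\<phi>: "?h (\<phi> a) = \<psi> a" if a: "a \<in> univ A" for a
  proof (cases "a \<in> relevant")
    case True
    then show ?thesis using \<phi> \<psi> hg[OF a] by (simp add: generic_def)
  next
    case False
    then have "\<phi> a \<notin> g ` univ A" using \<phi> g(2) a by (auto simp: generic_def)
    then show ?thesis
      using inv_into_f_f[OF emb_inj_on[OF A M Emb_emb[OF \<phi>E]] a] by (simp add: swap_generic_def)
  qed
  assume i: "i \<in> I" and xs: "xs \<in> rel M i" "set xs \<subseteq> \<phi> ` univ A \<union> g ` univ A"
  show "map ?h xs \<in> rel M i"
  proof (cases "set xs \<subseteq> g ` univ A")
    case True
    then have "map ?h xs = xs" using hg by (auto intro!: map_idI)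
    then show ?thesis using xs by simp
  next
    case False
    then obtain a where a: "a \<in> univ A" "\<phi> a \<in> set xs" "\<phi> a \<notin> g ` univ A" using xs(2) by blast
    then have aU: "a \<in> univ A - relevant" using genericD(2)[OF \<phi>, of a] by auto
    have "set xs \<subseteq> Lv 0 \<union> \<phi> ` univ A" using xs(2) g(2) by blast
    then have "set xs \<subseteq> \<phi> ` univ A" using genericD(5)[OF \<phi> aU i xs(1)] a(2) by blast
    then obtain bs where bs: "xs = map \<phi> bs" "set bs \<subseteq> univ A" by (rule list_in_image)
    have "map ?h xs = map \<psi> bs" using bs h\<phi> by auto
    then show ?thesis using EmbD(5)[OF \<phi>E i bs(2)] EmbD(5)[OF \<psi>E i bs(2)] xs(1) bs(1) by metis
  qed
qed

text \<open>Genericity determines every comparison and relation between the copy and g(A). So the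
  swap, which fixes g(A), is an embedding that carries the pair of \<open>\<phi>\<close> and
  \<open>g\<close> to the pair of \<open>\<psi>\<close> and \<open>g\<close>.\<close>

lemma generic_same_type:
  assumes g: "g \<in> Emb I A M" "g ` univ A \<subseteq> Lv 0" and \<phi>: "generic g \<phi>" and \<psi>: "generic g \<psi>"
  shows "c \<phi> = c g \<longleftrightarrow> c \<psi> = c g"
proof -
  let ?h = "swap_generic g \<phi> \<psi>" and ?D = "\<phi> ` univ A \<union> g ` univ A"
  note h = swap_generic[OF g \<phi> \<psi>] and h' = swap_generic[OF g \<psi> \<phi>]
  have \<phi>E: "\<phi> \<in> Emb I A M" and \<psi>E: "\<psi> \<in> Emb I A M" using \<phi> \<psi> by (auto simp: generic_def)
  have DM: "?D \<subseteq> univ M" using EmbD(2)[OF \<phi>E] EmbD(2)[OF g(1)] by blast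
  have less_iff: "(\<phi> a, g b) \<in> less_rel M \<longleftrightarrow> (\<psi> a, g b) \<in> less_rel M"
    if "a \<in> univ A - relevant" "b \<in> univ A" for a b
    using genericD(4)[OF \<phi> that(1), of "g b"] genericD(4)[OF \<psi> that(1), of "g b"] that(2) g(2) by auto
  have emb: "emb I (induced M ?D) M ?h"
  proof (rule emb_monoI[OF finite_ord_struct_induced[OF M DM] M])
    show "?h x \<in> univ M" if "x \<in> univ (induced M ?D)" for x
      using that h(1,2) EmbD(1)[OF \<psi>E] EmbD(1)[OF g(1)] by auto
    show "map ?h xs \<in> rel M i \<longleftrightarrow> xs \<in> rel (induced M ?D) i"
      if i: "i \<in> I" and "set xs \<subseteq> univ (induced M ?D)" for i xs
    proof -
      have xs: "set xs \<subseteq> ?D" using that by simp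
      \<comment> \<open>\<open>swap_generic\<close> only preserves relations. Swapping back from
        \<open>\<psi>\<close> to \<open>\<phi>\<close> is the inverse and yields the other
        direction.\<close>
      have "xs \<in> rel M i" if R: "map ?h xs \<in> rel M i"
      proof -
        have "set (map ?h xs) \<subseteq> \<psi> ` univ A \<union> g ` univ A" using xs h(1,2) by auto
        from h'(3)[OF i R this] have "map (swap_generic g \<psi> \<phi>) (map ?h xs) \<in> rel M i" .
        moreover have "swap_generic g \<psi> \<phi> (?h z) = z" if "z \<in> ?D" for z
          using that h(1,2) h'(1,2) by auto
        then have "map (swap_generic g \<psi> \<phi>) (map ?h xs) = xs" using xs by (auto intro!: map_idI)
        ultimately show ?thesis by simp
      qed
      then show ?thesis using h(3)[OF i] xs by auto
    qed
    show "(?h z, ?h w) \<in> less_rel M" if zw: "(z, w) \<in> less_rel (induced M ?D)" for z w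
    proof -
      have zw': "(z, w) \<in> less_rel M" using zw by simp
      have cases: "(\<exists>b\<in>univ A. z = g b) \<or> (\<exists>a\<in>univ A - relevant. z = \<phi> a)" if "z \<in> ?D" for z
        using that \<phi> relevant_subset by (auto simp: generic_def)
      have z: "(\<exists>b\<in>univ A. z = g b) \<or> (\<exists>a\<in>univ A - relevant. z = \<phi> a)"
        "(\<exists>b\<in>univ A. w = g b) \<or> (\<exists>a\<in>univ A - relevant. w = \<phi> a)"
        using cases zw by auto
      consider (gg) b b' where "b \<in> univ A" "b' \<in> univ A" "z = g b" "w = g b'"
        | (pg) a b where "a \<in> univ A - relevant" "b \<in> univ A" "z = \<phi> a" "w = g b"
        | (gp) a b where "a \<in> univ A - relevant" "b \<in> univ A" "z = g b" "w = \<phi> a"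
        | (pp) a a' where "a \<in> univ A" "a' \<in> univ A" "z = \<phi> a" "w = \<phi> a'"
        using z by blast
      then show ?thesis
      proof cases
        case gg
        then show ?thesis using zw' h(1) by simp
      next
        case pg
        then show ?thesis using zw' h(1,2) less_iff by auto
      next
        case gp
        then have "(\<phi> a, g b) \<notin> less_rel M" using zw' MD(9) by blast
        then have "(\<psi> a, g b) \<notin> less_rel M" using less_iff gp by blast
        moreover have "\<psi> a \<noteq> g b" using \<psi> gp g(2) by (auto simp: generic_def)
        ultimately have "(g b, \<psi> a) \<in> less_rel M"
          using MD(10)[of "\<psi> a" "g b"] EmbD(1)[OF \<psi>E] EmbD(1)[OF g(1)] gp by auto
        then show ?thesis using gp h(1,2) by auto
      next
        case pp
        then show ?thesis using zw' h(2) EmbD(3)[OF \<phi>E] EmbD(3)[OF \<psi>E] by auto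
      qed
    qed
  qed
  show ?thesis by (rule invariantI[OF \<phi>E g(1) \<psi>E g(1) emb]) (use h in auto)
qed

theorem canonical:
  assumes f: "f \<in> Emb I A M" "f ` univ A \<subseteq> Lv 0" and g: "g \<in> Emb I A M" "g ` univ A \<subseteq> Lv 0"
  shows "c f = c g \<longleftrightarrow> (\<forall>a\<in>relevant. f a = g a)"
proof
  assume "c f = c g"
  then show "\<forall>a\<in>relevant. f a = g a" using agree_on_relevant[OF f(1) g(1) f(2) g(2)] by blast
next
  assume eq: "\<forall>a\<in>relevant. f a = g a"
  obtain \<phi> where \<phi>: "generic f \<phi>" "c \<phi> = c f" using generic_exists[OF f] .
  obtain \<psi> where \<psi>: "generic g \<psi>" "c \<psi> = c g" using generic_exists[OF g] .
  have "generic g \<phi>" using \<phi>(1) eq unfolding generic_def by auto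
  from generic_same_type[OF g this \<psi>(1)] show "c f = c g" using \<phi>(2) \<psi>(2) by simp
qed

end

section \<open>Reduction to invariant colourings\<close>

definition homogeneous :: "'i set \<Rightarrow> ('a, 'i) ord_struct \<Rightarrow> ('a, 'i) ord_struct \<Rightarrow>
    (('a \<Rightarrow> 'c) \<Rightarrow> nat) \<Rightarrow> ('a \<Rightarrow> 'c) \<Rightarrow> ('a \<Rightarrow> 'a) \<Rightarrow> ('a \<Rightarrow> 'a) \<Rightarrow> bool" where
  "homogeneous I A M \<chi> w f g \<longleftrightarrow>
     (\<forall>h\<in>Emb I (induced M (f ` univ A \<union> g ` univ A)) M.
      \<forall>h'\<in>Emb I (induced M (f ` univ A \<union> g ` univ A)) M.
        \<chi> (compose (univ A) w (compose (univ A) h f)) = \<chi> (compose (univ A) w (compose (univ A) h g)) \<longleftrightarrow>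
        \<chi> (compose (univ A) w (compose (univ A) h' f)) = \<chi> (compose (univ A) w (compose (univ A) h' g)))"

text \<open>One pair at a time. A copy of the structure induced on f(A) \<union> g(A) gets one of
  two colours, according to whether the images of \<open>f\<close> and \<open>g\<close> have equal
  \<chi>-colour. The arrow makes this constant on a copy of the structure built for the earlier
  pairs. The induced structure lies in \<open>M\<close>, so no irreducible structure is new.\<close>

lemma homogeneous_on_pairs:
  fixes A M :: "('a::infinite, 'i) ord_struct"
  assumes M: "finite_ord_struct I r M"
    and Z: "finite Z" "Z \<subseteq> Emb I A M \<times> Emb I A M"
  shows "\<exists>C :: ('a, 'i) ord_struct. finite_ord_struct I r C \<and> irreducibles_within I r C {M} \<and>
    (\<forall>\<chi> :: ('a \<Rightarrow> 'a) \<Rightarrow> nat. \<exists>w\<in>Emb I M C. \<forall>(f, g)\<in>Z. homogeneous I A M \<chi> w f g)"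
  using Z
proof (induction Z rule: finite_induct)
  case empty
  have "irreducibles_within I r M {M}" by (auto simp: irreducibles_within_def)
  moreover have "Emb I M M \<noteq> {}" using restrict_in_Emb[OF emb_id[of I M]] by blast
  ultimately show ?case using M by (intro exI[of _ M]) auto
next
  case (insert z Z)
  obtain f g where z: "z = (f, g)" by (cases z)
  have fg: "emb I A M f" "emb I A M g" using insert.prems z by (auto simp: Emb_def)
  obtain C :: "('a, 'i) ord_struct" where C: "finite_ord_struct I r C" "irreducibles_within I r C {M}"
    and IH: "\<forall>\<chi> :: ('a \<Rightarrow> 'a) \<Rightarrow> nat. \<exists>w\<in>Emb I M C. \<forall>(f, g)\<in>Z. homogeneous I A M \<chi> w f g"
    using insert.IH insert.prems by auto
  define D where "D = induced M (f ` univ A \<union> g ` univ A)"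
  have DM: "f ` univ A \<union> g ` univ A \<subseteq> univ M" using embD(1)[OF fg(1)] embD(1)[OF fg(2)] by blast
  have D: "finite_ord_struct I r D" unfolding D_def by (rule finite_ord_struct_induced[OF M DM])
  obtain C' :: "('a, 'i) ord_struct" where C': "finite_ord_struct I r C'" "arrows I C' C D"
    "irreducibles_within I r C' {D, C}"
    using Nesetril_Rodl[OF D C(1)] .
  have D_M: "emb I D M id" unfolding D_def by (rule emb_induced[OF DM])
  have within: "irreducibles_within I r C' {M}"
    unfolding irreducibles_within_def
  proof (intro allI impI)
    fix F :: "('a, 'i) ord_struct" and \<phi>
    assume F: "finite_ord_struct I r F" "irreducible_struct I F" "emb I F C' \<phi>"
    then consider \<psi> where "emb I F D \<psi>" | \<psi> where "emb I F C \<psi>"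
      using C'(3) unfolding irreducibles_within_def by blast
    then show "\<exists>D\<in>{M}. \<exists>\<phi>. emb I F D \<phi>"
      using emb_comp[OF _ D_M] C(2) F(1,2) unfolding irreducibles_within_def by cases blast+
  qed
  show ?case
  proof (intro exI[of _ C'] conjI C'(1) within allI)
    fix \<chi> :: "('a \<Rightarrow> 'a) \<Rightarrow> nat"
    define \<delta> where "\<delta> = (\<lambda>k. \<chi> (compose (univ A) k f) = \<chi> (compose (univ A) k g))"
    obtain v where v: "v \<in> Emb I C C'"
      and mono: "\<forall>k\<in>Emb I D C. \<forall>k'\<in>Emb I D C. \<delta> (compose (univ D) v k) = \<delta> (compose (univ D) v k')"
      using C'(2)[unfolded arrows_def, THEN spec, of \<delta>] by (elim bexE)
    \<comment> \<open>The earlier pairs are treated inside the copy given by \<open>v\<close>, hence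
      for the colouring pulled back along \<open>v\<close>.\<close>
    obtain w where w: "w \<in> Emb I M C"
      and hom: "\<forall>(f, g)\<in>Z. homogeneous I A M (\<lambda>k. \<chi> (compose (univ A) v k)) w f g"
      using IH[THEN spec, of "\<lambda>k. \<chi> (compose (univ A) v k)"] by (elim bexE)
    let ?w = "compose (univ M) v w"
    have assoc: "compose (univ A) ?w (compose (univ A) h k) =
        compose (univ A) v (compose (univ A) w (compose (univ A) h k))"
      if h: "h \<in> Emb I (induced M (f' ` univ A \<union> g' ` univ A)) M"
        and k: "k ` univ A \<subseteq> f' ` univ A \<union> g' ` univ A" for h k f' g'
    proof (rule compose_assoc'[symmetric])
      show "compose (univ A) h k a \<in> univ M" if "a \<in> univ A" for a
        using embD(1)[OF Emb_emb[OF h], of "k a"] k that by (auto simp: compose_def)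
    qed
    have "homogeneous I A M \<chi> ?w f g"
      unfolding homogeneous_def D_def[symmetric]
    proof (intro ballI)
      fix h h' assume h: "h \<in> Emb I D M" "h' \<in> Emb I D M"
      have \<delta>: "\<delta> (compose (univ D) v (compose (univ D) w k)) \<longleftrightarrow>
          \<chi> (compose (univ A) ?w (compose (univ A) k f)) = \<chi> (compose (univ A) ?w (compose (univ A) k g))"
        if k: "k \<in> Emb I D M" for k
      proof -
        have "compose (univ A) (compose (univ D) v (compose (univ D) w k)) u =
            compose (univ A) ?w (compose (univ A) k u)" if "u ` univ A \<subseteq> univ D" for u
          using that embD(1)[OF Emb_emb[OF k]]
          by (auto simp: compose_def restrict_def fun_eq_iff image_subset_iff)
        then show ?thesis by (simp add: \<delta>_def D_def)
      qed
      have "compose (univ D) w k \<in> Emb I D C" if "k \<in> Emb I D M" for k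
        using compose_in_Emb[OF Emb_emb[OF that] Emb_emb[OF w]] .
      then show "\<chi> (compose (univ A) ?w (compose (univ A) h f)) = \<chi> (compose (univ A) ?w (compose (univ A) h g)) \<longleftrightarrow>
         \<chi> (compose (univ A) ?w (compose (univ A) h' f)) = \<chi> (compose (univ A) ?w (compose (univ A) h' g))"
        using mono \<delta>[OF h(1)] \<delta>[OF h(2)] h by blast
    qed
    moreover have "homogeneous I A M \<chi> ?w f' g'" if Z: "(f', g') \<in> Z" for f' g'
      unfolding homogeneous_def
    proof (intro ballI)
      fix h h' assume h: "h \<in> Emb I (induced M (f' ` univ A \<union> g' ` univ A)) M"
        "h' \<in> Emb I (induced M (f' ` univ A \<union> g' ` univ A)) M"
      show "\<chi> (compose (univ A) ?w (compose (univ A) h f')) = \<chi> (compose (univ A) ?w (compose (univ A) h g')) \<longleftrightarrow>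
         \<chi> (compose (univ A) ?w (compose (univ A) h' f')) = \<chi> (compose (univ A) ?w (compose (univ A) h' g'))"
        using hom[THEN bspec, OF Z, unfolded split homogeneous_def, THEN bspec, OF h(1), THEN bspec, OF h(2)]
        unfolding assoc[OF h(1) Un_upper1] assoc[OF h(1) Un_upper2]
          assoc[OF h(2) Un_upper1] assoc[OF h(2) Un_upper2] .
    qed
    ultimately have "\<forall>(f, g)\<in>insert z Z. homogeneous I A M \<chi> ?w f g" unfolding z by blast
    then show "\<exists>w\<in>Emb I M C'. \<forall>(f, g)\<in>insert z Z. homogeneous I A M \<chi> w f g"
      using compose_in_Emb[OF Emb_emb[OF w] Emb_emb[OF v]] by blast
  qed
qed

theorem canonical_Nesetril_Rodl:
  fixes A B :: "('a::infinite, 'i) ord_struct"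
  assumes A: "finite_ord_struct I r A" and B: "finite_ord_struct I r B"
  shows "\<exists>C :: ('a, 'i) ord_struct. finite_ord_struct I r C \<and> irreducibles_within I r C {B} \<and>
    (\<forall>\<chi> :: ('a \<Rightarrow> 'a) \<Rightarrow> nat. \<exists>w\<in>Emb I B C. \<exists>J\<subseteq>univ A. \<forall>f\<in>Emb I A B. \<forall>g\<in>Emb I A B.
       \<chi> (compose (univ A) w f) = \<chi> (compose (univ A) w g) \<longleftrightarrow> (\<forall>a\<in>J. f a = g a))"
proof -
  define N where "N = 2 * card (univ A) + 2"
  obtain M Lv where M: "finite_ord_struct I r M" "induced M (univ B) = B"
    "irreducibles_within I r M {B}" and Lv: "Lv 0 = univ B" "Lv N = univ M"
    "\<forall>k<N. Lv k \<subseteq> Lv (Suc k)" "\<forall>k\<le>N. Lv k \<subseteq> univ M"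
    and tw: "\<forall>k<N. \<forall>S d. S \<subseteq> Lv k \<longrightarrow> d \<in> S \<longrightarrow> (\<exists>x\<in>Lv (Suc k). twin I M (Lv k) S d x)"
    using twin_tower[OF B, of N] by (elim exE conjE) (rule that)
  have BM: "univ B \<subseteq> univ M" using Lv(1,4) by auto
  have B_M: "emb I B M id" using emb_induced[OF BM, of I] M(2) by simp
  have "finite (Emb I A M \<times> Emb I A M)" using finite_Emb[OF A M(1)] by simp
  from homogeneous_on_pairs[OF M(1) this subset_refl]
  obtain C :: "('a, 'i) ord_struct" where C: "finite_ord_struct I r C" "irreducibles_within I r C {M}"
    and hom: "\<forall>\<chi> :: ('a \<Rightarrow> 'a) \<Rightarrow> nat. \<exists>w\<in>Emb I M C. \<forall>(f, g)\<in>Emb I A M \<times> Emb I A M. homogeneous I A M \<chi> w f g"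
    by (elim exE conjE) (rule that)
  show ?thesis
  proof (intro exI[of _ C] conjI C(1) irreducibles_within_trans[OF C(2) M(3)] allI)
    fix \<chi> :: "('a \<Rightarrow> 'a) \<Rightarrow> nat"
    obtain w where w: "w \<in> Emb I M C"
      and pairs: "\<forall>(f, g)\<in>Emb I A M \<times> Emb I A M. homogeneous I A M \<chi> w f g"
      using hom[THEN spec, of \<chi>] by (elim bexE)
    define c where "c = (\<lambda>f. \<chi> (compose (univ A) w f))"
    interpret invariant_colouring I r A M Lv N c
    proof
      show "c f = c g \<longleftrightarrow> c f' = c g'"
        if f: "f \<in> Emb I A M" and g: "g \<in> Emb I A M"
          and h: "emb I (induced M (f ` univ A \<union> g ` univ A)) M h"
          and f': "f' = compose (univ A) h f" and g': "g' = compose (univ A) h g" for f g f' g' h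
      proof -
        let ?D = "f ` univ A \<union> g ` univ A"
        have "?D \<subseteq> univ M" using embD(1)[OF Emb_emb[OF f]] embD(1)[OF Emb_emb[OF g]] by blast
        \<comment> \<open>Homogeneity compares two embeddings of the union; the inclusion is taken
          as one of them, which leaves \<open>f\<close> and \<open>g\<close> themselves on that
          side.\<close>
        from restrict_in_Emb[OF emb_induced[OF this]]
        have id_D: "restrict id ?D \<in> Emb I (induced M ?D) M" by (simp only: induced_simps)
        have h_D: "restrict h ?D \<in> Emb I (induced M ?D) M" using restrict_in_Emb[OF h] by simp
        have eqs: "compose (univ A) (restrict id ?D) f = f" "compose (univ A) (restrict id ?D) g = g"
          using f g by (auto simp: compose_def restrict_def fun_eq_iff Emb_def extensional_def)
        have eqs': "compose (univ A) (restrict h ?D) f = f'" "compose (univ A) (restrict h ?D) g = g'"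
          unfolding f' g' by (auto simp: compose_def restrict_def fun_eq_iff)
        have "(f, g) \<in> Emb I A M \<times> Emb I A M" using f g by simp
        from pairs[THEN bspec, OF this, unfolded split homogeneous_def, THEN bspec, OF id_D, THEN bspec, OF h_D]
        show ?thesis unfolding eqs eqs' c_def .
      qed
    qed (use A M(1) Lv tw in \<open>auto simp: N_def\<close>)
    \<comment> \<open>The canonical description holds for embeddings into \<open>Lv 0\<close>, which
      is the universe of \<open>B\<close>, so \<open>w\<close> is restricted to
      \<open>B\<close>.\<close>
    let ?w = "compose (univ B) w id"
    have "\<chi> (compose (univ A) ?w f) = \<chi> (compose (univ A) ?w g) \<longleftrightarrow> (\<forall>a\<in>relevant. f a = g a)"
      if fg: "f \<in> Emb I A B" "g \<in> Emb I A B" for f g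
    proof -
      have in_M: "k \<in> Emb I A M" "k ` univ A \<subseteq> Lv 0" "compose (univ A) ?w k = compose (univ A) w k"
        if k: "k \<in> Emb I A B" for k
      proof -
        have kB: "k a \<in> univ B" if "a \<in> univ A" for a using embD(1)[OF Emb_emb[OF k] that] .
        then show "k ` univ A \<subseteq> Lv 0" using Lv(1) by blast
        show "k \<in> Emb I A M" using k emb_comp[OF Emb_emb[OF k] B_M] by (simp add: Emb_def)
        show "compose (univ A) ?w k = compose (univ A) w k"
          using kB by (auto simp: compose_def restrict_def fun_eq_iff)
      qed
      show ?thesis
        using canonical[OF in_M(1,2)[OF fg(1)] in_M(1,2)[OF fg(2)]]
        unfolding in_M(3)[OF fg(1)] in_M(3)[OF fg(2)] c_def .
    qed
    moreover have "?w \<in> Emb I B C" using compose_in_Emb[OF B_M Emb_emb[OF w]] .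
    ultimately show "\<exists>w\<in>Emb I B C. \<exists>J\<subseteq>univ A. \<forall>f\<in>Emb I A B. \<forall>g\<in>Emb I A B.
       \<chi> (compose (univ A) w f) = \<chi> (compose (univ A) w g) \<longleftrightarrow> (\<forall>a\<in>J. f a = g a)"
      using relevant_subset by (intro bexI[of _ ?w] exI[of _ relevant]) auto
  qed
qed

section \<open>Translation to the category\<close>

lemma embeddings_empty_iff:
  assumes "finite_ord_struct I r A" "finite_ord_struct I r B"
  shows "embeddings I r A B = {} \<longleftrightarrow> (\<nexists>\<phi>. emb I A B \<phi>)"
  unfolding embeddings_eq_Emb[OF assms] using restrict_in_Emb Emb_emb by fastforce

theorem theorem6p3:
  fixes I :: "'i set" and r :: "'i \<Rightarrow> nat"
    and \<F> :: "('a::infinite, 'i) ord_struct set"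
  assumes "\<And>F. F \<in> \<F> \<Longrightarrow> finite_ord_struct I r F"
    and "\<And>F. F \<in> \<F> \<Longrightarrow> irreducible_struct I F"
    and "finite I \<or> finite \<F>"
  shows "canonical_Ramsey_property (Forb (Rel_cat I r) \<F>)"
proof -
  let ?K = "Forb (Rel_cat I r) \<F> :: (('a, 'i) ord_struct, 'a \<Rightarrow> 'a) category"
  have Obj: "A \<in> Obj ?K \<longleftrightarrow> finite_ord_struct I r A \<and> (\<forall>F\<in>\<F>. \<nexists>\<phi>. emb I F A \<phi>)" for A
  proof (cases "finite_ord_struct I r A")
    case True
    then have "(\<forall>F\<in>\<F>. embeddings I r F A = {}) \<longleftrightarrow> (\<forall>F\<in>\<F>. \<nexists>\<phi>. emb I F A \<phi>)"
      using embeddings_empty_iff[OF assms(1)] by (intro ball_cong) auto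
    then show ?thesis using True by (simp add: Forb_def full_subcategory_def Rel_cat_def)
  qed (simp add: Forb_def full_subcategory_def Rel_cat_def)
  have Hom: "Hom ?K A B = Emb I A B" if "finite_ord_struct I r A" "finite_ord_struct I r B" for A B
    using embeddings_eq_Emb[OF that] by (simp add: Forb_def full_subcategory_def Rel_cat_def)
  have Comp: "Comp ?K A B C g f = compose (univ A) g f" for A B C g f
    by (simp add: Forb_def full_subcategory_def Rel_cat_def)
  show ?thesis
    unfolding canonical_Ramsey_property_def
  proof (intro ballI impI)
    fix A B assume AK: "A \<in> Obj ?K" and BK: "B \<in> Obj ?K"
    then have A: "finite_ord_struct I r A" and B: "finite_ord_struct I r B" by (auto simp: Obj)
    obtain C :: "('a, 'i) ord_struct" where C: "finite_ord_struct I r C" "irreducibles_within I r C {B}"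
      and can: "\<forall>\<chi> :: ('a \<Rightarrow> 'a) \<Rightarrow> nat. \<exists>w\<in>Emb I B C. \<exists>J\<subseteq>univ A. \<forall>f\<in>Emb I A B. \<forall>g\<in>Emb I A B.
       \<chi> (compose (univ A) w f) = \<chi> (compose (univ A) w g) \<longleftrightarrow> (\<forall>a\<in>J. f a = g a)"
      using canonical_Nesetril_Rodl[OF A B] by (elim exE conjE) (rule that)
    \<comment> \<open>A forbidden structure embedding into \<open>C\<close> would, being
      irreducible, embed into \<open>B\<close>.\<close>
    have "C \<in> Obj ?K"
      using C assms(1,2) BK unfolding Obj irreducibles_within_def by blast
    moreover have "can_arrow ?K C B A"
      unfolding can_arrow_def
    proof
      fix \<chi> :: "('a \<Rightarrow> 'a) \<Rightarrow> nat"
      obtain w J where w: "w \<in> Emb I B C" and J: "J \<subseteq> univ A"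
        and wJ: "\<forall>f\<in>Emb I A B. \<forall>g\<in>Emb I A B.
          \<chi> (compose (univ A) w f) = \<chi> (compose (univ A) w g) \<longleftrightarrow> (\<forall>a\<in>J. f a = g a)"
        using can[THEN spec, of \<chi>] by (elim bexE exE conjE) (rule that)
      \<comment> \<open>Composition with the inclusion of \<open>J\<close> turns agreement on
        \<open>J\<close> into an equation between morphisms. If \<open>J\<close> is empty,
        \<open>?Q\<close> is the empty structure and all copies get one colour. A forbidden
        structure in \<open>?Q\<close> would already be one in \<open>A\<close>.\<close>
      let ?Q = "induced A J" and ?q = "restrict id J"
      have Q: "finite_ord_struct I r ?Q" using finite_ord_struct_induced[OF A J] .
      have QK: "?Q \<in> Obj ?K"
        using Q AK emb_comp[OF _ emb_induced[OF J]] unfolding Obj by blast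
      have q: "?q \<in> Emb I ?Q A" using restrict_in_Emb[OF emb_induced[OF J]] by simp
      have "compose J f ?q = compose J g ?q \<longleftrightarrow> (\<forall>a\<in>J. f a = g a)" for f g :: "'a \<Rightarrow> 'a"
        by (auto simp: compose_def restrict_def fun_eq_iff)
      then show "\<exists>w\<in>Hom ?K B C. \<exists>Q\<in>Obj ?K. \<exists>q\<in>Hom ?K Q A. \<forall>f\<in>Hom ?K A B. \<forall>g\<in>Hom ?K A B.
          \<chi> (Comp ?K A B C w f) = \<chi> (Comp ?K A B C w g) \<longleftrightarrow> Comp ?K Q A B f q = Comp ?K Q A B g q"
        unfolding Comp
        using w wJ QK q by (intro bexI[of _ w] bexI[of _ ?Q] bexI[of _ ?q]) (auto simp: Hom A B C(1) Q)
    qed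
    ultimately show "\<exists>C\<in>Obj ?K. can_arrow ?K C B A" by blast
  qed
qed

end
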